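(* Let $G$ be a ribbon graph. Then $R(G;x,y,z,w)=R(D(G);x,y,z,w)$.
   Context: A ribbon graph $G=(V,E)$ is a surface with boundary, represented as the union of two finite sets of discs, the vertices $V$ and the edges $E$, such that: the vertices and edges intersect in disjoint line segments; each such line segment lies on the boundary of precisely one vertex and precisely one edge; every edge contains exactly two such line segments. For $A\subseteq E$, the following refer to the spanning ribbon subgraph $(V,A)$: $k(A)$ is its number of connected components, $f(A)$ its number of boundary components, $r(A)=|V|-k(A)$, $n(A)=|A|-r(A)$, $\gamma(A)=2k(A)-|V|+|A|-f(A)$ its Euler genus, and $t(A)=1$ if $(V,A)$ is non-orientable as a surface and $t(A)=0$ otherwise. $k(G)=k(E)$. The delta-matroid $D(G)$ has ground set $E$ and feasible sets the $A\subseteq E$ with $f(A)=k(G)$ (the edge sets of spanning quasi-trees). A delta-matroid is $D=(E,\mathcal{F})$ with $E$ a finite set and $\mathcal F$ a non-empty collection of subsets of $E$ (feasible sets) such that for all $X,Y\in\mathcal F$ and $u\in X\bigtriangleup Y$ there is $v\in X\bigtriangleup Y$ (possibly $v=u$) with $X\bigtriangleup\{u,v\}\in\mathcal F$. $D_{\min}$ and $D_{\max}$ are the matroids on $E$ whose bases are the feasible sets of minimum, respectively maximum, cardinality. $r_M$ denotes matroid rank, $r(M)=r_M(E)$, $n_M(A)=|A|-r_M(A)$. The width is $w(D)=r(D_{\max})-r(D_{\min})$. $D$ is even if all its feasible sets have sizes of the same parity. Deletion: if $e$ is not in every feasible set, $D\setminus e=(E-e,\{F\in\mathcal{F}\mid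 e\notin F\})$; if $e$ is in every feasible set (a coloop), $D\setminus e=(E-e,\{F-e\mid F\in\mathcal{F}\})$. Deleting a set of elements one at a time is independent of the order. The restriction is $D|A=D\setminus(E-A)$, and $w_D(A)=w(D|A)$. For a delta-matroid, $t(A)=0$ if $D|A$ is even and $t(A)=1$ otherwise. The Bollobás–Riordan polynomials, in $\mathbb{Z}[x,y,z,w]/\langle w^2-w\rangle$ (where $w$ is a variable), are $$R(G;x,y,z,w)=\sum_{A\subseteq E}(x-1)^{r(E)-r(A)}y^{n(A)}z^{\gamma(A)}w^{t(A)},$$ $$R(D;x,y,z,w)=\sum_{A\subseteq E}(x-1)^{r_{D_{\min}}(E)-r_{D_{\min}}(A)}y^{n_{D_{\min}}(A)}z^{w_D(A)}w^{t(A)}.$$ *)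

theory Defs
  imports "HOL-Analysis.Analysis" "HOL-Computational_Algebra.Polynomial"
begin

section \<open>Surfaces inside a Hausdorff space\<close>

definition is_disc :: "'a::t2_space set \<Rightarrow> bool" where
  "is_disc D \<longleftrightarrow> D homeomorphic cball (0::complex) 1"

definition is_segment :: "'a::t2_space set \<Rightarrow> bool" where
  "is_segment s \<longleftrightarrow> s homeomorphic {0..1::real}"

text \<open>The boundary of a surface is its boundary as a manifold (not the frontier in the ambient
  space): the points without a neighbourhood in \<open>S\<close> homeomorphic to the plane.\<close>

definition surface_boundary :: "'a::t2_space set \<Rightarrow> 'a set" where
  "surface_boundary S =
     {x \<in> S. \<nexists>U. openin (top_of_set S) U \<and> x \<in> U \<and> U homeomorphic (UNIV :: complex set)}"

text \<open>A Moebius band is the unit square with \<open>(0, t)\<close> identified with \<open>(1, 1 - t)\<close>. Since the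
  square is compact and the ambient space is Hausdorff, a continuous surjection \<open>q\<close> making exactly
  these identifications is automatically a quotient map.\<close>

definition moebius_band :: "'a::t2_space set \<Rightarrow> bool" where
  "moebius_band M \<longleftrightarrow>
     (\<exists>q :: real \<times> real \<Rightarrow> 'a.
        continuous_on ({0..1} \<times> {0..1}) q \<and> q ` ({0..1} \<times> {0..1}) = M \<and>
        (\<forall>p \<in> {0..1} \<times> {0..1}. \<forall>p' \<in> {0..1} \<times> {0..1}.
           q p = q p' \<longleftrightarrow>
             p = p' \<or> (\<exists>t. {p, p'} = {(0, t), (1, 1 - t)})))"

definition nonorientable :: "'a::t2_space set \<Rightarrow> bool" where
  "nonorientable S \<longleftrightarrow> (\<exists>M \<subseteq> S. moebius_band M)"

section \<open>Ribbon graphs\<close>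

text \<open>A ribbon graph is given by the set \<open>V\<close> of its vertices and the set \<open>E\<close> of its edges, each
  being a closed disc; the surface itself is the union of all of them. The line
  segments in which vertices and edges intersect are the connected components of the
  intersection of the union of the vertices with the union of the edges.\<close>

definition rg_segments :: "'a::t2_space set set \<Rightarrow> 'a set set \<Rightarrow> 'a set set" where
  "rg_segments V E = components (\<Union>V \<inter> \<Union>E)"

locale ribbon_graph =
  fixes V E :: "'a::t2_space set set"
  assumes finite_V: "finite V"
    and finite_E: "finite E"
    and vertex_disc: "v \<in> V \<Longrightarrow> is_disc v"
    and edge_disc: "e \<in> E \<Longrightarrow> is_disc e"
    and disjoint_V: "pairwise disjnt V"
    and disjoint_E: "pairwise disjnt E"
    and segments: "s \<in> rg_segments V E \<Longrightarrow> is_segment s"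
    and segment_vertex: "s \<in> rg_segments V E \<Longrightarrow> \<exists>!v. v \<in> V \<and> s \<subseteq> surface_boundary v"
    and segment_edge: "s \<in> rg_segments V E \<Longrightarrow> \<exists>!e. e \<in> E \<and> s \<subseteq> surface_boundary e"
    and two_segments: "e \<in> E \<Longrightarrow> card {s \<in> rg_segments V E. s \<subseteq> e} = 2"

text \<open>In the following, \<open>A\<close> is a set of edges and the parameters are those of the spanning ribbon
  subgraph \<open>(V, A)\<close>. For a ribbon graph none of the natural number subtractions truncates.\<close>

definition rg_surface :: "'a::t2_space set set \<Rightarrow> 'a set set \<Rightarrow> 'a set" where
  "rg_surface V A = \<Union>V \<union> \<Union>A"

definition rg_k :: "'a::t2_space set set \<Rightarrow> 'a set set \<Rightarrow> nat" where
  "rg_k V A = card (components (rg_surface V A))"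

definition rg_f :: "'a::t2_space set set \<Rightarrow> 'a set set \<Rightarrow> nat" where
  "rg_f V A = card (components (surface_boundary (rg_surface V A)))"

definition rg_rank :: "'a::t2_space set set \<Rightarrow> 'a set set \<Rightarrow> nat" where
  "rg_rank V A = card V - rg_k V A"

definition rg_nullity :: "'a::t2_space set set \<Rightarrow> 'a set set \<Rightarrow> nat" where
  "rg_nullity V A = card A - rg_rank V A"

definition rg_genus :: "'a::t2_space set set \<Rightarrow> 'a set set \<Rightarrow> nat" where
  "rg_genus V A = 2 * rg_k V A + card A - card V - rg_f V A"

definition rg_t :: "'a::t2_space set set \<Rightarrow> 'a set set \<Rightarrow> nat" where
  "rg_t V A = (if nonorientable (rg_surface V A) then 1 else 0)"

section \<open>Delta-matroids\<close>

text \<open>A set system consists of a ground set and a collection of feasible sets. The operations and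
  invariants below are given by formulas that make sense for any set system, but they are meant for
  those satisfying \<open>delta_matroid\<close>, for which no natural number subtraction truncates.\<close>

type_synonym 'e set_system = "'e set \<times> 'e set set"

definition delta_matroid :: "'e set_system \<Rightarrow> bool" where
  "delta_matroid D \<longleftrightarrow> (case D of (E, \<F>) \<Rightarrow>
     finite E \<and> \<F> \<noteq> {} \<and> \<F> \<subseteq> Pow E \<and>
     (\<forall>X \<in> \<F>. \<forall>Y \<in> \<F>. \<forall>u \<in> sym_diff X Y. \<exists>v \<in> sym_diff X Y. sym_diff X {u, v} \<in> \<F>))"

text \<open>Matroids are represented by their ground set and their collection of bases.\<close>

definition dm_min :: "'e set_system \<Rightarrow> 'e set_system" where
  "dm_min D = (fst D, {F \<in> snd D. \<forall>F' \<in> snd D. card F \<le> card F'})"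

definition dm_max :: "'e set_system \<Rightarrow> 'e set_system" where
  "dm_max D = (fst D, {F \<in> snd D. \<forall>F' \<in> snd D. card F' \<le> card F})"

definition matroid_indep :: "'e set_system \<Rightarrow> 'e set \<Rightarrow> bool" where
  "matroid_indep M I \<longleftrightarrow> (\<exists>B \<in> snd M. I \<subseteq> B)"

definition matroid_rank :: "'e set_system \<Rightarrow> 'e set \<Rightarrow> nat" where
  "matroid_rank M A = Max {card I | I. I \<subseteq> A \<and> matroid_indep M I}"

definition matroid_nullity :: "'e set_system \<Rightarrow> 'e set \<Rightarrow> nat" where
  "matroid_nullity M A = card A - matroid_rank M A"

definition dm_width :: "'e set_system \<Rightarrow> nat" where
  "dm_width D = matroid_rank (dm_max D) (fst D) - matroid_rank (dm_min D) (fst D)"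

definition dm_even :: "'e set_system \<Rightarrow> bool" where
  "dm_even D \<longleftrightarrow> (\<forall>F \<in> snd D. \<forall>F' \<in> snd D. even (card F) \<longleftrightarrow> even (card F'))"

definition dm_delete :: "'e \<Rightarrow> 'e set_system \<Rightarrow> 'e set_system" where
  "dm_delete e D =
     (fst D - {e},
      if \<forall>F \<in> snd D. e \<in> F then (\<lambda>F. F - {e}) ` snd D else {F \<in> snd D. e \<notin> F})"

text \<open>Restriction deletes the elements outside \<open>A\<close> one at a time, in some order. For a
  delta-matroid the result does not depend on the chosen order.\<close>

definition dm_restrict :: "'e set_system \<Rightarrow> 'e set \<Rightarrow> 'e set_system" where
  "dm_restrict D A = fold dm_delete (SOME es. distinct es \<and> set es = fst D - A) D"

definition dm_w :: "'e set_system \<Rightarrow> 'e set \<Rightarrow> nat" where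
  "dm_w D A = dm_width (dm_restrict D A)"

definition dm_t :: "'e set_system \<Rightarrow> 'e set \<Rightarrow> nat" where
  "dm_t D A = (if dm_even (dm_restrict D A) then 0 else 1)"

definition rg_delta_matroid :: "'a::t2_space set set \<Rightarrow> 'a set set \<Rightarrow> 'a set set_system" where
  "rg_delta_matroid V E = (E, {A. A \<subseteq> E \<and> rg_f V A = rg_k V E})"

section \<open>The Bollobas-Riordan polynomials\<close>

text \<open>The ring \<open>\<int>[x,y,z,w]\<close> is represented as \<open>\<int>[x][y][z][w]\<close>.\<close>

type_synonym poly4 = "int poly poly poly poly"

definition var_x :: poly4 where "var_x = [:[:[:[:0, 1:]:]:]:]"
definition var_y :: poly4 where "var_y = [:[:[:0, 1:]:]:]"
definition var_z :: poly4 where "var_z = [:[:0, 1:]:]"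
definition var_w :: poly4 where "var_w = [:0, 1:]"

definition cong_w :: "poly4 \<Rightarrow> poly4 \<Rightarrow> bool" where
  "cong_w p q \<longleftrightarrow> (var_w ^ 2 - var_w) dvd (p - q)"

lemma equivp_cong_w: "equivp cong_w"
proof (rule equivpI)
  show "reflp cong_w"
    by (simp add: reflp_def cong_w_def)
  show "symp cong_w"
    unfolding symp_def cong_w_def by (metis dvd_minus_iff minus_diff_eq)
  show "transp cong_w"
  proof (rule transpI)
    fix p q r assume "cong_w p q" "cong_w q r"
    then have "(var_w ^ 2 - var_w) dvd ((p - q) + (q - r))"
      unfolding cong_w_def by (rule dvd_add)
    then show "cong_w p r" by (simp add: cong_w_def)
  qed
qed

text \<open>The quotient \<open>\<int>[x,y,z,w]/\<langle>w\<^sup>2 - w\<rangle>\<close>; its elements are written as classes of polynomials.\<close>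

quotient_type br_ring = poly4 / cong_w
  by (rule equivp_cong_w)

definition BR_ribbon :: "'a::t2_space set set \<Rightarrow> 'a set set \<Rightarrow> br_ring" where
  "BR_ribbon V E = abs_br_ring
     (\<Sum>A \<in> Pow E. (var_x - 1) ^ (rg_rank V E - rg_rank V A) * var_y ^ rg_nullity V A *
        var_z ^ rg_genus V A * var_w ^ rg_t V A)"

definition BR_delta :: "'e set_system \<Rightarrow> br_ring" where
  "BR_delta D = abs_br_ring
     (\<Sum>A \<in> Pow (fst D).
        (var_x - 1) ^ (matroid_rank (dm_min D) (fst D) - matroid_rank (dm_min D) A) *
        var_y ^ matroid_nullity (dm_min D) A * var_z ^ dm_w D A * var_w ^ dm_t D A)"

end

theory Submission
  imports Defs "HOL-Library.Transitive_Closure_Table"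
begin

text \<open>
  Both polynomials are sums over the same edge sets \<open>A\<close>, and they agree term by term. Everything in
  either term is determined by three functions of \<open>A\<close>: the number \<open>k A\<close> of components of the surface
  \<open>(V, A)\<close>, the number \<open>f A\<close> of its boundary components, and its orientability.

  The delta-matroid knows these functions for the following reasons. If \<open>f F = k E\<close>, then \<open>F\<close> connects all
  that \<open>E\<close> connects, because \<open>k E \<le> k F \<le> f F\<close>; so the smallest feasible sets are the maximal spanning
  forests (\<open>min_quasi_trees\<close>) and \<open>D\<^sub>m\<^sub>i\<^sub>n\<close> is the cycle matroid. If a component has two boundary
  components, then some edge has one side on each of two different ones; its removal merges them and leaves
  the component connected. Repeating this inside \<open>A\<close> reaches a set \<open>F\<close> with \<open>f F = k A\<close> that has
  \<open>|A| - (f A - k A)\<close> elements, and none is larger because the Euler genus is monotone (\<open>large_quasi_tree\<close>, \<open>genus_mono\<close>). So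
  the width is the Euler genus, and restricting the delta-matroid to \<open>A\<close> gives the delta-matroid of
  \<open>(V, A)\<close>. In an orientable surface an additional edge always changes the number of boundary
  components by exactly one, so all feasible sets have sizes of one parity; in a non-orientable one some
  edge leaves that number of a spanning forest unchanged, which gives feasible sets of consecutive sizes.

  The three functions become combinatorial as follows. An edge meets the vertices in two segments, whose
  four end points are its flags. The segments cut the boundary circle of a vertex into gaps, each joining two
  flags. The boundary of \<open>(V, A)\<close> runs through all gaps, through the two free sides of every edge in \<open>A\<close>
  and through both segments of every other edge (\<open>boundary_pieces\<close>); vertices without segments add
  their whole circles. Hence, apart from these circles, \<open>f A\<close> counts the classes of flags under the union
  of two perfect matchings, one of which does not depend on \<open>A\<close>. Adding an edge
  exchanges two pairs on its four flags for two other pairs on the same flags, and the effect on the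
  count depends only on how the rest of the boundary pairs off these four flags
  (\<open>rest_pairing\<close>, \<open>coloured_pair\<close>). A two-colouring of the flags that alternates along gaps, along
  segments and along the sides of the edges in \<open>A\<close> is an orientation of \<open>(V, A)\<close>.

  Topology enters at three places. Invariance of domain identifies the boundary of the surface
  (\<open>embedded_boundary\<close>). A coloured surface contains no Moebius band: it can be immersed in the plane by
  mapping every vertex onto the unit disc and bending every edge into a band outside of it
  (\<open>balanced_immersion\<close>), while a Moebius band cannot be immersed in the plane
  (\<open>moebius_not_immersible\<close>). An uncolourable surface contains a Moebius band: a spanning forest can be
  coloured, some further edge violates the colouring, and the discs on the cycle that this edge closes
  are strips that can be glued to a Moebius band (\<open>moebius_from_edge\<close>).
\<close>


section \<open>Quasi-trees and the numbers of components and boundary components\<close>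

text \<open>The properties of component counts, boundary counts and non-orientability that the delta-matroid of the
quasi-trees depends on; \<open>t A\<close> is to say that the surface of \<open>A\<close> is not orientable.\<close>

locale surface_counts =
  fixes E :: "'e set" and k f :: "'e set \<Rightarrow> nat" and t :: "'e set \<Rightarrow> bool"
  assumes finite_ground: "finite E"
    and k_insert: "A \<subseteq> E \<Longrightarrow> e \<in> E \<Longrightarrow> k (insert e A) \<le> k A \<and> k A \<le> Suc (k (insert e A))"
    and k_closure: "A \<subseteq> B \<Longrightarrow> B \<subseteq> E \<Longrightarrow> e \<in> E \<Longrightarrow> k (insert e A) = k A \<Longrightarrow> k (insert e B) = k B"
    and f_empty: "f {} = k {}"
    and k_le_f: "A \<subseteq> E \<Longrightarrow> k A \<le> f A"
    and f_insert: "A \<subseteq> E \<Longrightarrow> e \<in> E \<Longrightarrow> f (insert e A) \<le> Suc (f A) \<and> f A \<le> Suc (f (insert e A))"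
    and f_bridge: "A \<subseteq> E \<Longrightarrow> e \<in> E \<Longrightarrow> k (insert e A) \<noteq> k A \<Longrightarrow> f A = Suc (f (insert e A))"
    and f_merge: "A \<subseteq> E \<Longrightarrow> k A < f A \<Longrightarrow> \<exists>e\<in>A. f A = Suc (f (A - {e}))"
    and f_orientable: "insert e X \<subseteq> A \<Longrightarrow> A \<subseteq> E \<Longrightarrow> \<not> t A \<Longrightarrow> e \<notin> X \<Longrightarrow> f (insert e X) \<noteq> f X"
    and f_nonorientable: "A \<subseteq> E \<Longrightarrow> t A \<Longrightarrow>
      \<exists>T e. insert e T \<subseteq> A \<and> e \<notin> T \<and> f T = k A \<and> f (insert e T) = k A"
begin

definition quasi_trees :: "'e set \<Rightarrow> 'e set_system" where
  "quasi_trees A = (A, {F. F \<subseteq> A \<and> f F = k A})"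

lemma finite_sub: "A \<subseteq> E \<Longrightarrow> finite A"
  using finite_ground finite_subset by blast

lemma k_Un: "finite C \<Longrightarrow> A \<subseteq> E \<Longrightarrow> C \<subseteq> E \<Longrightarrow> k (A \<union> C) \<le> k A \<and> k A \<le> k (A \<union> C) + card C"
proof (induction C rule: finite_induct)
  case (insert e C)
  then show ?case using k_insert[of "A \<union> C" e] by auto
qed simp

lemma k_antimono: "A \<subseteq> B \<Longrightarrow> B \<subseteq> E \<Longrightarrow> k B \<le> k A"
  using k_Un[of B A] finite_sub[of B] by (simp add: Un_absorb1)

lemma k_le_card_diff: "A \<subseteq> B \<Longrightarrow> B \<subseteq> E \<Longrightarrow> k A \<le> k B + card (B - A)"
  using k_Un[of "B - A" A] finite_sub[of B] by (simp add: Un_absorb1 subset_trans[of "B - A" B E])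

text \<open>Every edge of a forest joins two different components of the preceding ones, so the number of
components falls from its value on the empty set by one per edge.\<close>

definition forest :: "'e set \<Rightarrow> bool" where
  "forest T \<longleftrightarrow> T \<subseteq> E \<and> card T + k T = k {}"

lemma k_empty_le: "A \<subseteq> E \<Longrightarrow> k {} \<le> card A + k A"
  using k_le_card_diff[of "{}" A] by simp

lemma forest_subset: "forest T \<Longrightarrow> Y \<subseteq> T \<Longrightarrow> forest Y"
proof -
  assume T: "forest T" and Y: "Y \<subseteq> T"
  then have E: "T \<subseteq> E" "Y \<subseteq> E" by (auto simp: forest_def)
  have "card (T - Y) = card T - card Y" "card Y \<le> card T"
    using Y E finite_sub card_Diff_subset card_mono by metis+
  then show ?thesis
    using T k_empty_le[OF E(2)] k_le_card_diff[OF Y E(1)] E by (auto simp: forest_def)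
qed

text \<open>All edges of a forest are bridges, and a bridge merges two boundary components just as it merges two
components.\<close>

lemma forest_f: "forest T \<Longrightarrow> f T = k T"
proof -
  assume T: "forest T"
  then have "finite T" using finite_sub by (auto simp: forest_def)
  then show ?thesis using T
  proof (induction T rule: finite_induct)
    case empty then show ?case by (simp add: f_empty)
  next
    case (insert e T)
    have T: "forest T" using insert.prems forest_subset by blast
    then have "k (insert e T) \<noteq> k T" using insert by (auto simp: forest_def)
    then show ?case
      using f_bridge[of T e] insert T k_insert[of T e] by (auto simp: forest_def)
  qed
qed

lemma forest_extend:
  assumes "A \<subseteq> E" "X \<subseteq> A" "forest X"
  shows "\<exists>T. X \<subseteq> T \<and> T \<subseteq> A \<and> forest T \<and> k T = k A"
  using assms
proof (induction "card (A - X)" arbitrary: X rule: less_induct)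
  case less
  show ?case
  proof (cases "\<forall>e\<in>A - X. k (insert e X) = k X")
    case True
    have "k (X \<union> C) = k X" if "finite C" "C \<subseteq> A" for C
      using that
    proof (induction C rule: finite_induct)
      case (insert e C)
      have "k (insert e X) = k X" using True insert.prems by (cases "e \<in> X") (auto simp: insert_absorb)
      then show ?case using k_closure[of X "X \<union> C" e] insert less.prems by auto
    qed simp
    from this[of A] have "k A = k X" using less.prems finite_sub by (simp add: Un_absorb1)
    then show ?thesis using less.prems by auto
  next
    case False
    then obtain e where e: "e \<in> A" "e \<notin> X" "k (insert e X) \<noteq> k X" by auto
    have fin: "finite A" using less.prems finite_sub by blast
    have "forest (insert e X)"
      using e less.prems k_insert[of X e] finite_subset[OF less.prems(2) fin] by (auto simp: forest_def)
    moreover have "card (A - insert e X) < card (A - X)"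
      using e fin by (intro psubset_card_mono) auto
    ultimately show ?thesis using less.hyps[of "insert e X"] less.prems e by auto
  qed
qed

lemma forest_empty: "forest {}" by (simp add: forest_def)

text \<open>From \<open>k A \<le> k F \<le> f F\<close>.\<close>

lemma quasi_tree_connected:
  assumes "A \<subseteq> E" "F \<subseteq> A" "f F = k A"
  shows "k F = k A" "k {} \<le> card F + k A"
proof -
  have FE: "F \<subseteq> E" using assms by auto
  show k: "k F = k A" using k_antimono[OF assms(2,1)] k_le_f[OF FE] assms(3) by simp
  show "k {} \<le> card F + k A" using k k_empty_le[OF FE] by simp
qed

text \<open>A quasi-tree has at least \<open>k {} - k A\<close> edges since every edge reduces the number of components by at
most one, and equality means that each edge is a bridge.\<close>

lemma min_quasi_trees:
  assumes A: "A \<subseteq> E"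
  shows "snd (dm_min (quasi_trees A)) = {F. F \<subseteq> A \<and> forest F \<and> k F = k A}"
proof -
  obtain T where T: "T \<subseteq> A" "forest T" "k T = k A"
    using forest_extend[OF A _ forest_empty] by auto
  have fT: "f T = k A" using forest_f T by simp
  show ?thesis
  proof (intro set_eqI iffI)
    fix F assume "F \<in> snd (dm_min (quasi_trees A))"
    then have F: "F \<subseteq> A" "f F = k A" and min: "card F \<le> card T"
      using T fT by (auto simp: dm_min_def quasi_trees_def)
    note q = quasi_tree_connected[OF A F]
    then show "F \<in> {F. F \<subseteq> A \<and> forest F \<and> k F = k A}"
      using F T A min by (auto simp: forest_def)
  next
    fix F assume "F \<in> {F. F \<subseteq> A \<and> forest F \<and> k F = k A}"
    then have F: "F \<subseteq> A" "forest F" "k F = k A" by auto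
    moreover have "card F \<le> card F'" if "F' \<subseteq> A" "f F' = k A" for F'
      using quasi_tree_connected[OF A that] F by (auto simp: forest_def)
    ultimately show "F \<in> snd (dm_min (quasi_trees A))"
      by (auto simp: dm_min_def quasi_trees_def forest_f)
  qed
qed

lemma rank_min_quasi_trees:
  assumes B: "B \<subseteq> E" and A: "A \<subseteq> B"
  shows "matroid_rank (dm_min (quasi_trees B)) A = k {} - k A"
proof -
  have AE: "A \<subseteq> E" and fin: "finite A" using assms finite_sub by auto
  let ?S = "{card I | I. I \<subseteq> A \<and> matroid_indep (dm_min (quasi_trees B)) I}"
  have finS: "finite ?S"
    by (rule finite_subset[of _ "card ` Pow A"]) (use fin in auto)
  obtain T where T: "T \<subseteq> A" "forest T" "k T = k A"
    using forest_extend[OF AE _ forest_empty] by auto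
  obtain T' where T': "T \<subseteq> T'" "T' \<subseteq> B" "forest T'" "k T' = k B"
    using forest_extend[OF B _ T(2)] T A by auto
  have "k {} - k A = card T" using T by (auto simp: forest_def)
  then have mem: "k {} - k A \<in> ?S"
    using T T' by (auto simp: matroid_indep_def min_quasi_trees[OF B])
  have "x \<le> k {} - k A" if x: "x \<in> ?S" for x
  proof -
    obtain I F where I: "x = card I" "I \<subseteq> A" "I \<subseteq> F" "forest F"
      using x by (auto simp: matroid_indep_def min_quasi_trees[OF B])
    have "forest I" using forest_subset I by blast
    moreover have "k A \<le> k I" using k_antimono I AE by blast
    ultimately show ?thesis using I by (auto simp: forest_def)
  qed
  with finS mem show ?thesis unfolding matroid_rank_def by (intro Max_eqI)
qed

text \<open>The Euler genus does not decrease when an edge is added: a bridge leaves it unchanged, and any other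
edge adds one to the number of edges and at most one to the number of boundary components. The inequality
is written without subtractions.\<close>

lemma genus_mono:
  assumes "F \<subseteq> B" "B \<subseteq> E"
  shows "2 * k F + card F + f B \<le> 2 * k B + card B + f F"
proof -
  have "2 * k F + card F + f (F \<union> C) \<le> 2 * k (F \<union> C) + card (F \<union> C) + f F"
    if "finite C" "C \<subseteq> B - F" for C
    using that
  proof (induction C rule: finite_induct)
    case (insert e C)
    have E: "F \<union> C \<subseteq> E" "e \<in> E" and n: "e \<notin> F \<union> C" using insert assms by auto
    have "finite (F \<union> C)" using E finite_sub by blast
    then have "card (F \<union> insert e C) = Suc (card (F \<union> C))" using n by simp
    moreover have "2 * k (F \<union> C) + f (F \<union> insert e C) \<le> 2 * k (F \<union> insert e C) + 1 + f (F \<union> C)"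
      using f_insert[OF E] k_insert[OF E] f_bridge[OF E]
      by (cases "k (insert e (F \<union> C)) = k (F \<union> C)") auto
    ultimately show ?case using insert by auto
  qed simp
  from this[of "B - F"] show ?thesis using assms finite_sub by (simp add: Un_absorb1)
qed

text \<open>As long as there are more boundary components than components, removing a suitable edge merges two of
them; that edge is no bridge, as the removal of a bridge would create a boundary component.\<close>

lemma large_quasi_tree:
  assumes "A \<subseteq> E" "B \<subseteq> A" "k B = k A"
  shows "\<exists>F\<subseteq>B. f F = k A \<and> card F + f B = card B + k A"
  using assms
proof (induction "f B" arbitrary: B rule: less_induct)
  case less
  have BE: "B \<subseteq> E" using less.prems by auto
  show ?case
  proof (cases "k A < f B")
    case True
    then obtain e where e: "e \<in> B" "f B = Suc (f (B - {e}))" using f_merge[OF BE] less.prems by auto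
    have BeE: "B - {e} \<subseteq> E" "e \<in> E" using BE e by auto
    have "insert e (B - {e}) = B" using e by auto
    then have "k (B - {e}) = k A"
      using f_bridge[OF BeE] e less.prems by fastforce
    then obtain F where "F \<subseteq> B - {e}" "f F = k A" "card F + f (B - {e}) = card (B - {e}) + k A"
      using less.hyps[of "B - {e}"] e less.prems by auto
    moreover have "Suc (card (B - {e})) = card B"
      using e(1) finite_sub[OF BE] by (intro card_Suc_Diff1)
    ultimately show ?thesis using e by (intro exI[of _ F]) auto
  next
    case False
    then show ?thesis using k_le_f[OF BE] less.prems by (intro exI[of _ B]) auto
  qed
qed

lemma rank_max_quasi_trees:
  assumes A: "A \<subseteq> E"
  shows "matroid_rank (dm_max (quasi_trees A)) A + f A = card A + k A"
proof -
  have fin: "finite A" using assms finite_sub by auto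
  let ?S = "{card I | I. I \<subseteq> A \<and> matroid_indep (dm_max (quasi_trees A)) I}"
  have finS: "finite ?S"
    by (rule finite_subset[of _ "card ` Pow A"]) (use fin in auto)
  obtain F where F: "F \<subseteq> A" "f F = k A" "card F + f A = card A + k A"
    using large_quasi_tree[OF A order_refl] by auto
  have bound: "card F' \<le> card F" if "F' \<subseteq> A" "f F' = k A" for F'
    using genus_mono[OF that(1) A] quasi_tree_connected[OF A that] that F by simp
  then have FB: "F \<in> snd (dm_max (quasi_trees A))"
    using F by (auto simp: dm_max_def quasi_trees_def)
  have "Max ?S = card F"
  proof (rule Max_eqI[OF finS])
    show "card F \<in> ?S" using F FB by (auto simp: matroid_indep_def)
    fix x assume "x \<in> ?S"
    then obtain I F' where I: "x = card I" "I \<subseteq> F'" "F' \<subseteq> A" "f F' = k A"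
      by (auto simp: matroid_indep_def dm_max_def quasi_trees_def)
    then show "x \<le> card F" using bound[of F'] card_mono[of F' I] finite_subset[OF I(3) fin] by simp
  qed
  then show ?thesis using F by (simp add: matroid_rank_def)
qed

lemma width_quasi_trees:
  assumes A: "A \<subseteq> E"
  shows "dm_width (quasi_trees A) = 2 * k A + card A - k {} - f A"
  using rank_max_quasi_trees[OF A] rank_min_quasi_trees[OF A order_refl] k_antimono[OF _ A, of "{}"]
  by (simp add: dm_width_def quasi_trees_def)

text \<open>In the orientable case \<open>f F + |F|\<close> has the same parity for all \<open>F\<close>, since each edge changes the
number of boundary components by exactly one.\<close>

lemma even_quasi_trees:
  assumes A: "A \<subseteq> E"
  shows "dm_even (quasi_trees A) \<longleftrightarrow> \<not> t A"
proof
  assume ev: "dm_even (quasi_trees A)"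
  show "\<not> t A"
  proof
    assume "t A"
    then obtain T e where T: "insert e T \<subseteq> A" "e \<notin> T" "f T = k A" "f (insert e T) = k A"
      using f_nonorientable[OF A] by blast
    have "finite T" using T A finite_sub by (meson insert_subset subset_trans)
    then have "even (card (insert e T)) \<noteq> even (card T)" using T by simp
    moreover have "even (card (insert e T)) = even (card T)"
      using ev T by (auto simp: dm_even_def quasi_trees_def)
    ultimately show False by simp
  qed
next
  assume nt: "\<not> t A"
  have par: "even (f F + card F) \<longleftrightarrow> even (f {})" if "finite F" "F \<subseteq> A" for F
    using that
  proof (induction F rule: finite_induct)
    case (insert e F)
    have "f (insert e F) \<noteq> f F" using f_orientable[OF _ A nt] insert by auto
    then have "f (insert e F) = Suc (f F) \<or> f F = Suc (f (insert e F))"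
      using f_insert[of F e] insert A by fastforce
    then show ?case using insert by auto
  qed simp
  have "even (card F) \<longleftrightarrow> even (card F')"
    if "F \<subseteq> A" "f F = k A" "F' \<subseteq> A" "f F' = k A" for F F'
    using par[of F] par[of F'] that A finite_sub[of F] finite_sub[of F'] by auto
  then show "dm_even (quasi_trees A)" by (auto simp: dm_even_def quasi_trees_def)
qed

text \<open>The two cases in the definition of deletion match the two kinds of edges. A non-bridge is avoided by some
spanning forest, hence by some feasible set. A bridge lies in all feasible sets, and taking it out of a
feasible set raises both the number of components of the whole and the number of boundary components by
one.\<close>

lemma delete_quasi_trees:
  assumes A: "A \<subseteq> E" and e: "e \<in> A"
  shows "dm_delete e (quasi_trees A) = quasi_trees (A - {e})"
proof -
  have Ae: "A - {e} \<subseteq> E" "e \<in> E" and ins: "insert e (A - {e}) = A" using A e by auto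
  have kA: "k A \<le> k (A - {e})" using k_antimono[OF _ A, of "A - {e}"] by auto
  show ?thesis
  proof (cases "k (A - {e}) = k A")
    case True
    obtain T where T: "T \<subseteq> A - {e}" "forest T" "k T = k (A - {e})"
      using forest_extend[OF Ae(1) _ forest_empty] by auto
    then have "\<not> (\<forall>F\<in>snd (quasi_trees A). e \<in> F)"
      using True forest_f[OF T(2)] by (auto simp: quasi_trees_def)
    then have "dm_delete e (quasi_trees A) = (A - {e}, {F \<in> snd (quasi_trees A). e \<notin> F})"
      unfolding dm_delete_def by (auto simp: quasi_trees_def)
    also have "\<dots> = quasi_trees (A - {e})" using True by (auto simp: quasi_trees_def)
    finally show ?thesis .
  next
    case False
    have sep: "k (insert e F) \<noteq> k F" if "F \<subseteq> A - {e}" for F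
      using k_closure[OF that Ae] False ins by auto
    have kA': "k (A - {e}) = Suc (k A)" using False k_insert[OF Ae] ins kA by auto
    have fF: "f F = Suc (f (insert e F))" if "F \<subseteq> A - {e}" for F
      using f_bridge[of F e] sep[OF that] that Ae by auto
    have all: "\<forall>F\<in>snd (quasi_trees A). e \<in> F"
    proof
      fix F assume "F \<in> snd (quasi_trees A)"
      then have F: "F \<subseteq> A" "f F = k A" by (auto simp: quasi_trees_def)
      show "e \<in> F"
      proof (rule ccontr)
        assume "e \<notin> F"
        then have "F \<subseteq> A - {e}" using F by auto
        then have "k (A - {e}) \<le> k F" "k F \<le> f F" using k_antimono k_le_f Ae by auto
        then show False using F kA' by simp
      qed
    qed
    have "(\<lambda>F. F - {e}) ` snd (quasi_trees A) = snd (quasi_trees (A - {e}))"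
    proof (intro set_eqI iffI)
      fix F assume "F \<in> (\<lambda>F. F - {e}) ` snd (quasi_trees A)"
      then obtain F' where F': "F = F' - {e}" "F' \<subseteq> A" "f F' = k A" "e \<in> F'"
        using all by (auto simp: quasi_trees_def)
      then show "F \<in> snd (quasi_trees (A - {e}))"
        using fF[of F] kA' by (auto simp: quasi_trees_def insert_absorb)
    next
      fix F assume "F \<in> snd (quasi_trees (A - {e}))"
      then have F: "F \<subseteq> A - {e}" "f F = Suc (k A)" using kA' by (auto simp: quasi_trees_def)
      then have "insert e F \<in> snd (quasi_trees A)" using fF[OF F(1)] e by (auto simp: quasi_trees_def)
      moreover have "F = insert e F - {e}" using F by auto
      ultimately show "F \<in> (\<lambda>F. F - {e}) ` snd (quasi_trees A)" by blast
    qed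
    then show ?thesis using all by (simp add: dm_delete_def quasi_trees_def)
  qed
qed

lemma fold_delete_quasi_trees:
  "distinct es \<Longrightarrow> set es \<subseteq> A \<Longrightarrow> A \<subseteq> E \<Longrightarrow> fold dm_delete es (quasi_trees A) = quasi_trees (A - set es)"
proof (induction es arbitrary: A)
  case (Cons e es)
  have "set es \<subseteq> A - {e}" "A - {e} \<subseteq> E" using Cons.prems by auto
  then have "fold dm_delete es (quasi_trees (A - {e})) = quasi_trees (A - {e} - set es)"
    using Cons by simp
  moreover have "A - {e} - set es = A - set (e # es)" by auto
  ultimately show ?case using Cons.prems delete_quasi_trees[of A e] by simp
qed simp

lemma restrict_quasi_trees:
  assumes A: "A \<subseteq> E"
  shows "dm_restrict (quasi_trees E) A = quasi_trees A"
proof -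
  let ?es = "SOME es. distinct es \<and> set es = E - A"
  have "\<exists>es. distinct es \<and> set es = E - A"
    using finite_distinct_list[of "E - A"] finite_ground by auto
  then have es: "distinct ?es \<and> set ?es = E - A" by (rule someI_ex)
  then have "fold dm_delete ?es (quasi_trees E) = quasi_trees (E - (E - A))"
    using fold_delete_quasi_trees[of ?es E] by auto
  moreover have "E - (E - A) = A" using A by auto
  ultimately show ?thesis by (simp add: dm_restrict_def quasi_trees_def)
qed

theorem BR_quasi_trees:
  "BR_delta (quasi_trees E) = abs_br_ring
     (\<Sum>A \<in> Pow E. (var_x - 1) ^ ((k {} - k E) - (k {} - k A)) * var_y ^ (card A - (k {} - k A)) *
        var_z ^ (2 * k A + card A - k {} - f A) * var_w ^ (if t A then 1 else 0))"
proof -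
  have fst: "fst (quasi_trees E) = E" by (simp add: quasi_trees_def)
  show ?thesis
    unfolding BR_delta_def fst
    by (intro arg_cong[where f = abs_br_ring] sum.cong refl)
      (auto simp: rank_min_quasi_trees matroid_nullity_def dm_w_def dm_t_def restrict_quasi_trees
        width_quasi_trees even_quasi_trees)
qed

end

section \<open>Counting classes of a relation\<close>

definition conn :: "('p \<times> 'p) set \<Rightarrow> ('p \<times> 'p) set" where
  "conn R = (R \<union> R\<inverse>)\<^sup>*"

definition ncomp :: "'p set \<Rightarrow> ('p \<times> 'p) set \<Rightarrow> nat" where
  "ncomp X R = card ((\<lambda>x. conn R `` {x}) ` X)"

lemma conn_refl [simp]: "(x, x) \<in> conn R" by (simp add: conn_def)

lemma conn_base: "(x, y) \<in> R \<Longrightarrow> (x, y) \<in> conn R" by (auto simp: conn_def)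

lemma conn_sym: "(x, y) \<in> conn R \<Longrightarrow> (y, x) \<in> conn R"
proof -
  have "sym ((R \<union> R\<inverse>)\<^sup>*)" by (rule sym_rtrancl) (auto simp: sym_def)
  then show "(x, y) \<in> conn R \<Longrightarrow> (y, x) \<in> conn R" by (auto simp: conn_def sym_def)
qed

lemma conn_trans: "(x, y) \<in> conn R \<Longrightarrow> (y, z) \<in> conn R \<Longrightarrow> (x, z) \<in> conn R"
  by (simp add: conn_def)

lemma conn_induct [consumes 1, case_names refl step]:
  assumes "(x, y) \<in> conn R" "P x"
    "\<And>y z. (x, y) \<in> conn R \<Longrightarrow> P y \<Longrightarrow> (y, z) \<in> R \<or> (z, y) \<in> R \<Longrightarrow> P z"
  shows "P y"
  using assms(1) unfolding conn_def
  by (induction rule: rtrancl_induct) (use assms(2,3) in \<open>auto simp: conn_def\<close>)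

lemma conn_leI:
  assumes "R \<subseteq> conn S" shows "conn R \<subseteq> conn S"
proof (rule subrelI)
  fix x y assume "(x, y) \<in> conn R"
  then show "(x, y) \<in> conn S"
  proof (induction rule: conn_induct)
    case (step y z)
    then have "(y, z) \<in> conn S" using assms conn_sym[of z y S] by blast
    then show ?case using step conn_trans by metis
  qed simp
qed

lemma conn_mono: "R \<subseteq> S \<Longrightarrow> conn R \<subseteq> conn S"
  by (rule conn_leI) (auto intro: conn_base)

lemma conn_eqI: "R \<subseteq> conn S \<Longrightarrow> S \<subseteq> conn R \<Longrightarrow> conn R = conn S"
  using conn_leI by blast

lemma conn_class_eq: "conn R `` {x} = conn R `` {y} \<longleftrightarrow> (x, y) \<in> conn R"
proof
  assume "conn R `` {x} = conn R `` {y}"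
  then have "y \<in> conn R `` {x}" by simp
  then show "(x, y) \<in> conn R" by simp
next
  assume xy: "(x, y) \<in> conn R"
  have "(x, z) \<in> conn R \<longleftrightarrow> (y, z) \<in> conn R" for z
    using xy conn_sym[OF xy] conn_trans[of x y R z] conn_trans[of y x R z] by blast
  then show "conn R `` {x} = conn R `` {y}" by auto
qed

lemma conn_closed: "(x, y) \<in> conn R \<Longrightarrow> R \<subseteq> X \<times> X \<Longrightarrow> x \<in> X \<Longrightarrow> y \<in> X"
  by (induction rule: conn_induct) auto

lemma ncomp_cong: "conn R = conn S \<Longrightarrow> ncomp X R = ncomp X S"
  by (simp add: ncomp_def)

lemma conn_image_class:
  assumes "conn R \<subseteq> conn S" shows "conn S `` (conn R `` {x}) = conn S `` {x}"
proof (intro set_eqI iffI)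
  fix z assume "z \<in> conn S `` (conn R `` {x})"
  then obtain y where "(x, y) \<in> conn R" "(y, z) \<in> conn S" by auto
  then show "z \<in> conn S `` {x}" using assms conn_trans[of x y S z] by auto
next
  fix z assume "z \<in> conn S `` {x}"
  then show "z \<in> conn S `` (conn R `` {x})" using conn_refl[of x R] by auto
qed

text \<open>Passing to the larger relation maps the classes onto its classes.\<close>

lemma ncomp_coarser:
  assumes "finite X" "conn R \<subseteq> conn S"
  shows "ncomp X S \<le> ncomp X R"
    and "ncomp X S = ncomp X R \<Longrightarrow> x \<in> X \<Longrightarrow> y \<in> X \<Longrightarrow> (x, y) \<in> conn S \<Longrightarrow> (x, y) \<in> conn R"
proof -
  let ?g = "\<lambda>C. conn S `` C"
  have g: "?g (conn R `` {x}) = conn S `` {x}" for x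
    by (rule conn_image_class[OF assms(2)])
  then have im: "(\<lambda>x. conn S `` {x}) ` X = ?g ` ((\<lambda>x. conn R `` {x}) ` X)"
    by (simp add: image_image)
  show "ncomp X S \<le> ncomp X R"
    unfolding ncomp_def im using assms(1) by (intro card_image_le) auto
  assume eq: "ncomp X S = ncomp X R" and xy: "x \<in> X" "y \<in> X" "(x, y) \<in> conn S"
  have "inj_on ?g ((\<lambda>x. conn R `` {x}) ` X)"
    using eq unfolding ncomp_def im using assms(1) by (intro eq_card_imp_inj_on) auto
  moreover have "?g (conn R `` {x}) = ?g (conn R `` {y})"
    using xy(3) unfolding g by (simp add: conn_class_eq)
  ultimately have "conn R `` {x} = conn R `` {y}" using xy by (auto dest: inj_onD)
  then show "(x, y) \<in> conn R" by (simp add: conn_class_eq)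
qed

lemma conn_insert_conn: "(x, y) \<in> conn R \<Longrightarrow> conn (insert (x, y) R) = conn R"
  by (rule conn_eqI) (auto intro: conn_base)

lemma conn_insert_cases:
  assumes "(u, w) \<in> conn (insert (x, y) R)"
  shows "(u, w) \<in> conn R \<or> ((u, x) \<in> conn R \<or> (u, y) \<in> conn R) \<and> ((w, x) \<in> conn R \<or> (w, y) \<in> conn R)"
  using assms
proof (induction rule: conn_induct)
  case (step w z)
  show ?case
  proof (cases "(w, z) \<in> R \<or> (z, w) \<in> R")
    case True
    then have wz: "(w, z) \<in> conn R" "(z, w) \<in> conn R" using conn_base conn_sym by metis+
    show ?thesis
      using step.IH wz conn_trans[of u w R z] conn_trans[of z w R x] conn_trans[of z w R y] by auto
  next
    case False
    then have "w = x \<and> z = y \<or> w = y \<and> z = x" using step.hyps by auto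
    then show ?thesis using step.IH by auto
  qed
qed simp

text \<open>The classes other than that of \<open>y\<close> correspond to the classes of the larger relation, since a new
connection has to pass from the class of \<open>x\<close> to that of \<open>y\<close>.\<close>

lemma ncomp_insert:
  assumes fin: "finite X" and xy: "x \<in> X" "y \<in> X" and ndc: "(x, y) \<notin> conn R"
  shows "ncomp X R = Suc (ncomp X (insert (x, y) R))"
proof -
  let ?R = "insert (x, y) R"
  let ?c = "\<lambda>x. conn R `` {x}" and ?d = "\<lambda>x. conn ?R `` {x}"
  have sub: "conn R \<subseteq> conn ?R" by (rule conn_mono) auto
  have xy': "(x, y) \<in> conn ?R" by (rule conn_base) simp
  let ?Y = "{z \<in> X. (z, y) \<notin> conn R}"
  have d: "?d ` X = ?d ` ?Y"
  proof -
    have "?d z \<in> ?d ` ?Y" if "z \<in> X" for z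
    proof (cases "(z, y) \<in> conn R")
      case True
      then have "(z, y) \<in> conn ?R" using sub by auto
      then have "?d z = ?d x"
        unfolding conn_class_eq using conn_sym[OF xy'] conn_trans[of z y ?R x] by blast
      then show ?thesis using xy ndc by auto
    qed (use that in auto)
    then show ?thesis by auto
  qed
  have inj: "(u, w) \<in> conn R" if "u \<in> ?Y" "w \<in> ?Y" "(u, w) \<in> conn ?R" for u w
    using conn_insert_cases[OF that(3)] that(1,2) conn_sym[of w x R] conn_trans[of u x R w] by auto
  have "ncomp X ?R = card (?d ` ?Y)" by (simp add: ncomp_def d)
  moreover have "card (?d ` ?Y) = card (?c ` ?Y)"
  proof (rule bij_betw_same_card[symmetric], rule bij_betwI')
    let ?h = "\<lambda>C. conn ?R `` C"
    have h: "?h (?c z) = ?d z" for z by (rule conn_image_class[OF sub])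
    show "(?h C = ?h D) = (C = D)" if C: "C \<in> ?c ` ?Y" and D: "D \<in> ?c ` ?Y" for C D
    proof -
      obtain u w where uw: "u \<in> ?Y" "C = ?c u" "w \<in> ?Y" "D = ?c w" using C D by auto
      show ?thesis
        unfolding uw(2,4) h conn_class_eq using inj[OF uw(1,3)] subsetD[OF sub, of "(u, w)"] by auto
    qed
    show "?h C \<in> ?d ` ?Y" if "C \<in> ?c ` ?Y" for C using that h by auto
    show "\<exists>C\<in>?c ` ?Y. D = ?h C" if "D \<in> ?d ` ?Y" for D using that h by auto
  qed
  moreover have "?c ` X = insert (?c y) (?c ` ?Y)"
  proof -
    have "?c z \<in> insert (?c y) (?c ` ?Y)" if "z \<in> X" for z
      using that conn_class_eq[of R z y] by (cases "(z, y) \<in> conn R") auto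
    then show ?thesis using xy by blast
  qed
  then have "ncomp X R = card (insert (?c y) (?c ` ?Y))" by (simp add: ncomp_def)
  moreover have "?c y \<notin> ?c ` ?Y"
  proof
    assume "?c y \<in> ?c ` ?Y"
    then obtain z where "z \<in> ?Y" "?c z = ?c y" by auto
    then show False unfolding conn_class_eq by auto
  qed
  ultimately show ?thesis using fin by (simp add: ncomp_def)
qed

lemma ncomp_insert_le:
  assumes "finite X" "x \<in> X" "y \<in> X"
  shows "ncomp X (insert (x, y) R) \<le> ncomp X R \<and> ncomp X R \<le> Suc (ncomp X (insert (x, y) R))"
proof (cases "(x, y) \<in> conn R")
  case True
  then show ?thesis using ncomp_cong[OF conn_insert_conn[OF True], of X] by simp
next
  case False
  then show ?thesis using ncomp_insert[OF assms False] by simp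
qed

lemma ncomp_empty: "ncomp X {} = card X"
proof -
  have "conn {} `` {x} = {x}" for x :: 'a by (auto simp: conn_def)
  then show ?thesis by (simp add: ncomp_def card_image)
qed

text \<open>A forest bound: every pair lowers the number of classes by at most one.\<close>

lemma ncomp_ge:
  assumes "finite X" "finite R" "R \<subseteq> X \<times> X"
  shows "card X \<le> ncomp X R + card R"
  using assms(2,3)
proof (induction R rule: finite_induct)
  case empty then show ?case by (simp add: ncomp_empty)
next
  case (insert r R)
  then obtain x y where "r = (x, y)" "x \<in> X" "y \<in> X" by auto
  then show ?case using insert ncomp_insert_le[OF assms(1), of x y R] by auto
qed

section \<open>Flag graphs\<close>

text \<open>The flags \<open>P\<close> are the end points of the segments; \<open>a e\<close> and \<open>b e\<close> lie on one segment of the edge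
\<open>e\<close>, \<open>c e\<close> and \<open>d e\<close> on the other, and the free sides of \<open>e\<close> run from \<open>a e\<close> to \<open>c e\<close> and from
\<open>b e\<close> to \<open>d e\<close>. The involution \<open>al\<close> leads to the other end of a gap. The set \<open>X\<close> may contain further
points, one for each vertex without edges. The colouring \<open>eps0\<close> orients every vertex separately.\<close>

locale flag_graph =
  fixes X P :: "'p set" and E :: "'e set" and al :: "'p \<Rightarrow> 'p" and a b c d :: "'e \<Rightarrow> 'p"
    and eps0 :: "'p \<Rightarrow> bool"
  assumes finite_X: "finite X" and finite_E: "finite E" and P_sub: "P \<subseteq> X"
    and al: "p \<in> P \<Longrightarrow> al p \<in> P \<and> al (al p) = p"
    and corners: "e \<in> E \<Longrightarrow> distinct [a e, b e, c e, d e]"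
    and corners_disjoint: "e \<in> E \<Longrightarrow> e' \<in> E \<Longrightarrow> e \<noteq> e' \<Longrightarrow>
      {a e, b e, c e, d e} \<inter> {a e', b e', c e', d e'} = {}"
    and P_eq: "P = (\<Union>e\<in>E. {a e, b e, c e, d e})"
    and eps0_al: "p \<in> P \<Longrightarrow> eps0 (al p) \<noteq> eps0 p"
    and eps0_seg: "e \<in> E \<Longrightarrow> eps0 (a e) \<noteq> eps0 (b e) \<and> eps0 (c e) \<noteq> eps0 (d e)"
begin

definition gaps :: "('p \<times> 'p) set" where "gaps = {(p, al p) | p. p \<in> P}"
definition segs :: "'e set \<Rightarrow> ('p \<times> 'p) set" where
  "segs B = (\<Union>e\<in>B. {(a e, b e), (c e, d e)})"
definition sides :: "'e set \<Rightarrow> ('p \<times> 'p) set" where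
  "sides B = (\<Union>e\<in>B. {(a e, c e), (b e, d e)})"

text \<open>The classes of \<open>Rf A\<close> are the boundary components of the surface of \<open>A\<close>, those of \<open>Rk A\<close> its components.\<close>

definition Rf :: "'e set \<Rightarrow> ('p \<times> 'p) set" where
  "Rf A = gaps \<union> segs (E - A) \<union> sides A"
definition Rk :: "'e set \<Rightarrow> ('p \<times> 'p) set" where
  "Rk A = gaps \<union> segs E \<union> sides A"

definition nf :: "'e set \<Rightarrow> nat" where "nf A = ncomp X (Rf A)"
definition nk :: "'e set \<Rightarrow> nat" where "nk A = ncomp X (Rk A)"

text \<open>Orientations of the vertices amount to colourings that alternate along gaps and segments; the edges in
\<open>A\<close> are compatible with them if the colours also alternate along their sides.\<close>

definition balances :: "('p \<Rightarrow> bool) \<Rightarrow> 'e set \<Rightarrow> bool" where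
  "balances eps A \<longleftrightarrow> (\<forall>(p, q) \<in> Rk A. eps p \<noteq> eps q)"

text \<open>The part of the boundary that does not depend on whether \<open>e\<close> belongs to \<open>A\<close>.\<close>

definition rest :: "'e set \<Rightarrow> 'e \<Rightarrow> ('p \<times> 'p) set" where
  "rest A e = gaps \<union> segs (E - A - {e}) \<union> sides (A - {e})"

lemma corner_in: "e \<in> E \<Longrightarrow> a e \<in> P \<and> b e \<in> P \<and> c e \<in> P \<and> d e \<in> P"
  by (auto simp: P_eq)

lemma corner_in_X: "e \<in> E \<Longrightarrow> a e \<in> X \<and> b e \<in> X \<and> c e \<in> X \<and> d e \<in> X"
  using corner_in P_sub by auto

lemma Rk_insert: "Rk (insert e A) = insert (b e, d e) (insert (a e, c e) (Rk A))"
  by (auto simp: Rk_def sides_def)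

lemma Rf_in: "e \<in> E \<Longrightarrow> e \<notin> A \<Longrightarrow> Rf A = insert (a e, b e) (insert (c e, d e) (rest A e))"
  by (auto simp: Rf_def rest_def segs_def)

lemma Rf_insert: "e \<in> E \<Longrightarrow> Rf (insert e A) = insert (a e, c e) (insert (b e, d e) (rest A e))"
proof -
  have "E - insert e A = E - A - {e}" by auto
  then have eq: "segs (E - insert e A) = segs (E - A - {e})" by (rule arg_cong)
  show "Rf (insert e A) = insert (a e, c e) (insert (b e, d e) (rest A e))"
    unfolding Rf_def rest_def eq sides_def by blast
qed

lemma rest_insert: "rest (insert e A) e = rest A e"
proof -
  have "E - insert e A - {e} = E - A - {e}" "insert e A - {e} = A - {e}" by auto
  then show ?thesis unfolding rest_def by metis
qed

lemma seg_in_Rk: "e \<in> E \<Longrightarrow> (a e, b e) \<in> Rk A \<and> (c e, d e) \<in> Rk A"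
  by (auto simp: Rk_def segs_def)

lemma conn_Rk_insert:
  assumes "e \<in> E"
  shows "conn (Rk (insert e A)) = conn (insert (a e, c e) (Rk A))"
proof -
  let ?R = "insert (a e, c e) (Rk A)"
  have "(a e, b e) \<in> conn ?R" "(c e, d e) \<in> conn ?R" "(a e, c e) \<in> conn ?R"
    using seg_in_Rk[OF assms, of A] by (auto intro!: conn_base)
  then have "(b e, d e) \<in> conn ?R"
    using conn_sym[of "a e" "b e"] conn_trans[of "b e" "a e" ?R "c e"] conn_trans[of "b e" "c e" ?R "d e"]
    by blast
  then show ?thesis unfolding Rk_insert by (rule conn_insert_conn)
qed

lemma nk_insert:
  assumes "e \<in> E"
  shows "nk (insert e A) = ncomp X (insert (a e, c e) (Rk A))"
  unfolding nk_def by (rule ncomp_cong) (rule conn_Rk_insert[OF assms])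

lemma nk_insert_eq_iff:
  assumes "e \<in> E"
  shows "nk (insert e A) = nk A \<longleftrightarrow> (a e, c e) \<in> conn (Rk A)"
proof (cases "(a e, c e) \<in> conn (Rk A)")
  case True
  then show ?thesis
    using nk_insert[OF assms] ncomp_cong[OF conn_insert_conn[OF True]] by (simp add: nk_def)
next
  case False
  then show ?thesis
    using nk_insert[OF assms] ncomp_insert[OF finite_X _ _ False] corner_in_X[OF assms] by (simp add: nk_def)
qed

lemma nk_step:
  assumes "e \<in> E" shows "nk (insert e A) \<le> nk A \<and> nk A \<le> Suc (nk (insert e A))"
  unfolding nk_insert[OF assms] unfolding nk_def
  using corner_in_X[OF assms] by (intro ncomp_insert_le finite_X) auto

lemma Rk_mono: "A \<subseteq> B \<Longrightarrow> conn (Rk A) \<subseteq> conn (Rk B)"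
  by (rule conn_mono) (auto simp: Rk_def sides_def)

lemma nk_closure:
  assumes "A \<subseteq> B" "e \<in> E" "nk (insert e A) = nk A" shows "nk (insert e B) = nk B"
  using assms Rk_mono[OF assms(1)] nk_insert_eq_iff by blast

lemma Rf_sub_Rk: "conn (Rf A) \<subseteq> conn (Rk A)"
  by (rule conn_mono) (auto simp: Rk_def Rf_def segs_def)

lemma nk_le_nf: "nk A \<le> nf A"
  unfolding nf_def nk_def by (rule ncomp_coarser(1)[OF finite_X Rf_sub_Rk])

lemma nf_empty: "nf {} = nk {}"
  by (simp add: nf_def nk_def Rf_def Rk_def)

section \<open>How the rest of the boundary pairs off the flags of an edge\<close>

lemma rest_sub: "A \<subseteq> E \<Longrightarrow> rest A e \<subseteq> P \<times> P"
  using al by (auto simp: rest_def gaps_def segs_def sides_def dest: corner_in)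

definition colours_rest :: "('p \<Rightarrow> bool) \<Rightarrow> 'e set \<Rightarrow> 'e \<Rightarrow> bool" where
  "colours_rest eps A e \<longleftrightarrow> (\<forall>(p, q) \<in> rest A e. eps p \<noteq> eps q)"

definition qset :: "'e \<Rightarrow> 'p set" where "qset e = {a e, b e, c e, d e}"

lemma finite_P: "finite P" using finite_X P_sub finite_subset by blast

lemma finite_qset [simp]: "finite (qset e)" by (simp add: qset_def)

lemma sum_over_P:
  fixes g :: "'p \<Rightarrow> int"
  assumes K: "K \<subseteq> P"
  shows "sum g K = (\<Sum>e\<in>E. sum g (K \<inter> qset e))"
proof -
  have "K = (\<Union>e\<in>E. K \<inter> qset e)" using K by (auto simp: P_eq qset_def)
  then have "sum g K = sum g (\<Union>e\<in>E. K \<inter> qset e)" by simp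
  also have "\<dots> = (\<Sum>e\<in>E. sum g (K \<inter> qset e))"
    using corners_disjoint finite_E by (intro sum.UNION_disjoint) (auto simp: qset_def)
  finally show ?thesis .
qed

lemma sum_al:
  fixes g :: "'p \<Rightarrow> int"
  assumes "K \<subseteq> P" "\<And>p. p \<in> K \<Longrightarrow> al p \<in> K"
  shows "sum g K = (\<Sum>p\<in>K. g (al p))"
  by (rule sum.reindex_bij_witness[of _ al al]) (use assms al in auto)

lemma class_rest:
  assumes A: "A \<subseteq> E" and p: "p \<in> P" and K: "K = conn (rest A e) `` {p}"
  shows "K \<subseteq> P" "\<And>q. q \<in> K \<Longrightarrow> al q \<in> K"
    "\<And>q r. (q, r) \<in> rest A e \<Longrightarrow> q \<in> K \<longleftrightarrow> r \<in> K"
proof -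
  show KP: "K \<subseteq> P" using conn_closed[OF _ rest_sub[OF A] p] K by auto
  show 1: "q \<in> K \<longleftrightarrow> r \<in> K" if "(q, r) \<in> rest A e" for q r
    using conn_base[OF that] conn_sym[of q r] K conn_trans[of p q _ r] conn_trans[of p r _ q] by auto
  show "al q \<in> K" if "q \<in> K" for q
    using 1[of q "al q"] that KP by (auto simp: rest_def gaps_def)
qed

lemma side_in_rest: "e' \<in> A \<Longrightarrow> e' \<noteq> e \<Longrightarrow> (a e', c e') \<in> rest A e \<and> (b e', d e') \<in> rest A e"
  by (auto simp: rest_def sides_def)

lemma seg_in_rest:
  "e' \<in> E \<Longrightarrow> e' \<notin> A \<Longrightarrow> e' \<noteq> e \<Longrightarrow> (a e', b e') \<in> rest A e \<and> (c e', d e') \<in> rest A e"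
  by (auto simp: rest_def segs_def)

lemma seg_or_side_in_rest:
  assumes "e' \<in> E" "e' \<noteq> e"
  shows "(a e', b e') \<in> rest A e \<and> (c e', d e') \<in> rest A e \<or> (a e', c e') \<in> rest A e \<and> (b e', d e') \<in> rest A e"
  using assms by (cases "e' \<in> A") (auto simp: rest_def segs_def sides_def)

text \<open>The sum of \<open>g\<close> over the class \<open>K\<close> vanishes because \<open>K\<close> is a union of gap pairs, and so do the
contributions of the other edges because their flags are paired within \<open>K\<close>.\<close>

lemma sum_qset_zero:
  fixes g :: "'p \<Rightarrow> int"
  assumes A: "A \<subseteq> E" and e: "e \<in> E" and p: "p \<in> P" and K: "K = conn (rest A e) `` {p}"
    and flip: "\<And>q r. (q, r) \<in> rest A e \<Longrightarrow> g q + g r = 0"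
  shows "sum g (K \<inter> qset e) = 0"
proof -
  note cl = class_rest[OF A p K]
  have "g (al p) = - g p" if "p \<in> K" for p
    using flip[of p "al p"] that cl(1) by (auto simp: rest_def gaps_def)
  then have "sum g K = (\<Sum>p\<in>K. - g p)"
    using sum_al[OF cl(1,2), of g] by simp
  then have "sum g K = 0" by (simp add: sum_negf)
  moreover have "sum g (K \<inter> qset e') = 0" if e': "e' \<in> E" "e' \<noteq> e" for e'
  proof -
    have dist: "distinct [a e', b e', c e', d e']" by (rule corners[OF e'(1)])
    have K4: "sum g (K \<inter> qset e') = (\<Sum>q\<in>qset e'. if q \<in> K then g q else 0)"
      unfolding Int_commute[of K] by (rule sum.inter_restrict[OF finite_qset])
    have "(\<Sum>q\<in>qset e'. if q \<in> K then g q else 0) = (if a e' \<in> K then g (a e') else 0) +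
       (if b e' \<in> K then g (b e') else 0) + (if c e' \<in> K then g (c e') else 0) + (if d e' \<in> K then g (d e') else 0)"
      using dist by (simp add: qset_def)
    also have "\<dots> = 0"
      using seg_or_side_in_rest[OF e', of A]
    proof
      assume r: "(a e', b e') \<in> rest A e \<and> (c e', d e') \<in> rest A e"
      then show ?thesis
        using flip[of "a e'" "b e'"] flip[of "c e'" "d e'"] cl(3)[of "a e'" "b e'"] cl(3)[of "c e'" "d e'"]
        by simp
    next
      assume r: "(a e', c e') \<in> rest A e \<and> (b e', d e') \<in> rest A e"
      then show ?thesis
        using flip[of "a e'" "c e'"] flip[of "b e'" "d e'"] cl(3)[of "a e'" "c e'"] cl(3)[of "b e'" "d e'"]
        by simp
    qed
    finally show ?thesis using K4 by simp
  qed
  then have "(\<Sum>e\<in>E. sum g (K \<inter> qset e)) = sum g (K \<inter> qset e)"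
    using e finite_E by (simp add: sum.remove)
  ultimately show ?thesis using sum_over_P[OF cl(1), of g] by simp
qed

text \<open>The class has an even number of elements as a union of gap pairs, and an even number on every edge other
than \<open>e\<close>.\<close>

lemma qset_even:
  assumes A: "A \<subseteq> E" and e: "e \<in> E" and p: "p \<in> P" and K: "K = conn (rest A e) `` {p}"
  shows "even (card (K \<inter> qset e))"
proof -
  note cl = class_rest[OF A p K]
  have fin: "finite K" using cl(1) finite_P finite_subset by blast
  let ?g = "\<lambda>p. if eps0 p then 1 else -1 :: int"
  have "?g (al p) = - ?g p" if "p \<in> K" for p
    using eps0_al[of p] that cl(1) by auto
  then have "sum ?g K = (\<Sum>p\<in>K. - ?g p)"
    using sum_al[OF cl(1,2), of ?g] by simp
  then have 0: "(\<Sum>p\<in>K. if eps0 p then 1 else -1 :: int) = 0" by (simp add: sum_negf)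
  have "(\<Sum>p\<in>K. 1) = (\<Sum>p\<in>K. (if eps0 p then 1 else -1 :: int)) + 2 * (\<Sum>p\<in>K. if eps0 p then 0 else 1)"
    by (simp add: sum.distrib[symmetric] sum_distrib_left if_distrib cong: if_cong sum.cong) 
  then have "even (\<Sum>p\<in>K. 1 :: int)" using 0 by simp
  moreover have "even (\<Sum>q\<in>K \<inter> qset e'. 1 :: int)" if e': "e' \<in> E - {e}" for e'
  proof -
    have e'': "e' \<in> E" "e' \<noteq> e" using e' by auto
    have dist: "distinct [a e', b e', c e', d e']" by (rule corners[OF e''(1)])
    have K4: "(\<Sum>q\<in>K \<inter> qset e'. 1 :: int) = (\<Sum>q\<in>qset e'. if q \<in> K then 1 else 0)"
      by (simp only: sum.inter_restrict[OF finite_qset] Int_commute[of K])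
    have "(\<Sum>q\<in>qset e'. if q \<in> K then 1 else 0 :: int) = (if a e' \<in> K then 1 else 0) +
       (if b e' \<in> K then 1 else 0) + (if c e' \<in> K then 1 else 0) + (if d e' \<in> K then 1 else 0)"
      using dist by (simp add: qset_def)
    moreover have "even \<dots>"
      using seg_or_side_in_rest[OF e'', of A]
        cl(3)[of "a e'" "b e'"] cl(3)[of "c e'" "d e'"] cl(3)[of "a e'" "c e'"] cl(3)[of "b e'" "d e'"]
      by auto
    ultimately show ?thesis using K4 by simp
  qed
  then have "even (\<Sum>e'\<in>E - {e}. \<Sum>q\<in>K \<inter> qset e'. 1 :: int)" by (rule dvd_sum)
  moreover have "(\<Sum>p\<in>K. 1) = (\<Sum>q\<in>K \<inter> qset e. 1) + (\<Sum>e'\<in>E - {e}. \<Sum>q\<in>K \<inter> qset e'. 1 :: int)"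
    unfolding sum_over_P[OF cl(1)] using e finite_E by (rule sum.remove[rotated])
  ultimately have "even (\<Sum>q\<in>K \<inter> qset e. 1 :: int)" by (metis even_add)
  then show ?thesis by simp
qed

text \<open>Each class contains an even number of the four flags, so all four are connected or they fall into two
pairs.\<close>

lemma rest_pairing:
  assumes A: "A \<subseteq> E" and e: "e \<in> E"
  defines "S \<equiv> conn (rest A e)"
  shows "(a e, b e) \<in> S \<and> (c e, d e) \<in> S \<or> (a e, c e) \<in> S \<and> (b e, d e) \<in> S \<or> (a e, d e) \<in> S \<and> (b e, c e) \<in> S"
proof -
  have dist: "distinct [a e, b e, c e, d e]" by (rule corners[OF e])
  have K4: "card (S `` {p} \<inter> qset e) = (if (p, a e) \<in> S then 1 else 0) +
       (if (p, b e) \<in> S then 1 else 0) + (if (p, c e) \<in> S then 1 else 0) + (if (p, d e) \<in> S then 1 else 0)" for p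
  proof -
    have "card (S `` {p} \<inter> qset e) = (\<Sum>q\<in>S `` {p} \<inter> qset e. 1)" by simp
    also have "\<dots> = (\<Sum>q\<in>qset e. if q \<in> S `` {p} then 1 else 0)"
      by (simp only: sum.inter_restrict[OF finite_qset] Int_commute[of "S `` {p}"])
    finally show ?thesis using dist by (simp add: qset_def)
  qed
  have ev: "p \<in> P \<Longrightarrow> even (card (S `` {p} \<inter> qset e))" for p
    using qset_even[OF A e, of p] by (simp add: S_def)
  have refl: "(p, p) \<in> S" for p by (simp add: S_def)
  have sym: "(p, q) \<in> S \<longleftrightarrow> (q, p) \<in> S" for p q by (auto simp: S_def intro: conn_sym)
  have tr: "(p, q) \<in> S \<Longrightarrow> (q, r) \<in> S \<Longrightarrow> (p, r) \<in> S" for p q r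
    unfolding S_def by (rule conn_trans)
  have par: "even ((if w then 1 else 0) + (if x then 1 else 0) + (if y then 1 else 0) + (if z then 1 else 0 :: nat))
      \<longleftrightarrow> ((w \<longleftrightarrow> x) \<longleftrightarrow> (y \<longleftrightarrow> z))" for w x y z by auto
  have x: "(p, a e) \<in> S \<longleftrightarrow> (p, b e) \<in> S \<longleftrightarrow> (p, c e) \<in> S \<longleftrightarrow> (p, d e) \<in> S" if "p \<in> P" for p
    using ev[OF that] unfolding K4 par by argo
  have P: "a e \<in> P" "b e \<in> P" "c e \<in> P" "d e \<in> P" using corner_in[OF e] by auto
  show ?thesis
    using x[OF P(1)] x[OF P(2)] x[OF P(3)] x[OF P(4)] refl[of "a e"] refl[of "b e"] refl[of "c e"] refl[of "d e"]
      tr[of "a e" "d e" "c e"] tr[of "a e" "c e" "d e"] tr[of "c e" "a e" "b e"] tr[of "d e" "b e" "c e"]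
      tr[of "b e" "c e" "d e"] tr[of "b e" "d e" "c e"] tr[of "a e" "b e" "c e"] tr[of "a e" "b e" "d e"]
      sym[of "b e" "a e"] sym[of "c e" "a e"] sym[of "d e" "a e"] sym[of "c e" "b e"]
      sym[of "d e" "b e"] sym[of "d e" "c e"] by argo
qed

text \<open>A class that contained all four flags would be connected by too few pairs: half as many gaps as
flags, and half as many segments or sides as flags of the other edges, in total two less than the number
of its flags. The colouring serves to list every gap once, from its coloured end.\<close>

lemma coloured_class_not_all:
  assumes A: "A \<subseteq> E" and e: "e \<in> E" and p: "p \<in> P" and K: "K = conn (rest A e) `` {p}"
    and col: "colours_rest eps A e"
  shows "\<not> qset e \<subseteq> K"
proof
  assume Q: "qset e \<subseteq> K"
  note cl = class_rest[OF A p K]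
  have fin: "finite K" using cl(1) finite_P finite_subset by blast
  let ?R1 = "(\<lambda>q. (q, al q)) ` {q \<in> K. eps q}"
  let ?T = "\<lambda>e'. {r \<in> (if e' \<in> A then {(a e', c e'), (b e', d e')} else {(a e', b e'), (c e', d e')}). fst r \<in> K}"
  let ?R2 = "\<Union>e'\<in>E - {e}. ?T e'"
  have "card {q \<in> K. eps q} = card {q \<in> K. \<not> eps q}"
  proof (rule bij_betw_same_card, rule bij_betw_byWitness[where f = al and f' = al])
    have "eps (al q) \<noteq> eps q" if "q \<in> K" for q
    proof -
      have "(q, al q) \<in> rest A e" using that cl(1) by (auto simp: rest_def gaps_def)
      then show ?thesis using col by (auto simp: colours_rest_def)
    qed
    then show "al ` {q \<in> K. eps q} \<subseteq> {q \<in> K. \<not> eps q}" "al ` {q \<in> K. \<not> eps q} \<subseteq> {q \<in> K. eps q}"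
      using cl(2) by auto
  qed (use al cl(1) in auto)
  moreover have "card K = card {q \<in> K. eps q} + card {q \<in> K. \<not> eps q}"
    using fin by (subst card_Un_disjoint[symmetric]) (auto intro: arg_cong[where f = card])
  ultimately have R1: "2 * card ?R1 = card K"
    by (simp add: card_image inj_on_def)
  have T: "2 * card (?T e') \<le> card (K \<inter> qset e')" if e': "e' \<in> E" "e' \<noteq> e" for e'
  proof -
    have K4: "card (K \<inter> qset e') = (\<Sum>q\<in>qset e'. if q \<in> K then 1 else 0)"
      by (simp only: card_eq_sum sum.inter_restrict[OF finite_qset] Int_commute[of K])
    have dist: "distinct [a e', b e', c e', d e']" by (rule corners[OF e'(1)])
    have K5: "card (K \<inter> qset e') = (if a e' \<in> K then 1 else 0) +
       (if b e' \<in> K then 1 else 0) + (if c e' \<in> K then 1 else 0) + (if d e' \<in> K then 1 else 0)"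
      unfolding K4 using dist by (simp add: qset_def)
    show ?thesis
    proof (cases "e' \<in> A")
      case True
      then have ac: "a e' \<in> K \<longleftrightarrow> c e' \<in> K" "b e' \<in> K \<longleftrightarrow> d e' \<in> K"
        using e' by (auto intro!: cl(3) simp: rest_def sides_def)
      have "?T e' = (if a e' \<in> K then {(a e', c e')} else {}) \<union> (if b e' \<in> K then {(b e', d e')} else {})"
        using True by auto
      then have "card (?T e') \<le> (if a e' \<in> K then 1 else 0) + (if b e' \<in> K then 1 else 0)"
        using card_Un_le by (auto simp: card_insert_if)
      then show ?thesis unfolding K5 using ac by auto
    next
      case False
      then have ac: "a e' \<in> K \<longleftrightarrow> b e' \<in> K" "c e' \<in> K \<longleftrightarrow> d e' \<in> K"
        using e' by (auto intro!: cl(3) simp: rest_def segs_def)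
      have "?T e' = (if a e' \<in> K then {(a e', b e')} else {}) \<union> (if c e' \<in> K then {(c e', d e')} else {})"
        using False by auto
      then have "card (?T e') \<le> (if a e' \<in> K then 1 else 0) + (if c e' \<in> K then 1 else 0)"
        using card_Un_le by (auto simp: card_insert_if)
      then show ?thesis unfolding K5 using ac by auto
    qed
  qed
  have "2 * card ?R2 \<le> 2 * (\<Sum>e'\<in>E - {e}. card (?T e'))"
    using finite_E by (intro mult_left_mono card_UN_le) auto
  also have "\<dots> \<le> (\<Sum>e'\<in>E - {e}. card (K \<inter> qset e'))"
    unfolding sum_distrib_left by (rule sum_mono) (use T in auto)
  finally have R2: "2 * card ?R2 \<le> (\<Sum>e'\<in>E - {e}. card (K \<inter> qset e'))" .
  have "int (card K) = (\<Sum>e'\<in>E. int (card (K \<inter> qset e')))"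
    using sum_over_P[OF cl(1), of "\<lambda>_. 1"] by simp
  then have "card K = (\<Sum>e'\<in>E. card (K \<inter> qset e'))" by (simp flip: of_nat_sum)
  also have "\<dots> = card (K \<inter> qset e) + (\<Sum>e'\<in>E - {e}. card (K \<inter> qset e'))"
    using e finite_E by (simp add: sum.remove)
  also have "K \<inter> qset e = qset e" using Q by auto
  also have "card (qset e) = 4" using corners[OF e] by (simp add: qset_def)
  finally have R2': "2 * card ?R2 + 4 \<le> card K" using R2 by simp
  let ?R = "?R1 \<union> ?R2"
  \<comment> \<open>The class is already connected by the pairs that were counted.\<close>
  have restK: "(q, r) \<in> conn ?R" if qr: "(q, r) \<in> rest A e" "q \<in> K" for q r
  proof -
    have rK: "r \<in> K" using cl(3)[OF qr(1)] qr(2) by simp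
    consider "r = al q" "q \<in> P" | "(q, r) \<in> segs (E - A - {e})" | "(q, r) \<in> sides (A - {e})"
      using qr unfolding rest_def gaps_def by blast
    then show ?thesis
    proof cases
      case 1
      have "eps r \<noteq> eps q" using col qr by (auto simp: colours_rest_def)
      then have "(q, r) \<in> ?R1 \<or> (r, q) \<in> ?R1" using 1 qr rK al[of q] by (auto simp: image_iff)
      then show ?thesis using conn_base[of _ _ ?R] conn_sym[of r q ?R] by blast
    next
      case 2
      then have "(q, r) \<in> ?R2" using qr by (auto simp: segs_def)
      then show ?thesis by (intro conn_base) auto
    next
      case 3
      then have "(q, r) \<in> ?R2" using qr A by (auto simp: sides_def)
      then show ?thesis by (intro conn_base) auto
    qed
  qed
  have pK: "(p, q) \<in> conn ?R" if "(p, q) \<in> conn (rest A e)" for q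
    using that
  proof (induction rule: conn_induct)
    case (step q r)
    then have "q \<in> K" using K by auto
    then have "(q, r) \<in> conn ?R"
      using step.hyps restK[of q r] restK[of r q] conn_sym[of r q ?R] cl(3)[of r q] by blast
    then show ?case using step.IH conn_trans[of p q ?R r] by blast
  qed simp
  have "conn ?R `` {q} = conn ?R `` {p}" if "q \<in> K" for q
    using pK[of q] that K by (simp add: conn_class_eq conn_sym)
  then have "(\<lambda>x. conn ?R `` {x}) ` K \<subseteq> {conn ?R `` {p}}" by auto
  then have "ncomp K ?R \<le> card {conn ?R `` {p}}" unfolding ncomp_def by (intro card_mono) auto
  then have "ncomp K ?R \<le> 1" by simp
  moreover have "?R \<subseteq> K \<times> K"
  proof -
    have "?R1 \<subseteq> K \<times> K" using cl(2) by auto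
    moreover have "?T e' \<subseteq> K \<times> K" if e': "e' \<in> E - {e}" for e'
    proof (cases "e' \<in> A")
      case True
      then show ?thesis
        using e' side_in_rest[OF True, of e] cl(3)[of "a e'" "c e'"] cl(3)[of "b e'" "d e'"] by auto
    next
      case False
      then show ?thesis
        using e' seg_in_rest[OF _ False, of e] cl(3)[of "a e'" "b e'"] cl(3)[of "c e'" "d e'"] by auto
    qed
    ultimately show ?thesis by blast
  qed
  moreover have "finite ?R" using fin finite_E by auto
  ultimately have "card K \<le> 1 + card ?R" using ncomp_ge[OF fin, of ?R] by simp
  also have "card ?R \<le> card ?R1 + card ?R2" by (rule card_Un_le)
  finally show False using R1 R2' by linarith
qed

text \<open>By parity the class of \<open>p\<close> contains exactly two of the four flags, and the colours add up to zero
over them.\<close>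

lemma coloured_pair:
  assumes A: "A \<subseteq> E" and e: "e \<in> E" and col: "colours_rest eps A e"
    and pq: "p \<in> qset e" "q \<in> qset e" "p \<noteq> q" "(p, q) \<in> conn (rest A e)"
  shows "eps p \<noteq> eps q"
proof -
  let ?K = "conn (rest A e) `` {p}"
  let ?g = "\<lambda>p. if eps p then 1 else -1 :: int"
  have p: "p \<in> P" using pq(1) corner_in[OF e] by (auto simp: qset_def)
  have card4: "card (qset e) = 4" using corners[OF e] by (simp add: qset_def)
  have ev: "even (card (?K \<inter> qset e))" by (rule qset_even[OF A e p refl])
  have "?K \<inter> qset e \<subset> qset e" using coloured_class_not_all[OF A e p refl col] by auto
  then have "card (?K \<inter> qset e) < 4" using card4 psubset_card_mono[OF finite_qset, of "?K \<inter> qset e" e] by simp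
  moreover have sub: "{p, q} \<subseteq> ?K \<inter> qset e" using pq by auto
  moreover have c2: "card {p, q} = 2" using pq by simp
  ultimately have "card (?K \<inter> qset e) = 2"
    using ev card_mono[OF _ sub] by (cases "card (?K \<inter> qset e) = 3") auto
  then have "?K \<inter> qset e = {p, q}" using sub c2 card_subset_eq[of "?K \<inter> qset e" "{p, q}"] by simp
  moreover have "sum ?g (?K \<inter> qset e) = 0"
    by (rule sum_qset_zero[OF A e p refl]) (use col in \<open>auto simp: colours_rest_def\<close>)
  ultimately have "?g p + ?g q = 0" using pq(3) by simp
  then show ?thesis by (simp split: if_splits)
qed

section \<open>How the number of boundary components changes\<close>

text \<open>If \<open>x\<close> and \<open>y\<close> are already connected, then so are \<open>z\<close> and \<open>w\<close>, and nothing changes. Otherwise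
the first new pair merges two classes and the second one lies within the result.\<close>

lemma ncomp_two_inserts:
  assumes X: "x \<in> X" "y \<in> X" "z \<in> X" "w \<in> X"
    and pair: "(x, y) \<in> conn R \<and> (z, w) \<in> conn R \<or> (x, z) \<in> conn R \<and> (y, w) \<in> conn R \<or> (x, w) \<in> conn R \<and> (y, z) \<in> conn R"
  shows "if (x, y) \<in> conn R then ncomp X (insert (x, y) (insert (z, w) R)) = ncomp X R
         else ncomp X R = Suc (ncomp X (insert (x, y) (insert (z, w) R)))"
proof (cases "(x, y) \<in> conn R")
  case True
  have zw: "(z, w) \<in> conn R"
    using pair True conn_sym[of x z R] conn_sym[of x w R] conn_sym[of x y R] conn_sym[of y z R]
      conn_trans[of z x R y] conn_trans[of z y R w] conn_trans[of z y R x] conn_trans[of z x R w] by auto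
  have "(x, y) \<in> conn (insert (z, w) R)" using True conn_insert_conn[OF zw] by simp
  then show ?thesis
    using True ncomp_cong[OF conn_insert_conn[OF zw]] ncomp_cong[OF conn_insert_conn[of x y "insert (z, w) R"]]
    by metis
next
  case False
  let ?S = "insert (z, w) R"
  have zw: "(z, w) \<notin> conn R"
    using pair False conn_sym[of y w R] conn_sym[of z w R]
      conn_trans[of x z R y] conn_trans[of x w R y] conn_trans[of z w R y] conn_trans[of w z R y] conn_sym[of y z R] by auto
  have sub: "conn R \<subseteq> conn ?S" by (rule conn_mono) auto
  have "(z, w) \<in> conn ?S" "(w, z) \<in> conn ?S" using conn_base[of z w ?S] conn_sym[of z w ?S] by auto
  then have "(x, y) \<in> conn ?S"
    using pair False sub conn_trans[of x z ?S w] conn_trans[of x w ?S y] conn_trans[of x w ?S z] conn_trans[of x z ?S y]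
      conn_sym[of y w ?S] conn_sym[of y z ?S] by blast
  then show ?thesis
    using False ncomp_cong[OF conn_insert_conn[of x y ?S], of X] ncomp_insert[OF finite_X X(3,4) zw] by simp
qed

lemma nf_without:
  assumes A: "A \<subseteq> E" and e: "e \<in> E" "e \<notin> A"
  shows "if (a e, b e) \<in> conn (rest A e) then nf A = ncomp X (rest A e) else ncomp X (rest A e) = Suc (nf A)"
  unfolding nf_def Rf_in[OF e]
  by (rule ncomp_two_inserts) (use corner_in_X[OF e(1)] rest_pairing[OF A e(1)] in auto)

lemma nf_with:
  assumes A: "A \<subseteq> E" and e: "e \<in> E"
  shows "if (a e, c e) \<in> conn (rest A e) then nf (insert e A) = ncomp X (rest A e)
    else ncomp X (rest A e) = Suc (nf (insert e A))"
  unfolding nf_def Rf_insert[OF e]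
  by (rule ncomp_two_inserts)
    (use corner_in_X[OF e] rest_pairing[OF A e] conn_sym[of "b e" "c e" "rest A e"] in auto)

lemma nf_step:
  assumes A: "A \<subseteq> E" and e: "e \<in> E"
  shows "nf (insert e A) \<le> Suc (nf A) \<and> nf A \<le> Suc (nf (insert e A))"
proof (cases "e \<in> A")
  case True
  then show ?thesis by (simp add: insert_absorb)
next
  case False
  then show ?thesis using nf_without[OF A e] nf_with[OF A e] by (auto split: if_splits)
qed

lemma rest_sub_Rk: "conn (rest A e) \<subseteq> conn (Rk A)"
  by (rule conn_mono) (auto simp: Rk_def rest_def segs_def sides_def)

text \<open>The two segments of a bridge lie in different components, so the rest of the boundary pairs the flags of
each segment with each other.\<close>

lemma nf_bridge:
  assumes A: "A \<subseteq> E" and e: "e \<in> E" and ne: "nk (insert e A) \<noteq> nk A"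
  shows "nf A = Suc (nf (insert e A))"
proof -
  have eA: "e \<notin> A" using ne by (auto simp: insert_absorb)
  have ac: "(a e, c e) \<notin> conn (Rk A)" using ne nk_insert_eq_iff[OF e] by simp
  then have 1: "(a e, c e) \<notin> conn (rest A e)" using rest_sub_Rk by blast
  have "(d e, c e) \<in> conn (Rk A)" using seg_in_Rk[OF e, of A] conn_base conn_sym by metis
  then have "(a e, d e) \<notin> conn (rest A e)"
    using ac rest_sub_Rk[of A e] conn_trans[of "a e" "d e" "Rk A" "c e"] by blast
  then have "(a e, b e) \<in> conn (rest A e)" using rest_pairing[OF A e] 1 by auto
  then show ?thesis using nf_without[OF A e eA] nf_with[OF A e] 1 by simp
qed

text \<open>If no edge has its sides on two different boundary components, then the ends of each segment are
connected along the boundary, and boundary components are as coarse as components.\<close>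

lemma nf_merge:
  assumes A: "A \<subseteq> E" and lt: "nk A < nf A"
  shows "\<exists>e\<in>A. nf A = Suc (nf (A - {e}))"
proof (rule ccontr)
  assume no: "\<not> ?thesis"
  have ab: "(a e, b e) \<in> conn (Rf A) \<and> (c e, d e) \<in> conn (Rf A)" if eA: "e \<in> A" for e
  proof -
    have e: "e \<in> E" "e \<notin> A - {e}" "A - {e} \<subseteq> E" and ins: "insert e (A - {e}) = A" using eA A by auto
    let ?S = "rest (A - {e}) e"
    have "rest A e = ?S" using rest_insert[of e "A - {e}"] ins by simp
    have Rf: "Rf A = insert (a e, c e) (insert (b e, d e) ?S)" using Rf_insert[OF e(1), of "A - {e}"] ins by simp
    then have sub: "conn ?S \<subseteq> conn (Rf A)" by (intro conn_mono) auto
    have ac: "(a e, c e) \<in> conn (Rf A)" "(b e, d e) \<in> conn (Rf A)" using Rf by (auto intro: conn_base)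
    have "\<not> ((a e, b e) \<notin> conn ?S \<and> (a e, c e) \<in> conn ?S)"
    proof
      assume "(a e, b e) \<notin> conn ?S \<and> (a e, c e) \<in> conn ?S"
      then have "nf A = Suc (nf (A - {e}))"
        using nf_without[OF e(3,1,2)] nf_with[OF e(3,1)] ins by simp
      then show False using no eA by blast
    qed
    then have "(a e, b e) \<in> conn ?S \<or> (a e, d e) \<in> conn ?S"
      using rest_pairing[OF e(3,1)] by auto
    then have "(a e, b e) \<in> conn (Rf A)"
      using sub ac conn_sym[of "b e" "d e"] conn_trans[of "a e" "d e" "Rf A" "b e"] by blast
    moreover have "(c e, d e) \<in> conn (Rf A)"
      using calculation ac conn_sym[of "a e" "c e"] conn_trans[of "c e" "a e" "Rf A" "b e"]
        conn_trans[of "c e" "b e" "Rf A" "d e"] by blast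
    ultimately show ?thesis ..
  qed
  have "Rk A \<subseteq> conn (Rf A)"
  proof (rule subrelI)
    fix p q assume "(p, q) \<in> Rk A"
    then consider "(p, q) \<in> Rf A" | e where "e \<in> A" "(p, q) = (a e, b e) \<or> (p, q) = (c e, d e)"
      by (auto simp: Rk_def Rf_def segs_def)
    then show "(p, q) \<in> conn (Rf A)" by cases (use ab conn_base in auto)
  qed
  then have "conn (Rk A) = conn (Rf A)" using Rf_sub_Rk conn_leI by blast
  then show False using lt ncomp_cong[of "Rk A" "Rf A" X] by (simp add: nf_def nk_def)
qed

section \<open>Colourings\<close>

lemma balances_mono: "balances eps A \<Longrightarrow> B \<subseteq> A \<Longrightarrow> balances eps B"
  by (auto simp: balances_def Rk_def sides_def)

lemma balances_rest: "balances eps A \<Longrightarrow> colours_rest eps A e"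
  by (auto simp: balances_def colours_rest_def rest_def Rk_def segs_def sides_def)

lemma balances_seg: "balances eps A \<Longrightarrow> e \<in> E \<Longrightarrow> eps (a e) \<noteq> eps (b e) \<and> eps (c e) \<noteq> eps (d e)"
  using seg_in_Rk[of e A] by (auto simp: balances_def)

lemma balances_side: "balances eps A \<Longrightarrow> e \<in> A \<Longrightarrow> eps (a e) \<noteq> eps (c e) \<and> eps (b e) \<noteq> eps (d e)"
  by (auto simp: balances_def Rk_def sides_def)

lemma balances_insert:
  assumes "balances eps A" "e \<in> E" "eps (a e) \<noteq> eps (c e)"
  shows "balances eps (insert e A)"
  using assms balances_seg[OF assms(1,2)] unfolding balances_def Rk_insert by auto

lemma qset_mem: "a e \<in> qset e" "b e \<in> qset e" "c e \<in> qset e" "d e \<in> qset e"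
  by (auto simp: qset_def)

text \<open>The colours exclude that the rest of the boundary pairs \<open>a e\<close> with \<open>d e\<close>, the only pairing for which
both ways to complete the boundary give the same number of classes.\<close>

lemma nf_balanced:
  assumes A: "insert e Y \<subseteq> A" "A \<subseteq> E" "balances eps A" "e \<notin> Y"
  shows "nf (insert e Y) \<noteq> nf Y"
proof -
  have e: "e \<in> E" and Y: "Y \<subseteq> E" using A by auto
  have col: "colours_rest eps Y e" by (rule balances_rest[OF balances_mono[OF A(3)]]) (use A in auto)
  note cp = coloured_pair[OF Y e col]
  have "eps (a e) \<noteq> eps (b e)" "eps (c e) \<noteq> eps (d e)" "eps (a e) \<noteq> eps (c e)"
    using balances_seg[OF A(3) e] balances_side[OF A(3), of e] A by auto
  then have ad: "(a e, d e) \<notin> conn (rest Y e)" "(b e, c e) \<notin> conn (rest Y e)"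
    using cp[of "a e" "d e"] cp[of "b e" "c e"] corners[OF e] qset_mem by auto
  have "\<not> ((a e, b e) \<in> conn (rest Y e) \<and> (a e, c e) \<in> conn (rest Y e))"
    using ad(2) conn_sym[of "a e" "b e"] conn_trans[of "b e" "a e" _ "c e"] by blast
  then show ?thesis
    using ad rest_pairing[OF Y e] nf_without[OF Y e A(4)] nf_with[OF Y e] by (auto split: if_splits)
qed

text \<open>Edges are added as long as they are bridges. If the colours fail to alternate along the sides of the new
edge, the colouring is reversed on one of the two components that it joins.\<close>

lemma spanning_forest_balanced:
  assumes "A \<subseteq> E"
  shows "\<exists>T\<subseteq>A. \<exists>eps. balances eps T \<and> nf T = nk T \<and> conn (Rk T) = conn (Rk A)"
proof -
  have "finite A" using assms finite_E finite_subset by blast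
  then show ?thesis using assms
  proof (induction A rule: finite_induct)
    case empty
    have "balances eps0 {}"
      using eps0_al eps0_seg by (fastforce simp: balances_def Rk_def gaps_def segs_def sides_def)
    then show ?case using nf_empty by auto
  next
    case (insert e A)
    then obtain T eps where T: "T \<subseteq> A" "balances eps T" "nf T = nk T" "conn (Rk T) = conn (Rk A)" by auto
    have e: "e \<in> E" and TE: "T \<subseteq> E" using insert T by auto
    show ?case
    proof (cases "(a e, c e) \<in> conn (Rk A)")
      case True
      then have "conn (Rk (insert e A)) = conn (Rk T)"
        using conn_Rk_insert[OF e, of A] conn_insert_conn[OF True] T by simp
      then show ?thesis using T by blast
    next
      case False
      have ne: "nk (insert e T) \<noteq> nk T" using False T nk_insert_eq_iff[OF e] by simp
      have "nf (insert e T) = nk (insert e T)"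
        using nf_bridge[OF TE e ne] nk_step[OF e, of T] ne T(3) by simp
      moreover have "conn (Rk (insert e T)) = conn (Rk (insert e A))"
      proof -
        have "conn (insert (a e, c e) (Rk T)) = conn (insert (a e, c e) (Rk A))"
        proof (rule conn_eqI)
          have "Rk B \<subseteq> conn (Rk B)" for B by (auto intro: conn_base)
          from this[of T] this[of A] have "Rk T \<subseteq> conn (Rk A)" "Rk A \<subseteq> conn (Rk T)" using T(4) by simp_all
          moreover have "conn (Rk A) \<subseteq> conn (insert (a e, c e) (Rk A))" "conn (Rk T) \<subseteq> conn (insert (a e, c e) (Rk T))"
            by (intro conn_mono; blast)+
          ultimately show "insert (a e, c e) (Rk T) \<subseteq> conn (insert (a e, c e) (Rk A))"
            "insert (a e, c e) (Rk A) \<subseteq> conn (insert (a e, c e) (Rk T))"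
            using conn_base[of "a e" "c e" "insert (a e, c e) (Rk A)"]
              conn_base[of "a e" "c e" "insert (a e, c e) (Rk T)"] by auto
        qed
        then show ?thesis using conn_Rk_insert[OF e] by simp
      qed
      moreover have "\<exists>eps. balances eps (insert e T)"
      proof (cases "eps (a e) = eps (c e)")
        case False
        then show ?thesis using balances_insert[OF T(2) e] by blast
      next
        case True
        let ?eps = "\<lambda>p. eps p \<noteq> ((a e, p) \<in> conn (Rk T))"
        have "(a e, p) \<in> conn (Rk T) \<longleftrightarrow> (a e, q) \<in> conn (Rk T)" if "(p, q) \<in> Rk T" for p q
          using conn_base[OF that] conn_sym[of p q] conn_trans[of "a e" p _ q] conn_trans[of "a e" q _ p] by blast
        then have "balances ?eps T" using T(2) by (auto simp: balances_def)
        moreover have "?eps (a e) \<noteq> ?eps (c e)" using True False T(4) by auto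
        ultimately show ?thesis using balances_insert[of ?eps T e] e by blast
      qed
      ultimately show ?thesis using T(1) by (intro exI[of _ "insert e T"]) auto
    qed
  qed
qed

text \<open>The witness of non-orientability: a coloured spanning forest and an edge that violates its colouring.
It serves both to find feasible sets of different parity and to construct a Moebius band.\<close>

lemma unbalanced_edge:
  assumes A: "A \<subseteq> E" and nb: "\<nexists>eps. balances eps A"
  obtains T eps e where "T \<subseteq> A" "balances eps T" "nf T = nk T" "conn (Rk T) = conn (Rk A)"
    "e \<in> A" "e \<notin> T" "eps (a e) = eps (c e)"
proof -
  obtain T eps where T: "T \<subseteq> A" "balances eps T" "nf T = nk T" "conn (Rk T) = conn (Rk A)"
    using spanning_forest_balanced[OF A] by blast
  have "\<exists>e\<in>A. eps (a e) = eps (c e)"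
  proof (rule ccontr)
    assume "\<not> ?thesis"
    then have side: "eps (a e) \<noteq> eps (c e)" "eps (b e) \<noteq> eps (d e)" if "e \<in> A" for e
      using that balances_seg[OF T(2), of e] A by auto
    have "eps p \<noteq> eps q" if "(p, q) \<in> Rk A" for p q
    proof -
      have "(p, q) \<in> Rk T \<or> (\<exists>e\<in>A. (p, q) = (a e, c e) \<or> (p, q) = (b e, d e))"
        using that unfolding Rk_def sides_def by blast
      then show ?thesis using T(2) side unfolding balances_def by auto
    qed
    then have "balances eps A" unfolding balances_def by auto
    then show False using nb by blast
  qed
  then obtain e where e: "e \<in> A" "eps (a e) = eps (c e)" by blast
  then have "e \<notin> T" using balances_side[OF T(2), of e] by auto
  then show ?thesis using e by (intro that[OF T])
qed

text \<open>For the violating edge the rest of the boundary has to pair flags of different colours, hence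
neither \<open>a e\<close> with \<open>c e\<close> nor \<open>b e\<close> with \<open>d e\<close>; so the number of boundary components does not grow.
It cannot fall either, as the forest has the least number possible.\<close>

lemma nf_unbalanced:
  assumes A: "A \<subseteq> E" and nb: "\<nexists>eps. balances eps A"
  shows "\<exists>T e. insert e T \<subseteq> A \<and> e \<notin> T \<and> nf T = nk A \<and> nf (insert e T) = nk A"
proof -
  obtain T eps e where T: "T \<subseteq> A" "balances eps T" "nf T = nk T" "conn (Rk T) = conn (Rk A)"
    "e \<in> A" "e \<notin> T" "eps (a e) = eps (c e)"
    using unbalanced_edge[OF A nb] by blast
  have e: "e \<in> E" and TE: "T \<subseteq> E" using A T by auto
  have kTA: "nk T = nk A" using ncomp_cong[OF T(4)] by (simp add: nk_def)
  have "nk A \<le> nk (insert e T)"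
    unfolding nk_def by (rule ncomp_coarser(1)[OF finite_X Rk_mono]) (use T in auto)
  then have ge: "nk A \<le> nf (insert e T)" using nk_le_nf[of "insert e T"] by simp
  have "(a e, c e) \<notin> conn (rest T e)"
    using coloured_pair[OF TE e balances_rest[OF T(2)], of "a e" "c e"] T(7) qset_mem corners[OF e] by auto
  then have "nf (insert e T) \<le> nf T"
    using nf_without[OF TE e T(6)] nf_with[OF TE e] by (auto split: if_splits)
  then show ?thesis using ge T kTA by (intro exI[of _ T] exI[of _ e]) auto
qed

sublocale surface_counts E nk nf "\<lambda>A. \<nexists>eps. balances eps A"
proof unfold_locales
  show "finite E" by (rule finite_E)
  show "nk (insert e A) \<le> nk A \<and> nk A \<le> Suc (nk (insert e A))" if "e \<in> E" for A e
    by (rule nk_step[OF that])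
  show "nk (insert e B) = nk B" if "A \<subseteq> B" "e \<in> E" "nk (insert e A) = nk A" for A B e
    by (rule nk_closure[OF that])
  show "nf {} = nk {}" by (rule nf_empty)
  show "nk A \<le> nf A" for A by (rule nk_le_nf)
  show "nf (insert e A) \<le> Suc (nf A) \<and> nf A \<le> Suc (nf (insert e A))" if "A \<subseteq> E" "e \<in> E" for A e
    by (rule nf_step[OF that])
  show "nf A = Suc (nf (insert e A))" if "A \<subseteq> E" "e \<in> E" "nk (insert e A) \<noteq> nk A" for A e
    by (rule nf_bridge[OF that])
  show "\<exists>e\<in>A. nf A = Suc (nf (A - {e}))" if "A \<subseteq> E" "nk A < nf A" for A
    by (rule nf_merge[OF that])
  show "nf (insert e Y) \<noteq> nf Y"
    if "insert e Y \<subseteq> A" "A \<subseteq> E" "\<not> (\<nexists>eps. balances eps A)" "e \<notin> Y" for e Y A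
    using nf_balanced[OF that(1,2) _ that(4)] that(3) by auto
  show "\<exists>T e. insert e T \<subseteq> A \<and> e \<notin> T \<and> nf T = nk A \<and> nf (insert e T) = nk A"
    if "A \<subseteq> E" "\<nexists>eps. balances eps A" for A
    by (rule nf_unbalanced[OF that])
qed

end

section \<open>The boundary of an embedded surface\<close>

text \<open>On a compact set a continuous map to a Hausdorff space is a quotient map, so maps with the same fibres
have homeomorphic images.\<close>

lemma quotient_map_exists:
  fixes p :: "'k::topological_space \<Rightarrow> 'a::t2_space" and q :: "'k \<Rightarrow> 'b::t2_space"
  assumes K: "compact K" and p: "continuous_on K p" and q: "continuous_on K q"
    and eq: "\<And>x y. x \<in> K \<Longrightarrow> y \<in> K \<Longrightarrow> p x = p y \<longleftrightarrow> q x = q y"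
  obtains h where "continuous_on (p ` K) h" "inj_on h (p ` K)" "h ` p ` K = q ` K"
    "\<And>x. x \<in> K \<Longrightarrow> h (p x) = q x"
proof -
  let ?h = "\<lambda>y. q (SOME x. x \<in> K \<and> p x = y)"
  have h: "?h (p x) = q x" if "x \<in> K" for x
  proof -
    have "(SOME z. z \<in> K \<and> p z = p x) \<in> K \<and> p (SOME z. z \<in> K \<and> p z = p x) = p x"
      by (rule someI_ex) (use that in auto)
    then show ?thesis using eq that by blast
  qed
  have "closed (?h -` B \<inter> p ` K)" if B: "closed B" for B
  proof -
    have "?h -` B \<inter> p ` K = p ` (q -` B \<inter> K)" using h by auto
    moreover have "compact (q -` B \<inter> K)"
    proof -
      obtain A where A: "closed A" "A \<inter> K = q -` B \<inter> K"
        using q B unfolding continuous_on_closed_invariant by blast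
      have "compact (K \<inter> A)" using compact_Int_closed[OF K A(1)] .
      then show ?thesis using A(2) by (simp add: Int_commute)
    qed
    then have "compact (p ` (q -` B \<inter> K))"
      by (intro compact_continuous_image continuous_on_subset[OF p]) auto
    ultimately show ?thesis by (simp add: compact_imp_closed)
  qed
  moreover have "closed (p ` K)" using compact_continuous_image[OF p K] by (rule compact_imp_closed)
  ultimately have "continuous_on (p ` K) ?h" by (simp add: continuous_on_closed_vimage)
  moreover have "inj_on ?h (p ` K)" using h eq by (auto simp: inj_on_def)
  moreover have "?h ` p ` K = q ` K" using h by (force simp: image_image)
  ultimately show ?thesis using h that by blast
qed

text \<open>If \<open>x\<close> has a neighbourhood homeomorphic to the plane, then \<open>g\<close> maps it to an open set by invariance
of domain. Conversely a small disc around an interior point of the image pulls back to such a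
neighbourhood.\<close>

lemma embedded_boundary:
  fixes g :: "'a::t2_space \<Rightarrow> 'b::euclidean_space"
  assumes W: "openin (top_of_set S) W" and x: "x \<in> W" and g: "homeomorphism W W' g h"
    and dim: "DIM('b) = 2"
  shows "x \<in> surface_boundary S \<longleftrightarrow> g x \<notin> interior W'"
proof -
  have WS: "W \<subseteq> S" using W openin_imp_subset by blast
  have hg: "h (g y) = y" if "y \<in> W" for y using g that by (simp add: homeomorphism_def)
  have gh: "g (h z) = z" if "z \<in> W'" for z using g that by (simp add: homeomorphism_def)
  have gW: "g ` W = W'" "h ` W' = W" using g by (auto simp: homeomorphism_def)
  have dim': "DIM('b) = DIM(complex)" using dim by simp
  have "(\<exists>U. openin (top_of_set S) U \<and> x \<in> U \<and> U homeomorphic (UNIV :: complex set)) \<longleftrightarrow> g x \<in> interior W'"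
  proof
    assume "\<exists>U. openin (top_of_set S) U \<and> x \<in> U \<and> U homeomorphic (UNIV :: complex set)"
    then obtain U \<phi> \<psi> where U: "openin (top_of_set S) U" "x \<in> U"
      and \<phi>: "homeomorphism U (UNIV :: complex set) \<phi> \<psi>"
      by (auto simp: homeomorphic_def)
    have "openin (top_of_set U) (U \<inter> W)"
    proof -
      obtain T where "open T" "W = S \<inter> T" using W by (auto simp: openin_open)
      moreover have "U \<subseteq> S" using U openin_imp_subset by blast
      ultimately show ?thesis by (auto simp: openin_open)
    qed
    then have "openin (top_of_set UNIV) (\<phi> ` (U \<inter> W))" by (rule homeomorphism_imp_open_map[OF \<phi>])
    then have op: "open (\<phi> ` (U \<inter> W))" by simp
    have im: "\<psi> ` \<phi> ` (U \<inter> W) = U \<inter> W" using \<phi> by (force simp: homeomorphism_def image_image)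
    have inj\<psi>: "inj \<psi>" using \<phi> by (metis UNIV_I homeomorphism_def injI)
    have "continuous_on (\<phi> ` (U \<inter> W)) (g \<circ> \<psi>)"
    proof (rule continuous_on_compose)
      show "continuous_on (\<phi> ` (U \<inter> W)) \<psi>"
        using \<phi> by (auto simp: homeomorphism_def intro: continuous_on_subset)
      show "continuous_on (\<psi> ` \<phi> ` (U \<inter> W)) g"
        unfolding im using g by (auto simp: homeomorphism_def intro: continuous_on_subset)
    qed
    moreover have "inj_on (g \<circ> \<psi>) (\<phi> ` (U \<inter> W))"
    proof (rule comp_inj_on)
      show "inj_on \<psi> (\<phi> ` (U \<inter> W))" using inj\<psi> by (rule inj_on_subset) auto
      show "inj_on g (\<psi> ` \<phi> ` (U \<inter> W))" unfolding im by (rule inj_on_inverseI[of _ h]) (use hg in auto)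
    qed
    ultimately have "open ((g \<circ> \<psi>) ` \<phi> ` (U \<inter> W))"
      by (rule invariance_of_domain_gen[OF op]) (simp add: dim')
    moreover have "(g \<circ> \<psi>) ` \<phi> ` (U \<inter> W) = g ` (U \<inter> W)" using im by (metis image_comp)
    ultimately have "open (g ` (U \<inter> W))" by simp
    moreover have "g ` (U \<inter> W) \<subseteq> W'" using gW by auto
    ultimately show "g x \<in> interior W'" using U(2) x by (intro interiorI) auto
  next
    assume "g x \<in> interior W'"
    then obtain r where r: "r > 0" "ball (g x) r \<subseteq> W'" using mem_interior by blast
    have hom: "homeomorphism W' W h g" using g by (rule homeomorphism_symD)
    have "openin (top_of_set W') (ball (g x) r)" using r by (simp add: open_subset)
    then have "openin (top_of_set W) (h ` ball (g x) r)" by (rule homeomorphism_imp_open_map[OF hom])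
    then have "openin (top_of_set S) (h ` ball (g x) r)" using W openin_trans by blast
    moreover have "x \<in> h ` ball (g x) r" using hg[OF x] r(1) by (metis centre_in_ball imageI)
    moreover have "h ` ball (g x) r homeomorphic (UNIV :: complex set)"
    proof -
      have "h ` ball (g x) r homeomorphic ball (g x) r" unfolding homeomorphic_sym[of "h ` _"]
        unfolding homeomorphic_def using homeomorphism_of_subsets[OF hom r(2) _ refl] gW r(2)
        by (metis image_mono)
      moreover have "ball (g x) r homeomorphic (UNIV :: 'b set)" by (rule homeomorphic_ball_UNIV[OF r(1)])
      moreover have "(UNIV :: 'b set) homeomorphic (UNIV :: complex set)" using dim' by (simp add: homeomorphic_UNIV_UNIV)
      ultimately show ?thesis using homeomorphic_trans by metis
    qed
    ultimately show "\<exists>U. openin (top_of_set S) U \<and> x \<in> U \<and> U homeomorphic (UNIV :: complex set)" by blast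
  qed
  then show ?thesis using x WS by (auto simp: surface_boundary_def)
qed

lemma boundary_of_patch:
  fixes G :: "'b::euclidean_space \<Rightarrow> 'a::t2_space"
  assumes Q: "compact Q" and G: "continuous_on Q G" "inj_on G Q" and C: "closed C"
    and q: "q \<in> Q" "G q \<notin> C" and dim: "DIM('b) = 2"
  shows "G q \<in> surface_boundary (G ` Q \<union> C) \<longleftrightarrow> q \<notin> interior Q"
proof -
  obtain g where g: "homeomorphism Q (G ` Q) G g" using homeomorphism_compact[OF Q G(1) refl G(2)] by blast
  let ?W = "G ` Q - C" and ?W' = "Q - G -` C"
  have "openin (top_of_set (G ` Q \<union> C)) ?W"
    unfolding openin_open using C by (intro exI[of _ "- C"]) auto
  moreover have "homeomorphism ?W' ?W G g"
    by (rule homeomorphism_of_subsets[OF g]) auto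
  then have "homeomorphism ?W ?W' g G" by (rule homeomorphism_symD)
  moreover have "g (G q) = q" using g q by (simp add: homeomorphism_def)
  ultimately have "G q \<in> surface_boundary (G ` Q \<union> C) \<longleftrightarrow> q \<notin> interior ?W'"
    using embedded_boundary[of "G ` Q \<union> C" ?W "G q" ?W' g G] q dim by auto
  moreover have "?W' = Q - (Q \<inter> G -` C)" by auto
  moreover have "closed (Q \<inter> G -` C)"
    by (rule continuous_closed_preimage[OF G(1) compact_imp_closed[OF Q] C])
  ultimately show ?thesis using q by (simp add: interior_diff closure_closed)
qed

section \<open>Arcs in a circle\<close>

text \<open>The end points of an arc are its non-cut points. In this form they depend on the set only, so the two
parametrisations of a segment, from its vertex and from its edge, have the same ends.\<close>

definition ends :: "'a::t2_space set \<Rightarrow> 'a set" where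
  "ends s = {x \<in> s. connected (s - {x})}"

lemma ends_param:
  fixes \<gamma> :: "real \<Rightarrow> 'a::t2_space"
  assumes "continuous_on {a..b} \<gamma>" "inj_on \<gamma> {a..b}" "a < b"
  shows "ends (\<gamma> ` {a..b}) = {\<gamma> a, \<gamma> b}"
proof -
  obtain g where g: "homeomorphism {a..b} (\<gamma> ` {a..b}) \<gamma> g"
    using homeomorphism_compact[OF _ assms(1) refl assms(2)] by auto
  have "connected (\<gamma> ` {a..b} - {\<gamma> t}) \<longleftrightarrow> t = a \<or> t = b" if t: "t \<in> {a..b}" for t
  proof -
    have "\<gamma> ` {a..b} - {\<gamma> t} = \<gamma> ` ({a..b} - {t})"
      using assms(2) t by (auto dest: inj_onD)
    moreover have "({a..b} - {t}) homeomorphic (\<gamma> ` ({a..b} - {t}))"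
      unfolding homeomorphic_def
      by (intro exI[of _ \<gamma>] exI[of _ g] homeomorphism_of_subsets[OF g]) auto
    ultimately have "connected (\<gamma> ` {a..b} - {\<gamma> t}) \<longleftrightarrow> connected ({a..b} - {t})"
      using homeomorphic_connectedness by metis
    also have "\<dots> \<longleftrightarrow> t = a \<or> t = b"
    proof
      assume c: "connected ({a..b} - {t})"
      show "t = a \<or> t = b"
      proof (rule ccontr)
        assume n: "\<not> (t = a \<or> t = b)"
        have "a \<in> {a..b} - {t}" "b \<in> {a..b} - {t}" using n t assms(3) by auto
        then have "t \<in> {a..b} - {t}"
          using connectedD_interval[OF c] t n by (meson atLeastAtMost_iff)
        then show False by simp
      qed
    next
      assume "t = a \<or> t = b"
      then have "{a..b} - {t} = {a<..b} \<or> {a..b} - {t} = {a..<b}" using assms(3) by auto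
      then show "connected ({a..b} - {t})" by (metis connected_Ioc connected_Ico)
    qed
    finally show ?thesis .
  qed
  then show ?thesis using assms(3) by (auto simp: ends_def)
qed

lemma cis_eq_cis_iff: "cis x = cis y \<longleftrightarrow> (\<exists>n::int. x = y + 2 * of_int n * pi)"
proof -
  have "cis x = cis y \<longleftrightarrow> exp (\<i> * complex_of_real x) = exp (\<i> * complex_of_real y)"
    by (simp add: cis_conv_exp)
  also have "\<dots> \<longleftrightarrow> (\<exists>n::int. \<i> * complex_of_real x = \<i> * complex_of_real y + (of_int (2 * n) * pi) * \<i>)"
    by (rule exp_eq)
  also have "\<dots> \<longleftrightarrow> (\<exists>n::int. x = y + 2 * of_int n * pi)"
    by (simp add: complex_eq_iff)
  finally show ?thesis .
qed

lemma cis_inj: "cis x = cis y \<Longrightarrow> \<bar>x - y\<bar> < 2 * pi \<Longrightarrow> x = y"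
proof -
  assume "cis x = cis y" and lt: "\<bar>x - y\<bar> < 2 * pi"
  then obtain n :: int where n: "x = y + 2 * of_int n * pi" by (auto simp: cis_eq_cis_iff)
  then have "\<bar>2 * of_int n * pi\<bar> < 2 * pi" using lt by simp
  then have "\<bar>real_of_int n\<bar> < 1" by (simp add: abs_mult)
  then have "n = 0" by linarith
  then show "x = y" using n by simp
qed

lemma cis_surj_interval: "norm z = 1 \<Longrightarrow> \<exists>t. a \<le> t \<and> t < a + 2 * pi \<and> z = cis t"
proof -
  assume z: "norm z = 1"
  then have zc: "z = cis (Arg z)" using cis_Arg[of z] by (metis div_by_1 norm_eq_zero of_real_1 sgn_eq zero_neq_one)
  let ?n = "\<lfloor>(Arg z - a) / (2 * pi)\<rfloor>"
  let ?t = "Arg z - 2 * of_int ?n * pi"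
  have "of_int ?n \<le> (Arg z - a) / (2 * pi)" "(Arg z - a) / (2 * pi) < of_int ?n + 1" by linarith+
  moreover have "2 * pi > 0" by simp
  ultimately have "of_int ?n * (2 * pi) \<le> Arg z - a" "Arg z - a < (of_int ?n + 1) * (2 * pi)"
    by (simp_all only: pos_le_divide_eq pos_divide_less_eq)
  then have "a \<le> ?t" "?t < a + 2 * pi" by (auto simp: algebra_simps)
  moreover have "cis (Arg z) = cis ?t" unfolding cis_eq_cis_iff by (intro exI[of _ ?n]) simp
  ultimately show ?thesis using zc by (intro exI[of _ ?t]) simp
qed

lemma continuous_on_cis' [continuous_intros]: "continuous_on S f \<Longrightarrow> continuous_on S (\<lambda>x. cis (f x))"
  unfolding cis_conv_exp by (intro continuous_intros)

lemma inj_on_cis: "b < a + 2 * pi \<Longrightarrow> inj_on cis {a..b}"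
  by (rule inj_onI) (rule cis_inj, auto)

text \<open>A segment is contractible and therefore misses some point of the circle. Cutting the circle there
  turns the segment into a compact connected set of angles.\<close>

lemma circle_segment:
  assumes s: "s \<subseteq> sphere (0::complex) 1" and seg: "is_segment s"
  obtains a b where "a < b" "b < a + 2 * pi" "s = cis ` {a..b}"
proof -
  have "\<not> (sphere (0::complex) 1 homeomorphic {0..1::real})"
  proof
    assume "sphere (0::complex) 1 homeomorphic {0..1::real}"
    then have "contractible (sphere (0::complex) 1) \<longleftrightarrow> contractible {0..1::real}"
      by (rule homeomorphic_contractible_eq)
    moreover have "contractible {0..1::real}" by (rule convex_imp_contractible) simp
    ultimately show False by (simp add: contractible_sphere)
  qed
  then have "s \<noteq> sphere 0 1" using seg by (auto simp: is_segment_def)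
  then obtain z where "z \<in> sphere 0 1" and z: "z \<notin> s" using s by blast
  then have z: "norm z = 1" "z \<notin> s" by auto
  obtain \<theta> where \<theta>: "z = cis \<theta>" using cis_surj_interval[OF z(1)] by blast
  have comp: "compact s" and conn: "connected s" and inf: "infinite s"
  proof -
    have h: "{0..1::real} homeomorphic s" using seg unfolding is_segment_def by (subst homeomorphic_sym)
    show "compact s" using homeomorphic_compactness[OF h] by simp
    show "connected s" using homeomorphic_connectedness[OF h] by simp
    show "infinite s"
    proof
      assume "finite s"
      moreover obtain f g where "homeomorphism {0..1::real} s f g" using h by (auto simp: homeomorphic_def)
      then have "{0..1::real} = g ` s" by (simp add: homeomorphism_def)
      ultimately have "finite {0..1::real}" by simp
      then show False by (simp add: infinite_Icc)
    qed
  qed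
  let ?I = "{t \<in> {\<theta>..\<theta> + 2 * pi}. cis t \<in> s}"
  have comI: "compact ?I"
  proof -
    have "closed ({\<theta>..\<theta> + 2 * pi} \<inter> cis -` s)"
      by (intro continuous_closed_preimage continuous_intros compact_imp_closed[OF comp])
    moreover have "?I = {\<theta>..\<theta> + 2 * pi} \<inter> cis -` s" by auto
    moreover have "?I \<subseteq> {\<theta>..\<theta> + 2 * pi}" by auto
    ultimately show ?thesis using compact_Icc[of \<theta> "\<theta> + 2 * pi"] by (metis closed_Int_compact inf.absorb1 inf.idem)
  qed
  have open_I: "\<theta> < t \<and> t < \<theta> + 2 * pi" if "t \<in> ?I" for t
  proof -
    have "cis (\<theta> + 2 * pi) = z" using \<theta> unfolding \<theta> cis_eq_cis_iff by (intro exI[of _ 1]) simp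
    then have "t \<noteq> \<theta>" "t \<noteq> \<theta> + 2 * pi" using that z \<theta> by auto
    then show ?thesis using that by auto
  qed
  have im: "cis ` ?I = s"
  proof -
    have "w \<in> cis ` ?I" if w: "w \<in> s" for w
    proof -
      have "norm w = 1" using w s by auto
      then obtain t where "\<theta> \<le> t" "t < \<theta> + 2 * pi" "w = cis t" using cis_surj_interval by blast
      then show ?thesis using w by auto
    qed
    then show ?thesis by auto
  qed
  have inj: "inj_on cis ?I" by (rule inj_onI) (rule cis_inj, simp, use open_I in fastforce)
  have "\<exists>g. homeomorphism ?I s cis g"
    by (rule homeomorphism_compact[OF comI _ im inj]) (intro continuous_intros)
  then have "?I homeomorphic s" unfolding homeomorphic_def by blast
  then have "connected ?I" using conn homeomorphic_connectedness[of ?I s] by simp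
  then obtain a b where ab: "?I = {a..b}" using comI connected_compact_interval_1 by blast
  have "a < b"
  proof (rule ccontr)
    assume "\<not> a < b"
    then have "finite ?I" unfolding ab by (cases "a = b") auto
    then show False using inf im by (metis finite_imageI)
  qed
  moreover have "b < a + 2 * pi" using open_I[of a] open_I[of b] \<open>a < b\<close> unfolding ab by auto
  moreover have "s = cis ` {a..b}" using im unfolding ab by simp
  ultimately show ?thesis by (intro that[of a b])
qed


section \<open>Strips\<close>

abbreviation Sq :: "(real \<times> real) set" where "Sq \<equiv> {0..1} \<times> {0..1}"

text \<open>Discs are parametrised by the unit square, so that two arcs in the boundary can be made opposite sides.\<close>

definition strip :: "(real \<times> real \<Rightarrow> 'a::t2_space) \<Rightarrow> 'a set \<Rightarrow> bool" where
  "strip H M \<longleftrightarrow> continuous_on Sq H \<and> inj_on H Sq \<and> H ` Sq = M"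

definition clip :: "real \<Rightarrow> real" where "clip u = max 0 (min 1 u)"

lemma continuous_on_clip [continuous_intros]: "continuous_on S f \<Longrightarrow> continuous_on S (\<lambda>x. clip (f x))"
  unfolding clip_def by (intro continuous_intros)

lemma clip_simps [simp]: "u \<le> 0 \<Longrightarrow> clip u = 0" "1 \<le> u \<Longrightarrow> clip u = 1" "0 \<le> u \<Longrightarrow> u \<le> 1 \<Longrightarrow> clip u = u"
  by (auto simp: clip_def)

text \<open>For \<open>t\<close> from \<open>0\<close> to \<open>4\<close> the point \<open>(sqx t, sqy t)\<close> runs once around the boundary of the unit
  square, starting at the origin and moving up the left side.\<close>

definition sqx :: "real \<Rightarrow> real" where "sqx t = clip (min (t - 1) (4 - t))"
definition sqy :: "real \<Rightarrow> real" where "sqy t = clip (min t (3 - t))"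

text \<open>The maximum norm.\<close>

definition supd :: "real \<times> real \<Rightarrow> real" where "supd p = max \<bar>fst p\<bar> \<bar>snd p\<bar>"

lemma supd_scale: "0 \<le> r \<Longrightarrow> supd (r * x, r * y) = r * supd (x, y)"
  by (simp add: supd_def abs_mult max_mult_distrib_left)

lemma supd_le: "supd (x, y) \<le> k \<longleftrightarrow> \<bar>x\<bar> \<le> k \<and> \<bar>y\<bar> \<le> k"
  by (simp add: supd_def)

lemma sq_sides:
  "0 \<le> t \<Longrightarrow> t \<le> 1 \<Longrightarrow> sqx t = 0 \<and> sqy t = t"
  "1 \<le> t \<Longrightarrow> t \<le> 2 \<Longrightarrow> sqx t = t - 1 \<and> sqy t = 1"
  "2 \<le> t \<Longrightarrow> t \<le> 3 \<Longrightarrow> sqx t = 1 \<and> sqy t = 3 - t"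
  "3 \<le> t \<Longrightarrow> t \<le> 4 \<Longrightarrow> sqx t = 4 - t \<and> sqy t = 0"
  by (auto simp: sqx_def sqy_def clip_def)

lemma sq_cases:
  fixes t :: real
  assumes "t \<in> {0..4}"
  obtains "0 \<le> t" "t \<le> 1" | "1 \<le> t" "t \<le> 2" | "2 \<le> t" "t \<le> 3" | "3 \<le> t" "t \<le> 4"
  using assms by fastforce

lemma sq_boundary_norm: "t \<in> {0..4} \<Longrightarrow> supd (sqx t - 1/2, sqy t - 1/2) = 1/2"
  by (erule sq_cases) (auto simp: sq_sides supd_def max_def abs_if)

lemma sq_boundary_inj:
  assumes "t \<in> {0..4}" "t' \<in> {0..4}"
  shows "sqx t = sqx t' \<and> sqy t = sqy t' \<longleftrightarrow> t = t' \<or> {t, t'} = {0, 4}"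
  using assms(1)
  by (rule sq_cases; insert assms(2); elim sq_cases) (auto simp: sq_sides doubleton_eq_iff)

lemma sq_boundary_surj:
  assumes "supd (x - 1/2, y - 1/2) = 1/2"
  shows "\<exists>t\<in>{0..4}. x = sqx t \<and> y = sqy t"
proof -
  have b: "0 \<le> x" "x \<le> 1" "0 \<le> y" "y \<le> 1" and c: "x = 0 \<or> x = 1 \<or> y = 0 \<or> y = 1"
    using assms by (auto simp: supd_def max_def abs_if split: if_splits)
  from c show ?thesis
  proof (elim disjE)
    assume "x = 0" then show ?thesis using b sq_sides(1)[of y] by (intro bexI[of _ y]) auto
  next
    assume "x = 1" then show ?thesis using b sq_sides(3)[of "3 - y"] by (intro bexI[of _ "3 - y"]) auto
  next
    assume "y = 0" then show ?thesis using b sq_sides(4)[of "4 - x"] by (intro bexI[of _ "4 - x"]) auto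
  next
    assume "y = 1" then show ?thesis using b sq_sides(2)[of "1 + x"] by (intro bexI[of _ "1 + x"]) auto
  qed
qed

text \<open>The square is the cone over its boundary and the disc is the cone over the circle, so every
  parametrisation of the circle by the boundary of the square extends to the square.\<close>

lemma square_to_disc:
  assumes abcd: "a < b" "b < c" "c < d" "d < a + 2 * pi"
  obtains H where "strip H (cball (0::complex) 1)"
    "\<And>y. y \<in> {0..1} \<Longrightarrow> H (0, y) = cis (a + (b - a) * y)"
    "\<And>x. x \<in> {0..1} \<Longrightarrow> H (x, 1) = cis (b + (c - b) * x)"
    "\<And>y. y \<in> {0..1} \<Longrightarrow> H (1, y) = cis (d - (d - c) * y)"
    "\<And>x. x \<in> {0..1} \<Longrightarrow> H (x, 0) = cis (a + 2 * pi - (a + 2 * pi - d) * x)"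
proof -
  let ?K = "{0..4::real} \<times> {0..1::real}"
  \<comment> \<open>The angle at which the boundary point of the square with parameter \<open>t\<close> is placed.\<close>
  define pl where "pl t = a + (b - a) * clip t + (c - b) * clip (t - 1) + (d - c) * clip (t - 2) +
    (a + 2 * pi - d) * clip (t - 3)" for t
  have pl: "0 \<le> t \<Longrightarrow> t \<le> 1 \<Longrightarrow> pl t = a + (b - a) * t"
    "1 \<le> t \<Longrightarrow> t \<le> 2 \<Longrightarrow> pl t = b + (c - b) * (t - 1)"
    "2 \<le> t \<Longrightarrow> t \<le> 3 \<Longrightarrow> pl t = c + (d - c) * (t - 2)"
    "3 \<le> t \<Longrightarrow> t \<le> 4 \<Longrightarrow> pl t = d + (a + 2 * pi - d) * (t - 3)" for t
    by (auto simp: pl_def)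
  have plc: "continuous_on S pl" for S unfolding pl_def by (intro continuous_intros)
  have pl_less: "pl s < pl t" if "s \<in> {0..4}" "t \<in> {0..4}" "s < t" for s t
  proof -
    have pos: "b - a > 0" "c - b > 0" "d - c > 0" "a + 2 * pi - d > 0" using abcd by auto
    have le: "clip s \<le> clip t" "clip (s - 1) \<le> clip (t - 1)" "clip (s - 2) \<le> clip (t - 2)" "clip (s - 3) \<le> clip (t - 3)"
      using that by (auto simp: clip_def)
    have mle: "(b - a) * clip s \<le> (b - a) * clip t" "(c - b) * clip (s - 1) \<le> (c - b) * clip (t - 1)"
      "(d - c) * clip (s - 2) \<le> (d - c) * clip (t - 2)"
      "(a + 2 * pi - d) * clip (s - 3) \<le> (a + 2 * pi - d) * clip (t - 3)"
      using le pos by (auto intro!: mult_left_mono)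
    have "clip s < clip t \<or> clip (s - 1) < clip (t - 1) \<or> clip (s - 2) < clip (t - 2) \<or> clip (s - 3) < clip (t - 3)"
      using that by (auto simp: clip_def)
    then have "(b - a) * clip s < (b - a) * clip t \<or> (c - b) * clip (s - 1) < (c - b) * clip (t - 1) \<or>
      (d - c) * clip (s - 2) < (d - c) * clip (t - 2) \<or>
      (a + 2 * pi - d) * clip (s - 3) < (a + 2 * pi - d) * clip (t - 3)"
      using pos by (auto intro!: mult_strict_left_mono)
    then show ?thesis unfolding pl_def using mle by linarith
  qed
  have pl04: "pl 0 = a" "pl 4 = a + 2 * pi" by (simp_all add: pl)
  have pl_range: "a \<le> pl t \<and> pl t \<le> a + 2 * pi" if "t \<in> {0..4}" for t
    using pl_less[of 0 t] pl_less[of t 4] that pl04 by (cases "t = 0"; cases "t = 4") auto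
  have cis_pl: "cis (pl t) = cis (pl t') \<longleftrightarrow> t = t' \<or> {t, t'} = {0, 4}" if t: "t \<in> {0..4}" "t' \<in> {0..4}" for t t'
  proof
    assume eq: "cis (pl t) = cis (pl t')"
    show "t = t' \<or> {t, t'} = {0, 4}"
    proof (cases "\<bar>pl t - pl t'\<bar> < 2 * pi")
      case True
      then have "pl t = pl t'" using cis_inj eq by blast
      then show ?thesis using pl_less[OF t] pl_less[OF t(2,1)] by (metis linorder_neqE_linordered_idom less_irrefl)
    next
      case False
      then have "pl t = a \<and> pl t' = a + 2 * pi \<or> pl t' = a \<and> pl t = a + 2 * pi"
        using pl_range[OF t(1)] pl_range[OF t(2)] by auto
      moreover have "s = 0" if "pl s = a" "s \<in> {0..4}" for s using pl_less[of 0 s] that pl04 by force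
      moreover have "s = 4" if "pl s = a + 2 * pi" "s \<in> {0..4}" for s using pl_less[of s 4] that pl04 by force
      ultimately show ?thesis using t by auto
    qed
  next
    assume "t = t' \<or> {t, t'} = {0, 4}"
    moreover have "cis (pl 0) = cis (pl 4)" unfolding pl04 cis_eq_cis_iff by (intro exI[of _ "-1"]) simp
    ultimately show "cis (pl t) = cis (pl t')" by (auto simp: doubleton_eq_iff)
  qed
  \<comment> \<open>Cone coordinates of square and disc, with the centre at \<open>snd z = 0\<close>.\<close>
  define F where "F z = (1/2 + snd z * (sqx (fst z) - 1/2), 1/2 + snd z * (sqy (fst z) - 1/2))" for z :: "real \<times> real"
  define G where "G z = complex_of_real (snd z) * cis (pl (fst z))" for z :: "real \<times> real"
  have Fc: "continuous_on ?K F" unfolding F_def sqx_def sqy_def by (intro continuous_intros)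
  have Gc: "continuous_on ?K G" unfolding G_def by (intro continuous_intros continuous_on_compose2[OF plc[of UNIV]]) auto
  have Fd: "supd (fst (F z) - 1/2, snd (F z) - 1/2) = snd z / 2" if "z \<in> ?K" for z
    using that supd_scale[of "snd z" "sqx (fst z) - 1/2" "sqy (fst z) - 1/2"] sq_boundary_norm[of "fst z"] by (auto simp: F_def)
  have Gd: "norm (G z) = snd z" if "z \<in> ?K" for z using that by (auto simp: G_def norm_mult)
  have FG: "F z = F z' \<longleftrightarrow> G z = G z'" if z: "z \<in> ?K" "z' \<in> ?K" for z z'
  proof (cases "snd z = snd z'")
    case False
    then show ?thesis using Fd[OF z(1)] Fd[OF z(2)] Gd[OF z(1)] Gd[OF z(2)] by auto
  next
    case True
    have t: "fst z \<in> {0..4}" "fst z' \<in> {0..4}" using z by auto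
    show ?thesis
      using True sq_boundary_inj[OF t] cis_pl[OF t] by (cases "snd z' = 0") (auto simp: F_def G_def)
  qed
  obtain H where H: "continuous_on (F ` ?K) H" "inj_on H (F ` ?K)" "H ` F ` ?K = G ` ?K"
    "\<And>z. z \<in> ?K \<Longrightarrow> H (F z) = G z"
    using quotient_map_exists[OF _ Fc Gc FG] by (metis compact_Icc compact_Times)
  have Fim: "F ` ?K = Sq"
  proof (intro set_eqI iffI)
    fix p assume "p \<in> F ` ?K"
    then obtain z where z: "z \<in> ?K" "p = F z" by auto
    then have "supd (fst p - 1/2, snd p - 1/2) \<le> 1/2" using Fd[OF z(1)] by auto
    then have "\<bar>fst p - 1/2\<bar> \<le> 1/2" "\<bar>snd p - 1/2\<bar> \<le> 1/2" unfolding supd_le by auto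
    then have "0 \<le> fst p \<and> fst p \<le> 1" "0 \<le> snd p \<and> snd p \<le> 1" unfolding abs_le_iff by auto
    then show "p \<in> Sq" by (cases p) auto
  next
    fix p assume p: "p \<in> Sq"
    obtain x y where xy: "p = (x, y)" by (cases p)
    let ?r = "2 * supd (x - 1/2, y - 1/2)"
    have "supd (x - 1/2, y - 1/2) \<le> 1/2" unfolding supd_le abs_le_iff using p xy by auto
    then have r: "0 \<le> ?r" "?r \<le> 1" by (auto simp: supd_def)
    show "p \<in> F ` ?K"
    proof (cases "?r = 0")
      case True
      then have "x = 1/2" "y = 1/2" by (auto simp: supd_def max_def split: if_splits)
      then have "p = F (0, 0)" using xy by (simp add: F_def)
      then show ?thesis by (rule image_eqI) auto
    next
      case False
      then have r0: "?r > 0" using r by simp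
      let ?x = "1/2 + (x - 1/2) / ?r" and ?y = "1/2 + (y - 1/2) / ?r"
      have "supd (?x - 1/2, ?y - 1/2) = (1 / ?r) * supd (x - 1/2, y - 1/2)"
        using supd_scale[of "1 / ?r" "x - 1/2" "y - 1/2"] r0 by simp
      also have "\<dots> = 1/2" using r0 by simp
      finally obtain t where t: "t \<in> {0..4}" "?x = sqx t" "?y = sqy t" using sq_boundary_surj by blast
      have "p = F (t, ?r)" unfolding F_def fst_conv snd_conv t(2,3)[symmetric] using r0 xy by simp
      then show ?thesis by (rule image_eqI) (use t r in auto)
    qed
  qed
  have Gim: "G ` ?K = cball 0 1"
  proof (intro set_eqI iffI)
    fix w assume "w \<in> G ` ?K"
    then show "w \<in> cball 0 1" using Gd by auto
  next
    fix w :: complex assume w: "w \<in> cball 0 1"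
    show "w \<in> G ` ?K"
    proof (cases "w = 0")
      case True
      then have "w = G (0, 0)" by (simp add: G_def)
      then show ?thesis by (rule image_eqI) auto
    next
      case False
      have "norm (w / of_real (norm w)) = 1" using False by (simp add: norm_divide)
      then obtain \<theta> where \<theta>: "a \<le> \<theta>" "\<theta> < a + 2 * pi" "w / of_real (norm w) = cis \<theta>" using cis_surj_interval by blast
      have "\<exists>t\<ge>0. t \<le> 4 \<and> pl t = \<theta>" using \<theta> pl04 plc by (intro IVT') auto
      then obtain t where t: "0 \<le> t" "t \<le> 4" "pl t = \<theta>" by auto
      have "w = G (t, norm w)" unfolding G_def fst_conv snd_conv t(3) \<theta>(3)[symmetric] using False by simp
      then show ?thesis by (rule image_eqI) (use t w in auto)
    qed
  qed
  have Hb: "H (sqx t, sqy t) = cis (pl t)" if "t \<in> {0..4}" for t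
    using H(4)[of "(t, 1)"] that by (simp add: F_def G_def)
  show ?thesis
  proof (rule that)
    show "strip H (cball 0 1)" using H Fim Gim by (auto simp: strip_def)
    show "H (0, y) = cis (a + (b - a) * y)" if "y \<in> {0..1}" for y
      using Hb[of y] that sq_sides(1)[of y] pl(1)[of y] by simp
    show "H (x, 1) = cis (b + (c - b) * x)" if "x \<in> {0..1}" for x
      using Hb[of "x + 1"] that sq_sides(2)[of "x + 1"] pl(2)[of "x + 1"] by simp
    show "H (1, y) = cis (d - (d - c) * y)" if "y \<in> {0..1}" for y
    proof -
      have "c + (d - c) * (1 - y) = d - (d - c) * y" by (simp add: algebra_simps)
      then show ?thesis using Hb[of "3 - y"] that sq_sides(3)[of "3 - y"] pl(3)[of "3 - y"] by simp
    qed
    show "H (x, 0) = cis (a + 2 * pi - (a + 2 * pi - d) * x)" if "x \<in> {0..1}" for x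
    proof -
      have "d + (a + 2 * pi - d) * (1 - x) = a + 2 * pi - (a + 2 * pi - d) * x" by (simp add: algebra_simps)
      then show ?thesis using Hb[of "4 - x"] that sq_sides(4)[of "4 - x"] pl(4)[of "4 - x"] by simp
    qed
  qed
qed

section \<open>A Moebius band cannot be immersed in the plane\<close>

text \<open>Two logarithms of the same number differ by a multiple of \<open>2 * pi * \<i>\<close>.\<close>

lemma exp_eq_constant:
  fixes D :: "'b::topological_space \<Rightarrow> complex"
  assumes S: "connected S" and D: "continuous_on S D" and c: "\<And>x. x \<in> S \<Longrightarrow> exp (D x) = c"
    and xy: "x \<in> S" "y \<in> S"
  shows "D x = D y"
proof -
  have "D constant_on S"
  proof (rule continuous_discrete_range_constant[OF S D])
    fix x assume x: "x \<in> S"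
    show "\<exists>e>0. \<forall>y. y \<in> S \<and> D y \<noteq> D x \<longrightarrow> e \<le> norm (D y - D x)"
    proof (intro exI conjI allI impI)
      show "(0::real) < 2 * pi" by simp
      fix y assume y: "y \<in> S \<and> D y \<noteq> D x"
      have "exp (D y) = exp (D x)" using c x y by simp
      then obtain n :: int where n: "D y = D x + (of_int (2 * n) * pi) * \<i>" unfolding exp_eq by blast
      then have "n \<noteq> 0" using y by auto
      then have "1 \<le> \<bar>real_of_int n\<bar>" by linarith
      moreover have "norm (D y - D x) = \<bar>real_of_int n\<bar> * (2 * pi)" using n by (simp add: norm_mult)
      ultimately show "2 * pi \<le> norm (D y - D x)" by simp
    qed
  qed
  then show ?thesis using xy by (auto simp: constant_on_def)
qed

text \<open>Let \<open>H (s, \<theta>)\<close> be the difference of the images of the two antipodal points in direction \<open>\<theta>\<close> on a small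
circle around the point \<open>s\<close> of the core. By local injectivity \<open>H\<close> has no zero, so it has a continuous
logarithm \<open>L\<close> on \<open>{0..1} \<times> UNIV\<close>. A half turn changes the sign of \<open>H\<close>, so it changes \<open>L\<close> by a
nonzero constant. Going once around the core reflects the circle, \<open>H (1, \<theta>) = H (0, - \<theta>)\<close>, so it
turns this constant into its negative.\<close>

lemma moebius_not_immersible:
  fixes M :: "'a::t2_space set" and \<Phi> :: "'a \<Rightarrow> complex"
  assumes M: "moebius_band M" and cont: "continuous_on M \<Phi>"
    and loc: "\<And>x. x \<in> M \<Longrightarrow> \<exists>U. openin (top_of_set M) U \<and> x \<in> U \<and> inj_on \<Phi> U"
  shows False
proof -
  let ?Sq = "{0..1} \<times> {0..1} :: (real \<times> real) set"
  obtain q :: "real \<times> real \<Rightarrow> 'a" where q0: "continuous_on ?Sq q \<and> q ` ?Sq = M \<and>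
      (\<forall>p\<in>?Sq. \<forall>p'\<in>?Sq. q p = q p' \<longleftrightarrow> p = p' \<or> (\<exists>t. {p, p'} = {(0, t), (1, 1 - t)}))"
    using M unfolding moebius_band_def by (elim exE)
  have q: "continuous_on ?Sq q" "q ` ?Sq = M" by (rule q0[THEN conjunct1], rule q0[THEN conjunct2, THEN conjunct1])
  have qeq: "q p = q p' \<longleftrightarrow> p = p' \<or> (\<exists>t. {p, p'} = {(0, t), (1, 1 - t)})" if "p \<in> ?Sq" "p' \<in> ?Sq" for p p'
    using q0[THEN conjunct2, THEN conjunct2, rule_format, OF that] .
  have seam: "q (1, 1 - t) = q (0, t)" if "t \<in> {0..1}" for t
    using qeq[of "(1, 1 - t)" "(0, t)"] that by auto
  let ?K = "{-1..2} \<times> {0..1} :: (real \<times> real) set"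
  \<comment> \<open>The band is continued across the seam in both directions, to have room for the small circles.\<close>
  define \<kappa> where "\<kappa> z = (if fst z < 0 then q (fst z + 1, 1 - snd z)
    else if fst z \<le> 1 then q (fst z, snd z) else q (fst z - 1, 1 - snd z))" for z :: "real \<times> real"
  have \<kappa>c: "continuous_on ?K \<kappa>"
  proof -
    have 1: "continuous_on ({-1..0} \<times> {0..1}) \<kappa>"
    proof (rule continuous_on_eq)
      show "continuous_on ({-1..0} \<times> {0..1}) (\<lambda>z. q (fst z + 1, 1 - snd z))"
        by (rule continuous_on_compose2[OF q(1)]) (auto intro!: continuous_intros)
      show "q (fst z + 1, 1 - snd z) = \<kappa> z" if "z \<in> {-1..0} \<times> {0..1}" for z
        using that seam[of "snd z"] by (cases z) (auto simp: \<kappa>_def)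
    qed
    have 2: "continuous_on ({0..1} \<times> {0..1}) \<kappa>"
      by (rule continuous_on_eq[OF q(1)]) (auto simp: \<kappa>_def)
    have 3: "continuous_on ({1..2} \<times> {0..1}) \<kappa>"
    proof (rule continuous_on_eq)
      show "continuous_on ({1..2} \<times> {0..1}) (\<lambda>z. q (fst z - 1, 1 - snd z))"
        by (rule continuous_on_compose2[OF q(1)]) (auto intro!: continuous_intros)
      show "q (fst z - 1, 1 - snd z) = \<kappa> z" if "z \<in> {1..2} \<times> {0..1}" for z
        using that seam[of "1 - snd z"] by (cases z) (auto simp: \<kappa>_def)
    qed
    have "continuous_on ({-1..0} \<times> {0..1} \<union> ({0..1} \<times> {0..1} \<union> {1..2} \<times> {0..1})) \<kappa>"
      by (intro continuous_on_closed_Un 1 2 3 closed_Un closed_Times closed_atLeastAtMost)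
    then show ?thesis by (rule continuous_on_subset) auto
  qed
  have \<kappa>M: "\<kappa> z \<in> M" if "z \<in> ?K" for z using that q(2) by (cases z) (auto simp: \<kappa>_def)
  have deck: "\<kappa> (s + 1, t) = \<kappa> (s, 1 - t)" if "s \<in> {-1..1}" "t \<in> {0..1}" for s t
    using that seam[of t] seam[of "1 - t"] by (cases "s = 0"; cases "s = 1"; cases "s = -1") (auto simp: \<kappa>_def)
  have \<kappa>inj: "z = z'" if z: "z \<in> ?K" "z' \<in> ?K" "\<bar>fst z - fst z'\<bar> < 1" "\<kappa> z = \<kappa> z'" for z z'
  proof -
    have norm: "\<exists>n::int. \<exists>p\<in>?Sq. \<kappa> y = q p \<and> n \<in> {-1, 0, 1} \<and> fst y = fst p + of_int n \<and> snd y = (if n = 0 then snd p else 1 - snd p)"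
      if "y \<in> ?K" for y
    proof -
      consider "fst y < 0" | "0 \<le> fst y" "fst y \<le> 1" | "fst y > 1" by linarith
      then show ?thesis
      proof cases
        case 1
        then show ?thesis using that
          by (intro exI[of _ "-1"] bexI[of _ "(fst y + 1, 1 - snd y)"]) (auto simp: \<kappa>_def)
      next
        case 2
        then show ?thesis using that by (intro exI[of _ 0] bexI[of _ y]) (auto simp: \<kappa>_def)
      next
        case 3
        then show ?thesis using that
          by (intro exI[of _ 1] bexI[of _ "(fst y - 1, 1 - snd y)"]) (auto simp: \<kappa>_def)
      qed
    qed
    obtain n p where p: "p \<in> ?Sq" "\<kappa> z = q p" "n \<in> {-1, 0, 1::int}" "fst z = fst p + of_int n"
      "snd z = (if n = 0 then snd p else 1 - snd p)" using norm[OF z(1)] by blast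
    obtain n' p' where p': "p' \<in> ?Sq" "\<kappa> z' = q p'" "n' \<in> {-1, 0, 1::int}" "fst z' = fst p' + of_int n'"
      "snd z' = (if n' = 0 then snd p' else 1 - snd p')" using norm[OF z(2)] by blast
    consider "p = p'" | t where "p = (0, t)" "p' = (1, 1 - t)" | t where "p = (1, 1 - t)" "p' = (0, t)"
      using qeq[OF p(1) p'(1)] z(4) p(2) p'(2) by (auto simp: doubleton_eq_iff)
    then show ?thesis
    proof cases
      case 1
      then have "n = n'" using z(3) p(3,4) p'(3,4) by auto
      then show ?thesis using p p' 1 by (auto simp: prod_eq_iff)
    next
      case 2
      then have "n = n' + 1" using z(3) p(3,4) p'(3,4) by auto
      then show ?thesis using p p' 2 by (auto simp: prod_eq_iff)
    next
      case 3
      then have "n' = n + 1" using z(3) p(3,4) p'(3,4) by auto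
      then show ?thesis using p p' 3 by (auto simp: prod_eq_iff)
    qed
  qed
  have K: "compact ?K" by (intro compact_Times compact_Icc)
  have "\<exists>G. open G \<and> z \<in> G \<and> inj_on (\<Phi> \<circ> \<kappa>) (G \<inter> ?K)" if z: "z \<in> ?K" for z
  proof -
    obtain U where U: "openin (top_of_set M) U" "\<kappa> z \<in> U" "inj_on \<Phi> U" using loc[OF \<kappa>M[OF z]] by blast
    have "\<kappa> ` ?K \<subseteq> M" using \<kappa>M by blast
    then have "openin (top_of_set ?K) (?K \<inter> \<kappa> -` U)" by (intro continuous_openin_preimage[OF \<kappa>c _ U(1)]) auto
    then obtain T where T: "open T" "?K \<inter> \<kappa> -` U = ?K \<inter> T" by (auto simp: openin_open)
    have "inj_on (\<Phi> \<circ> \<kappa>) (T \<inter> ball z (1/2) \<inter> ?K)"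
    proof (rule inj_onI)
      fix w w' assume w: "w \<in> T \<inter> ball z (1/2) \<inter> ?K" and w': "w' \<in> T \<inter> ball z (1/2) \<inter> ?K"
        and eq: "(\<Phi> \<circ> \<kappa>) w = (\<Phi> \<circ> \<kappa>) w'"
      have "\<kappa> w \<in> U" "\<kappa> w' \<in> U" using T(2) w w' by blast+
      then have "\<kappa> w = \<kappa> w'" using eq U(3) by (auto dest: inj_onD)
      moreover have "dist w w' < 1" using dist_triangle_half_r[of z w 1 w'] w w' by auto
      then have "\<bar>fst w - fst w'\<bar> < 1" using dist_fst_le[of w w'] by (simp add: dist_real_def)
      ultimately show "w = w'" using \<kappa>inj w w' by blast
    qed
    moreover have "z \<in> ?K \<inter> T" using T(2)[symmetric] z U(2) by blast
    ultimately show ?thesis using T(1) by (intro exI[of _ "T \<inter> ball z (1/2)"]) auto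
  qed
  then obtain G where G: "\<And>z. z \<in> ?K \<Longrightarrow> open (G z) \<and> z \<in> G z \<and> inj_on (\<Phi> \<circ> \<kappa>) (G z \<inter> ?K)" by metis
  have cover: "?K \<subseteq> \<Union> (G ` ?K)" "\<And>U. U \<in> G ` ?K \<Longrightarrow> open U" using G by blast+
  obtain e where e: "e > 0" "\<And>z. z \<in> ?K \<Longrightarrow> \<exists>U\<in>G ` ?K. ball z e \<subseteq> U"
    by (rule Heine_Borel_lemma[OF K cover]) (assumption, metis)
  have near: "\<Phi> (\<kappa> z) \<noteq> \<Phi> (\<kappa> z')" if zz: "z \<in> ?K" "z' \<in> ?K" "dist z z' < e" "z \<noteq> z'" for z z'
  proof -
    obtain w where w: "w \<in> ?K" "ball z e \<subseteq> G w" using e(2)[OF zz(1)] by blast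
    then have "z \<in> G w" "z' \<in> G w" using e(1) zz(3) by auto
    then show ?thesis using inj_onD[OF G[OF w(1), THEN conjunct2, THEN conjunct2], of z z'] zz by auto
  qed
  define \<delta> where "\<delta> = min (e / 4) (1 / 4)"
  have \<delta>: "0 < \<delta>" "\<delta> \<le> 1/4" "2 * \<delta> < e" using e(1) by (auto simp: \<delta>_def min_def)
  define pl where "pl z = (fst z + \<delta> * cos (snd z), 1/2 + \<delta> * sin (snd z))" for z :: "real \<times> real"
  define mi where "mi z = (fst z - \<delta> * cos (snd z), 1/2 - \<delta> * sin (snd z))" for z :: "real \<times> real"
  define H where "H z = \<Phi> (\<kappa> (pl z)) - \<Phi> (\<kappa> (mi z))" for z :: "real \<times> real"
  let ?S = "{0..1} \<times> UNIV :: (real \<times> real) set"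
  have small: "\<bar>\<delta> * cos u\<bar> \<le> 1/4" "\<bar>\<delta> * sin u\<bar> \<le> 1/4" for u
  proof -
    have "\<delta> * \<bar>cos u\<bar> \<le> (1/4) * 1" "\<delta> * \<bar>sin u\<bar> \<le> (1/4) * 1" using \<delta> by (intro mult_mono; auto)+
    then show "\<bar>\<delta> * cos u\<bar> \<le> 1/4" "\<bar>\<delta> * sin u\<bar> \<le> 1/4" using \<delta>(1) by (simp_all add: abs_mult)
  qed
  have inK: "pl z \<in> ?K" "mi z \<in> ?K" if "z \<in> ?S" for z
    using small[of "snd z"] that unfolding abs_le_iff by (auto simp: pl_def mi_def)
  have Hnz: "H z \<noteq> 0" if z: "z \<in> ?S" for z
  proof -
    have "dist (pl z) (mi z) = 2 * \<delta>"
    proof -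
      have "(pl z) - (mi z) = (2 * \<delta>) *\<^sub>R (cos (snd z), sin (snd z))" by (simp add: pl_def mi_def)
      then have "dist (pl z) (mi z) = \<bar>2 * \<delta>\<bar> * norm (cos (snd z), sin (snd z))" unfolding dist_norm by (metis norm_scaleR)
      also have "norm (cos (snd z), sin (snd z)) = 1" by (simp add: norm_Pair)
      finally show ?thesis using \<delta>(1) by simp
    qed
    then have "dist (pl z) (mi z) < e" "pl z \<noteq> mi z" using \<delta> by auto
    then show ?thesis using near[OF inK[OF z]] by (simp add: H_def)
  qed
  have plc: "continuous_on ?S pl" "continuous_on ?S mi" unfolding pl_def mi_def by (intro continuous_intros)+
  have Hc: "continuous_on ?S H"
    unfolding H_def
    by (intro continuous_on_diff continuous_on_compose2[OF cont] continuous_on_compose2[OF \<kappa>c] plc) (use inK \<kappa>M in blast)+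
  have "convex ?S" by (intro convex_Times) auto
  then have "contractible ?S" by (rule convex_imp_contractible)
  then obtain L where L: "continuous_on ?S L" "\<And>z. z \<in> ?S \<Longrightarrow> H z = exp (L z)"
    using continuous_logarithm_on_contractible[OF Hc _ Hnz] by blast
  have half: "H (s, \<theta> + pi) = - H (s, \<theta>)" for s \<theta>
    by (simp add: H_def pl_def mi_def)
  have flip: "H (1, \<theta>) = H (0, - \<theta>)" for \<theta>
  proof -
    have "\<kappa> (pl (1, \<theta>)) = \<kappa> (pl (0, - \<theta>))"
      using deck[of "\<delta> * cos \<theta>" "1/2 + \<delta> * sin \<theta>"] small[of \<theta>] unfolding abs_le_iff by (simp add: pl_def add.commute)
    moreover have "\<kappa> (mi (1, \<theta>)) = \<kappa> (mi (0, - \<theta>))"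
      using deck[of "- \<delta> * cos \<theta>" "1/2 - \<delta> * sin \<theta>"] small[of \<theta>] unfolding abs_le_iff by (simp add: mi_def)
    ultimately show ?thesis by (simp add: H_def)
  qed
  let ?D = "\<lambda>z. L (fst z, snd z + pi) - L z"
  have D: "?D z = ?D z'" if "z \<in> ?S" "z' \<in> ?S" for z z'
  proof (rule exp_eq_constant[of ?S ?D])
    show "connected ?S" using \<open>convex ?S\<close> by (rule convex_connected)
    show "continuous_on ?S ?D"
      by (intro continuous_on_diff L continuous_on_compose2[OF L(1)] continuous_intros) auto
    show "exp (?D z) = -1" if z: "z \<in> ?S" for z
    proof -
      have "exp (L (fst z, snd z + pi)) = - exp (L z)"
        using L(2)[of z] L(2)[of "(fst z, snd z + pi)"] half[of "fst z" "snd z"] z by auto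
      then show ?thesis by (simp add: exp_diff)
    qed
  qed (use that in auto)
  let ?N = "\<lambda>\<theta>. L (1, \<theta>) - L (0, - \<theta>)"
  have N: "?N pi = ?N 0"
  proof (rule exp_eq_constant[of "UNIV :: real set" ?N])
    show "continuous_on UNIV ?N"
      by (intro continuous_on_diff continuous_on_compose2[OF L(1)] continuous_intros) auto
    show "exp (?N \<theta>) = 1" for \<theta>
      using L(2)[of "(1, \<theta>)"] L(2)[of "(0, - \<theta>)"] flip[of \<theta>] by (simp add: exp_diff)
  qed auto
  have "?D (1, 0) = - ?D (0, - pi)" using N by (simp add: algebra_simps)
  moreover have "?D (1, 0) = ?D (0, - pi)" by (rule D) auto
  ultimately have "?D (1, 0) = 0" by simp
  then have "L (1, pi) = L (1, 0)" by simp
  then have "H (1, pi) = H (1, 0)" using L(2)[of "(1, pi)"] L(2)[of "(1, 0)"] by simp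
  then have "H (1, 0) = 0" using half[of 1 0] by simp
  then show False using Hnz[of "(1, 0)"] by simp
qed

section \<open>Gluing strips\<close>

abbreviation I01 :: "real set" where "I01 \<equiv> {0..1}"

definition sideL :: "(real \<times> real \<Rightarrow> 'a) \<Rightarrow> 'a set" where "sideL H = (\<lambda>y. H (0, y)) ` I01"
definition sideR :: "(real \<times> real \<Rightarrow> 'a) \<Rightarrow> 'a set" where "sideR H = (\<lambda>y. H (1, y)) ` I01"

lemma stripD:
  assumes "strip H M"
  shows "continuous_on Sq H" "H ` Sq = M" "x \<in> I01 \<Longrightarrow> y \<in> I01 \<Longrightarrow> H (x, y) \<in> M"
    "H (x, y) = H (x', y') \<Longrightarrow> x \<in> I01 \<Longrightarrow> y \<in> I01 \<Longrightarrow> x' \<in> I01 \<Longrightarrow> y' \<in> I01 \<Longrightarrow> x = x' \<and> y = y'"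
proof -
  show "continuous_on Sq H" "H ` Sq = M" using assms by (auto simp: strip_def)
  then show "x \<in> I01 \<Longrightarrow> y \<in> I01 \<Longrightarrow> H (x, y) \<in> M" by auto
  assume "H (x, y) = H (x', y')" "x \<in> I01" "y \<in> I01" "x' \<in> I01" "y' \<in> I01"
  then have "(x, y) = (x', y')" using assms unfolding strip_def by (intro inj_onD[of H Sq]) auto
  then show "x = x' \<and> y = y'" by simp
qed

lemma strip_col:
  assumes "strip H M" "x \<in> I01"
  shows "continuous_on I01 (\<lambda>y. H (x, y))" "inj_on (\<lambda>y. H (x, y)) I01"
proof -
  show "continuous_on I01 (\<lambda>y. H (x, y))"
    by (rule continuous_on_compose2[OF stripD(1)[OF assms(1)]]) (use assms(2) in \<open>auto intro!: continuous_intros\<close>)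
  show "inj_on (\<lambda>y. H (x, y)) I01" using stripD(4)[OF assms(1)] assms(2) by (auto simp: inj_on_def)
qed

lemma arc_reparam:
  fixes f g :: "real \<Rightarrow> 'a::t2_space"
  assumes f: "continuous_on I01 f" "inj_on f I01" and g: "continuous_on I01 g" "inj_on g I01"
    and im: "f ` I01 = g ` I01" and e: "f 0 = g 0" "f 1 = g 1"
  obtains \<phi> where "continuous_on I01 \<phi>" "\<phi> 0 = 0" "\<phi> 1 = 1" "strict_mono_on I01 \<phi>"
    "\<And>y. y \<in> I01 \<Longrightarrow> \<phi> y \<in> I01 \<and> g (\<phi> y) = f y"
proof -
  obtain k where k: "homeomorphism I01 (g ` I01) g k" using homeomorphism_compact[OF compact_Icc g(1) refl g(2)] by blast
  let ?\<phi> = "k \<circ> f"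
  have gk: "k z \<in> I01 \<and> g (k z) = z" if "z \<in> g ` I01" for z using k that by (auto simp: homeomorphism_def)
  have kg: "k (g y) = y" if "y \<in> I01" for y using k that by (auto simp: homeomorphism_def)
  have c: "continuous_on I01 ?\<phi>"
    using k by (intro continuous_on_compose f(1)) (simp add: im homeomorphism_def)
  have v: "?\<phi> y \<in> I01 \<and> g (?\<phi> y) = f y" if "y \<in> I01" for y using gk[of "f y"] im imageI[OF that, of f] by simp
  have 0: "?\<phi> 0 = 0" "?\<phi> 1 = 1" using kg[of 0] kg[of 1] e by auto
  have inj: "y = z" if "?\<phi> y = ?\<phi> z" "y \<in> I01" "z \<in> I01" for y z
  proof -
    have "f y = f z" using v[OF that(2)] v[OF that(3)] that(1) by metis
    then show ?thesis using f(2) that by (auto dest: inj_onD)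
  qed
  have "strict_mono_on I01 ?\<phi>"
  proof (rule strict_mono_onI)
    fix y z :: real assume yz: "y \<in> I01" "z \<in> I01" "y < z"
    show "?\<phi> y < ?\<phi> z"
    proof (rule ccontr)
      assume n: "\<not> ?\<phi> y < ?\<phi> z"
      have "\<exists>w\<ge>0. w \<le> y \<and> ?\<phi> w = ?\<phi> z"
        using n v[OF yz(2)] 0 yz by (intro IVT' continuous_on_subset[OF c]) auto
      then obtain w where "0 \<le> w" "w \<le> y" "?\<phi> w = ?\<phi> z" by blast
      then show False using inj[of w z] yz by auto
    qed
  qed
  then show ?thesis using c 0 v by (intro that[of ?\<phi>])
qed

lemma strip_compose:
  assumes H: "strip H M" and f: "continuous_on Sq f" "inj_on f Sq" "f ` Sq \<subseteq> Sq"
  shows "strip (\<lambda>z. H (f z)) (H ` f ` Sq)"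
proof -
  have "inj_on H Sq" using H by (simp add: strip_def)
  then have "inj_on (H \<circ> f) Sq" by (intro comp_inj_on[OF f(2)] inj_on_subset[OF _ f(3)])
  moreover have "continuous_on Sq (\<lambda>z. H (f z))" by (rule continuous_on_compose2[OF stripD(1)[OF H] f(1,3)])
  ultimately show ?thesis by (simp add: strip_def o_def image_image)
qed

lemma strip_flip:
  assumes H: "strip H M" shows "strip (\<lambda>z. H (fst z, 1 - snd z)) M"
proof -
  let ?T = "\<lambda>z::real \<times> real. (fst z, 1 - snd z)"
  have im: "?T ` Sq = Sq"
  proof (intro set_eqI iffI)
    fix p assume "p \<in> Sq"
    then show "p \<in> ?T ` Sq" by (intro image_eqI[of _ _ "?T p"]) auto
  qed auto
  have "strip (\<lambda>z. H (?T z)) (H ` ?T ` Sq)"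
    by (rule strip_compose[OF H]) (auto simp: inj_on_def intro!: continuous_intros)
  then show ?thesis unfolding im stripD(2)[OF H] .
qed

text \<open>The new parametrisations of the two sides differ from the old ones by increasing functions, and so does
every convex combination of these; in between, the strip is reparametrised by the convex combinations.\<close>

lemma strip_reparam:
  fixes H :: "real \<times> real \<Rightarrow> 'a::t2_space"
  assumes H: "strip H M"
    and f0: "continuous_on I01 f0" "inj_on f0 I01" "f0 ` I01 = sideL H" "f0 0 = H (0, 0)" "f0 1 = H (0, 1)"
    and f1: "continuous_on I01 f1" "inj_on f1 I01" "f1 ` I01 = sideR H" "f1 0 = H (1, 0)" "f1 1 = H (1, 1)"
  obtains H' where "strip H' M" "\<And>y. y \<in> I01 \<Longrightarrow> H' (0, y) = f0 y \<and> H' (1, y) = f1 y"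
proof -
  have 01: "(0::real) \<in> I01" "(1::real) \<in> I01" by auto
  obtain \<phi>0 where p0: "continuous_on I01 \<phi>0" "\<phi>0 0 = 0" "\<phi>0 1 = 1" "strict_mono_on I01 \<phi>0"
    "\<And>y. y \<in> I01 \<Longrightarrow> \<phi>0 y \<in> I01 \<and> H (0, \<phi>0 y) = f0 y"
    using arc_reparam[OF f0(1,2) strip_col[OF H 01(1)] f0(3)[unfolded sideL_def] f0(4,5)] by blast
  obtain \<phi>1 where p1: "continuous_on I01 \<phi>1" "\<phi>1 0 = 0" "\<phi>1 1 = 1" "strict_mono_on I01 \<phi>1"
    "\<And>y. y \<in> I01 \<Longrightarrow> \<phi>1 y \<in> I01 \<and> H (1, \<phi>1 y) = f1 y"
    using arc_reparam[OF f1(1,2) strip_col[OF H 01(2)] f1(3)[unfolded sideR_def] f1(4,5)] by blast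
  define \<psi> where "\<psi> x y = (1 - x) * \<phi>0 y + x * \<phi>1 y" for x y
  define T where "T z = (fst z, \<psi> (fst z) (snd z))" for z :: "real \<times> real"
  have \<psi>01: "\<psi> x 0 = 0" "\<psi> x 1 = 1" for x using p0 p1 by (auto simp: \<psi>_def)
  have mono: "\<psi> x y < \<psi> x z" if x: "x \<in> I01" and yz: "y \<in> I01" "z \<in> I01" "y < z" for x y z
  proof -
    have lt: "\<phi>0 y < \<phi>0 z" "\<phi>1 y < \<phi>1 z" using strict_mono_onD[OF p0(4) yz] strict_mono_onD[OF p1(4) yz] by auto
    show ?thesis
    proof (cases "x = 0")
      case False
      have "(1 - x) * \<phi>0 y \<le> (1 - x) * \<phi>0 z" using lt x by (intro mult_left_mono) auto
      moreover have "x * \<phi>1 y < x * \<phi>1 z" using lt x False by (intro mult_strict_left_mono) auto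
      ultimately show ?thesis by (simp add: \<psi>_def)
    qed (use lt in \<open>simp add: \<psi>_def\<close>)
  qed
  have range: "\<psi> x y \<in> I01" if "x \<in> I01" "y \<in> I01" for x y
    using mono[OF that(1), of 0 y] mono[OF that(1), of y 1] that \<psi>01[of x] by (cases "y = 0"; cases "y = 1") auto
  have Tc: "continuous_on Sq T"
    unfolding T_def \<psi>_def
    by (intro continuous_intros continuous_on_compose2[OF p0(1)] continuous_on_compose2[OF p1(1)]) auto
  have Tim: "T ` Sq = Sq"
  proof (intro set_eqI iffI)
    fix p assume "p \<in> T ` Sq" then show "p \<in> Sq" using range by (auto simp: T_def)
  next
    fix p assume p: "p \<in> Sq"
    obtain x w where xw: "p = (x, w)" by (cases p)
    have c: "continuous_on {0..1} (\<psi> x)" unfolding \<psi>_def by (intro continuous_intros p0(1) p1(1))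
    have "\<exists>y\<ge>0. y \<le> 1 \<and> \<psi> x y = w" using p xw \<psi>01[of x] by (intro IVT' c) auto
    then obtain y where "0 \<le> y" "y \<le> 1" "\<psi> x y = w" by blast
    then show "p \<in> T ` Sq" using p xw by (intro image_eqI[of _ _ "(x, y)"]) (auto simp: T_def)
  qed
  have Tinj: "inj_on T Sq"
  proof (rule inj_onI)
    fix p p' assume p: "p \<in> Sq" "p' \<in> Sq" "T p = T p'"
    then have x: "fst p = fst p'" "\<psi> (fst p) (snd p) = \<psi> (fst p) (snd p')" by (auto simp: T_def)
    have "snd p = snd p'"
      using mono[of "fst p" "snd p" "snd p'"] mono[of "fst p" "snd p'" "snd p"] p x by (cases "snd p" "snd p'" rule: linorder_cases) auto
    then show "p = p'" using x by (simp add: prod_eq_iff)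
  qed
  have "strip (\<lambda>z. H (T z)) (H ` T ` Sq)" by (rule strip_compose[OF H Tc Tinj]) (simp add: Tim)
  then have "strip (\<lambda>z. H (T z)) M" unfolding Tim stripD(2)[OF H] .
  moreover have "H (T (0, y)) = f0 y \<and> H (T (1, y)) = f1 y" if "y \<in> I01" for y
    using p0(5)[OF that] p1(5)[OF that] by (simp add: T_def \<psi>_def)
  ultimately show ?thesis by (intro that[of "\<lambda>z. H (T z)"])
qed

definition glue :: "(real \<times> real \<Rightarrow> 'a) \<Rightarrow> (real \<times> real \<Rightarrow> 'a) \<Rightarrow> real \<times> real \<Rightarrow> 'a" where
  "glue H1 H2 z = (if fst z \<le> 1/2 then H1 (2 * fst z, snd z) else H2 (2 * fst z - 1, snd z))"

lemma glue_continuous: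
  assumes H1: "strip H1 M" and H2: "strip H2 N" and eq: "\<And>y. y \<in> I01 \<Longrightarrow> H1 (1, y) = H2 (0, y)"
  shows "continuous_on Sq (glue H1 H2)" "glue H1 H2 ` Sq = M \<union> N"
proof -
  have 1: "continuous_on ({0..1/2} \<times> I01) (glue H1 H2)"
  proof (rule continuous_on_eq)
    show "continuous_on ({0..1/2} \<times> I01) (\<lambda>z. H1 (2 * fst z, snd z))"
      by (rule continuous_on_compose2[OF stripD(1)[OF H1]]) (auto intro!: continuous_intros)
  qed (auto simp: glue_def)
  have 2: "continuous_on ({1/2..1} \<times> I01) (glue H1 H2)"
  proof (rule continuous_on_eq)
    show "continuous_on ({1/2..1} \<times> I01) (\<lambda>z. H2 (2 * fst z - 1, snd z))"
      by (rule continuous_on_compose2[OF stripD(1)[OF H2]]) (auto intro!: continuous_intros)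
    show "H2 (2 * fst z - 1, snd z) = glue H1 H2 z" if "z \<in> {1/2..1} \<times> I01" for z
    proof (cases "fst z = 1/2")
      case True
      then have "z = (1/2, snd z)" "snd z \<in> I01" using that by (cases z, simp)+
      then obtain y where "z = (1/2, y)" "y \<in> I01" by blast
      then show ?thesis by (simp add: glue_def eq)
    qed (use that in \<open>auto simp: glue_def\<close>)
  qed
  have "continuous_on ({0..1/2} \<times> I01 \<union> {1/2..1} \<times> I01) (glue H1 H2)"
    by (intro continuous_on_closed_Un 1 2 closed_Times closed_atLeastAtMost)
  then show "continuous_on Sq (glue H1 H2)" by (rule continuous_on_subset) auto
  show "glue H1 H2 ` Sq = M \<union> N"
  proof (intro set_eqI iffI)
    fix p assume "p \<in> glue H1 H2 ` Sq"
    then obtain x y where xy: "x \<in> I01" "y \<in> I01" "p = glue H1 H2 (x, y)" by auto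
    then show "p \<in> M \<union> N"
      using stripD(3)[OF H1, of "2 * x" y] stripD(3)[OF H2, of "2 * x - 1" y] by (auto simp: glue_def)
  next
    fix p assume "p \<in> M \<union> N"
    then consider x y where "x \<in> I01" "y \<in> I01" "p = H1 (x, y)" | x y where "x \<in> I01" "y \<in> I01" "p = H2 (x, y)"
      using stripD(2)[OF H1] stripD(2)[OF H2] by auto
    then show "p \<in> glue H1 H2 ` Sq"
    proof cases
      case 1
      then show ?thesis by (intro image_eqI[of _ _ "(x/2, y)"]) (auto simp: glue_def)
    next
      case 2
      have "2 * ((x + 1) / 2) - 1 = x" "(x + 1) / 2 \<le> 1/2 \<longleftrightarrow> x \<le> 0" by (simp_all add: field_simps)
      then have "p = glue H1 H2 ((x + 1)/2, y)"
        using 2 eq[of y] unfolding glue_def fst_conv snd_conv by (cases "x = 0") auto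
      then show ?thesis using 2 by (intro image_eqI[of _ _ "((x + 1)/2, y)"]) auto
    qed
  qed
qed

text \<open>The relation \<open>R\<close> describes an identification of the free left side of the first strip with the free right
side of the second one; it is empty when two strips are glued to a strip.\<close>

lemma glue_eq:
  assumes H1: "strip H1 M" and H2: "strip H2 N"
    and meet: "\<And>x y x' y'. x \<in> I01 \<Longrightarrow> y \<in> I01 \<Longrightarrow> x' \<in> {0<..1} \<Longrightarrow> y' \<in> I01 \<Longrightarrow>
      H1 (x, y) = H2 (x', y') \<longleftrightarrow> R y y' \<and> x = 0 \<and> x' = 1"
    and p: "x \<in> I01" "y \<in> I01" "x' \<in> I01" "y' \<in> I01"
  shows "glue H1 H2 (x, y) = glue H1 H2 (x', y') \<longleftrightarrow>
    (x, y) = (x', y') \<or> R y y' \<and> x = 0 \<and> x' = 1 \<or> R y' y \<and> x' = 0 \<and> x = 1"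
proof -
  have "H1 (2 * x, y) = H1 (2 * x', y') \<longleftrightarrow> x = x' \<and> y = y'" if "x \<le> 1/2" "x' \<le> 1/2"
    using stripD(4)[OF H1, of "2 * x" y "2 * x'" y'] that p by auto
  moreover have "H2 (2 * x - 1, y) = H2 (2 * x' - 1, y') \<longleftrightarrow> x = x' \<and> y = y'" if "x > 1/2" "x' > 1/2"
    using stripD(4)[OF H2, of "2 * x - 1" y "2 * x' - 1" y'] that p by auto
  moreover have "H1 (2 * x, y) = H2 (2 * x' - 1, y') \<longleftrightarrow> R y y' \<and> x = 0 \<and> x' = 1" if "x \<le> 1/2" "x' > 1/2"
    using meet[of "2 * x" y "2 * x' - 1" y'] that p by auto
  moreover have "H1 (2 * x', y') = H2 (2 * x - 1, y) \<longleftrightarrow> R y' y \<and> x' = 0 \<and> x = 1" if "x' \<le> 1/2" "x > 1/2"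
    using meet[of "2 * x'" y' "2 * x - 1" y] that p by auto
  ultimately show ?thesis
    by (cases "x \<le> 1/2"; cases "x' \<le> 1/2") (auto simp: glue_def eq_commute[of "H2 _" "H1 _"])
qed

lemma strip_join:
  fixes H1 H2 :: "real \<times> real \<Rightarrow> 'a::t2_space"
  assumes H1: "strip H1 M" and H2: "strip H2 N" and MN: "M \<inter> N = sideR H1" "sideR H1 = sideL H2"
    and c: "H1 (1, 0) = H2 (0, 0)" "H1 (1, 1) = H2 (0, 1)"
  obtains H where "strip H (M \<union> N)" "\<And>y. y \<in> I01 \<Longrightarrow> H (0, y) = H1 (0, y) \<and> H (1/2, y) = H1 (1, y) \<and> H (1, y) = H2 (1, y)"
proof -
  have 01: "(0::real) \<in> I01" "(1::real) \<in> I01" by auto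
  obtain H2' where H2': "strip H2' N" "\<And>y. y \<in> I01 \<Longrightarrow> H2' (0, y) = H1 (1, y) \<and> H2' (1, y) = H2 (1, y)"
  proof (rule strip_reparam[OF H2])
    show "continuous_on I01 (\<lambda>y. H1 (1, y))" "inj_on (\<lambda>y. H1 (1, y)) I01" by (rule strip_col[OF H1 01(2)])+
    show "(\<lambda>y. H1 (1, y)) ` I01 = sideL H2" using MN(2) by (simp add: sideR_def)
    show "continuous_on I01 (\<lambda>y. H2 (1, y))" "inj_on (\<lambda>y. H2 (1, y)) I01" by (rule strip_col[OF H2 01(2)])+
    show "(\<lambda>y. H2 (1, y)) ` I01 = sideR H2" by (simp add: sideR_def)
  qed (use c in auto)
  have eq: "H1 (1, y) = H2' (0, y)" if "y \<in> I01" for y using H2'(2)[OF that] by simp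
  have meet: "H1 (x, y) \<noteq> H2' (x', y')" if "x \<in> I01" "y \<in> I01" "x' \<in> {0<..1}" "y' \<in> I01" for x y x' y'
  proof
    assume e: "H1 (x, y) = H2' (x', y')"
    have "H1 (x, y) \<in> M" "H2' (x', y') \<in> N" using stripD(3)[OF H1, of x y] stripD(3)[OF H2'(1), of x' y'] that by auto
    then have "H2' (x', y') \<in> sideR H1" using MN(1) e by auto
    then obtain w where w: "w \<in> I01" "H2' (x', y') = H2' (0, w)" using eq by (auto simp: sideR_def)
    then have "x' = 0" using stripD(4)[OF H2'(1) w(2)] that by auto
    then show False using that by simp
  qed
  note gl = glue_continuous[OF H1 H2'(1) eq]
  have "inj_on (glue H1 H2') Sq"
  proof (rule inj_onI)
    fix p p' assume p: "p \<in> Sq" "p' \<in> Sq" "glue H1 H2' p = glue H1 H2' p'"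
    obtain x y x' y' where xy: "p = (x, y)" "p' = (x', y')" by (cases p, cases p')
    show "p = p'"
      using glue_eq[OF H1 H2'(1), of "\<lambda>_ _. False" x y x' y'] meet p xy by auto
  qed
  then have "strip (glue H1 H2') (M \<union> N)" using gl by (simp add: strip_def)
  moreover have "glue H1 H2' (0, y) = H1 (0, y) \<and> glue H1 H2' (1/2, y) = H1 (1, y) \<and> glue H1 H2' (1, y) = H2 (1, y)"
    if "y \<in> I01" for y using H2'(2)[OF that] by (simp add: glue_def)
  ultimately show ?thesis by (intro that[of "glue H1 H2'"])
qed

text \<open>The second strip is reparametrised so that it agrees with the first one on the common side and is
reflected on the other.\<close>

lemma strips_moebius:
  fixes H1 H2 :: "real \<times> real \<Rightarrow> 'a::t2_space"
  assumes H1: "strip H1 M" and H2: "strip H2 N" and MN: "M \<inter> N = sideL H1 \<union> sideR H1"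
    and sides: "sideR H1 = sideL H2" "sideL H1 = sideR H2"
    and c: "H1 (1, 0) = H2 (0, 0)" "H1 (1, 1) = H2 (0, 1)" "H2 (1, 0) = H1 (0, 1)" "H2 (1, 1) = H1 (0, 0)"
  shows "moebius_band (M \<union> N)"
proof -
  have 01: "(0::real) \<in> I01" "(1::real) \<in> I01" by auto
  obtain H2' where H2': "strip H2' N" "\<And>y. y \<in> I01 \<Longrightarrow> H2' (0, y) = H1 (1, y) \<and> H2' (1, y) = H1 (0, 1 - y)"
  proof (rule strip_reparam[OF H2])
    show "continuous_on I01 (\<lambda>y. H1 (1, y))" "inj_on (\<lambda>y. H1 (1, y)) I01" by (rule strip_col[OF H1 01(2)])+
    show "(\<lambda>y. H1 (1, y)) ` I01 = sideL H2" using sides by (simp add: sideR_def)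
    show "continuous_on I01 (\<lambda>y. H1 (0, 1 - y))" "inj_on (\<lambda>y. H1 (0, 1 - y)) I01"
      using strip_col[OF strip_flip[OF H1] 01(1)] by simp_all
    have "(\<lambda>y. H1 (0, 1 - y)) ` I01 = (\<lambda>y. H1 (0, y)) ` (\<lambda>y. 1 - y) ` I01" unfolding image_image ..
    also have "(\<lambda>y::real. 1 - y) ` I01 = I01" by simp
    finally show "(\<lambda>y. H1 (0, 1 - y)) ` I01 = sideR H2" using sides by (simp add: sideL_def)
  qed (use c in auto)
  have eq: "H1 (1, y) = H2' (0, y)" if "y \<in> I01" for y using H2'(2)[OF that] by simp
  have meet: "H1 (x, y) = H2' (x', y') \<longleftrightarrow> y' = 1 - y \<and> x = 0 \<and> x' = 1"
    if xy: "x \<in> I01" "y \<in> I01" "x' \<in> {0<..1}" "y' \<in> I01" for x y x' y'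
  proof
    assume e: "H1 (x, y) = H2' (x', y')"
    have "H1 (x, y) \<in> M" "H2' (x', y') \<in> N" using stripD(3)[OF H1, of x y] stripD(3)[OF H2'(1), of x' y'] that by auto
    then have "H1 (x, y) \<in> sideL H1 \<union> sideR H1" using MN e by auto
    then consider w where "w \<in> I01" "H1 (x, y) = H1 (0, w)" | w where "w \<in> I01" "H1 (x, y) = H1 (1, w)"
      by (auto simp: sideL_def sideR_def)
    then show "y' = 1 - y \<and> x = 0 \<and> x' = 1"
    proof cases
      case 1
      then have x: "x = 0" "y = w" using stripD(4)[OF H1 1(2)] xy by auto
      have "H2' (1, 1 - y) = H1 (0, y)" using H2'(2)[of "1 - y"] xy by auto
      then have "H2' (x', y') = H2' (1, 1 - y)" using e x by simp
      then show ?thesis using stripD(4)[OF H2'(1), of x' y' 1 "1 - y"] xy x by auto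
    next
      case 2
      then have "x = 1" "y = w" using stripD(4)[OF H1 2(2)] xy by auto
      then have "H2' (x', y') = H2' (0, y)" using e eq xy by simp
      then have "x' = 0" using stripD(4)[OF H2'(1), of x' y' 0 y] xy by auto
      then show ?thesis using xy by simp
    qed
  next
    assume "y' = 1 - y \<and> x = 0 \<and> x' = 1"
    then show "H1 (x, y) = H2' (x', y')" using H2'(2)[of y'] xy by auto
  qed
  note gl = glue_continuous[OF H1 H2'(1) eq]
  have "glue H1 H2' p = glue H1 H2' p' \<longleftrightarrow> p = p' \<or> (\<exists>t. {p, p'} = {(0, t), (1, 1 - t)})"
    if p: "p \<in> Sq" "p' \<in> Sq" for p p'
  proof -
    obtain x y x' y' where xy: "p = (x, y)" "p' = (x', y')" by (cases p, cases p')
    have "glue H1 H2' p = glue H1 H2' p' \<longleftrightarrow>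
      (x, y) = (x', y') \<or> y' = 1 - y \<and> x = 0 \<and> x' = 1 \<or> y = 1 - y' \<and> x' = 0 \<and> x = 1"
      unfolding xy by (rule glue_eq[OF H1 H2'(1) meet]) (use p xy in auto)
    then show ?thesis unfolding xy by (auto simp: doubleton_eq_iff)
  qed
  then show ?thesis using gl unfolding moebius_band_def by (intro exI[of _ "glue H1 H2'"]) auto
qed

section \<open>Counting the components of a finite union\<close>

text \<open>A finite closed cover by connected pieces, any two of which share a marked point if they meet at all. Its
components are then the classes of marked points.\<close>

locale marked_cover =
  fixes \<Q> :: "'a::topological_space set set" and X :: "'a set" and R :: "('a \<times> 'a) set"
  assumes finite_cover: "finite \<Q>"
    and piece: "Q \<in> \<Q> \<Longrightarrow> closed Q \<and> connected Q \<and> (\<exists>x\<in>X. x \<in> Q)"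
    and meet: "Q \<in> \<Q> \<Longrightarrow> Q' \<in> \<Q> \<Longrightarrow> Q \<inter> Q' \<noteq> {} \<Longrightarrow> \<exists>x\<in>X. x \<in> Q \<and> x \<in> Q'"
    and same: "Q \<in> \<Q> \<Longrightarrow> x \<in> Q \<Longrightarrow> y \<in> Q \<Longrightarrow> x \<in> X \<Longrightarrow> y \<in> X \<Longrightarrow> (x, y) \<in> conn R"
    and edge: "(x, y) \<in> R \<Longrightarrow> \<exists>Q\<in>\<Q>. x \<in> Q \<and> y \<in> Q"
    and marks: "X \<subseteq> \<Union>\<Q>"
begin

text \<open>The pieces that contain a mark equivalent to \<open>x\<close> and the other pieces have disjoint closed unions, which
a connected set cannot both meet.\<close>

lemma connected_marks:
  assumes C: "connected C" "C \<subseteq> \<Union>\<Q>" and xy: "x \<in> C" "y \<in> C" "x \<in> X" "y \<in> X"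
  shows "(x, y) \<in> conn R"
proof -
  define P where "P Q \<longleftrightarrow> (\<exists>z\<in>X. z \<in> Q \<and> (x, z) \<in> conn R)" for Q
  let ?F = "\<Union>{Q \<in> \<Q>. P Q}" and ?G = "\<Union>{Q \<in> \<Q>. \<not> P Q}"
  have cl: "closed ?F" "closed ?G" using finite_cover piece by (auto intro!: closed_Union)
  have disj: "?F \<inter> ?G = {}"
  proof (rule ccontr)
    assume "?F \<inter> ?G \<noteq> {}"
    then obtain Q Q' where Q: "Q \<in> \<Q>" "P Q" and Q': "Q' \<in> \<Q>" "\<not> P Q'" and QQ: "Q \<inter> Q' \<noteq> {}"
      by auto
    obtain z where z: "z \<in> X" "z \<in> Q" "(x, z) \<in> conn R" using Q(2) by (auto simp: P_def)
    obtain w where w: "w \<in> X" "w \<in> Q" "w \<in> Q'" using meet[OF Q(1) Q'(1) QQ] by blast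
    have "(x, w) \<in> conn R" using conn_trans[OF z(3) same[OF Q(1) z(2) w(2) z(1) w(1)]] .
    then show False using Q' w by (auto simp: P_def)
  qed
  have cover: "p \<in> ?F \<or> p \<in> ?G" if pC: "p \<in> C" for p
  proof -
    obtain Q where "Q \<in> \<Q>" "p \<in> Q" using C(2) pC by blast
    then show ?thesis by (cases "P Q") auto
  qed
  then have "C \<subseteq> ?F \<union> ?G" by auto
  moreover have "x \<in> ?F"
  proof -
    obtain Q where Q: "Q \<in> \<Q>" "x \<in> Q" using C(2) xy by blast
    then have "P Q" unfolding P_def using xy conn_refl[of x R] by blast
    then show ?thesis using Q by auto
  qed
  then have "?F \<inter> C \<noteq> {}" using xy by auto
  moreover have "?F \<inter> ?G \<inter> C = {}" using disj by auto
  ultimately have "?G \<inter> C = {}"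
    using C(1) cl unfolding connected_closed by metis
  then have "y \<in> ?F" using cover[OF xy(2)] xy(2) by auto
  then obtain Q z where Q: "Q \<in> \<Q>" "y \<in> Q" "z \<in> X" "z \<in> Q" "(x, z) \<in> conn R" by (auto simp: P_def)
  then show ?thesis using conn_trans[OF Q(5) same[OF Q(1,4,2,3) xy(4)]] by simp
qed

lemma conn_connected_component:
  assumes "(x, y) \<in> conn R" "x \<in> X"
  shows "connected_component (\<Union>\<Q>) x y"
  using assms(1)
proof (induction rule: conn_induct)
  case refl
  then show ?case using assms(2) marks by auto
next
  case (step y z)
  have "\<exists>Q\<in>\<Q>. y \<in> Q \<and> z \<in> Q" using step.hyps(2) edge[of y z] edge[of z y] by auto
  then obtain Q where Q: "Q \<in> \<Q>" "y \<in> Q" "z \<in> Q" by auto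
  then have "connected_component (\<Union>\<Q>) y z"
    using piece[OF Q(1)] unfolding connected_component_def by (intro exI[of _ Q]) auto
  then show ?case by (rule connected_component_trans[OF step.IH])
qed

lemma card_components: "card (components (\<Union>\<Q>)) = ncomp X R"
proof -
  let ?c = "\<lambda>x. connected_component_set (\<Union>\<Q>) x" and ?d = "\<lambda>x. conn R `` {x}"
  have eq: "?c x = ?c y \<longleftrightarrow> (x, y) \<in> conn R" if "x \<in> X" "y \<in> X" for x y
  proof
    assume c: "?c x = ?c y"
    have "y \<in> ?c y" using that marks by auto
    then have "y \<in> ?c x" unfolding c .
    then have "connected_component (\<Union>\<Q>) x y" by simp
    then obtain C where "connected C" "C \<subseteq> \<Union>\<Q>" "x \<in> C" "y \<in> C"
      unfolding connected_component_def by auto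
    then show "(x, y) \<in> conn R" by (rule connected_marks) (use that in auto)
  next
    assume "(x, y) \<in> conn R"
    then have "connected_component (\<Union>\<Q>) x y" using that by (intro conn_connected_component)
    then show "?c x = ?c y" by (simp add: connected_component_eq)
  qed
  have "components (\<Union>\<Q>) = ?c ` X"
  proof (intro set_eqI iffI)
    fix C assume "C \<in> components (\<Union>\<Q>)"
    then obtain p where p: "p \<in> \<Union>\<Q>" "C = ?c p" by (auto simp: components_def)
    then obtain Q where Q: "Q \<in> \<Q>" "p \<in> Q" by blast
    obtain x where x: "x \<in> X" "x \<in> Q" using piece[OF Q(1)] by blast
    have "connected_component (\<Union>\<Q>) x p"
      using Q x piece[OF Q(1)] unfolding connected_component_def by (intro exI[of _ Q]) auto
    then have "?c x = C" unfolding p(2) by (simp add: connected_component_eq)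
    then show "C \<in> ?c ` X" using x by blast
  next
    fix C assume "C \<in> ?c ` X"
    then show "C \<in> components (\<Union>\<Q>)" using marks by (auto simp: components_def)
  qed
  moreover have "card (?c ` X) = card (?d ` X)"
  proof (rule bij_betw_same_card)
    let ?h = "\<lambda>C. ?d (SOME x. x \<in> X \<and> ?c x = C)"
    have h: "?h (?c x) = ?d x" if "x \<in> X" for x
    proof -
      have "(SOME z. z \<in> X \<and> ?c z = ?c x) \<in> X \<and> ?c (SOME z. z \<in> X \<and> ?c z = ?c x) = ?c x"
        by (rule someI_ex) (use that in auto)
      then show ?thesis using eq[OF _ that] unfolding conn_class_eq by blast
    qed
    show "bij_betw ?h (?c ` X) (?d ` X)"
      unfolding bij_betw_def
    proof
      show "inj_on ?h (?c ` X)"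
      proof (rule inj_onI)
        fix C D assume "C \<in> ?c ` X" "D \<in> ?c ` X" and CD: "?h C = ?h D"
        then obtain x y where xy: "x \<in> X" "C = ?c x" "y \<in> X" "D = ?c y" by auto
        then have "?d x = ?d y" using CD h[OF xy(1)] h[OF xy(3)] by simp
        then show "C = D" using xy eq[of x y] unfolding conn_class_eq by simp
      qed
      show "?h ` ?c ` X = ?d ` X" unfolding image_image using h by (rule image_cong[OF refl])
    qed
  qed
  ultimately show ?thesis by (simp add: ncomp_def)
qed

end

section \<open>The gaps between disjoint intervals\<close>

text \<open>The intervals are the segments on the boundary of a vertex, cut open at the start of the first one, so
that \<open>M\<close> and \<open>lo i0\<close> are angles of the same point.\<close>

locale disjoint_intervals =
  fixes I :: "'s set" and lo hi :: "'s \<Rightarrow> real" and i0 :: 's and M :: real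
  assumes fin: "finite I" and i0: "i0 \<in> I"
    and lohi: "i \<in> I \<Longrightarrow> lo i < hi i \<and> lo i0 \<le> lo i \<and> hi i < M"
    and disj: "i \<in> I \<Longrightarrow> j \<in> I \<Longrightarrow> i \<noteq> j \<Longrightarrow> hi i < lo j \<or> hi j < lo i"
begin

definition nx :: "'s \<Rightarrow> real" where "nx i = Min (insert M (lo ` {j \<in> I. hi i < lo j}))"

lemma nx_le: "nx i \<le> M" "j \<in> I \<Longrightarrow> hi i < lo j \<Longrightarrow> nx i \<le> lo j"
  using fin by (auto simp: nx_def intro: Min_le)

lemma nx_cases: "nx i = M \<or> (\<exists>j\<in>I. hi i < lo j \<and> nx i = lo j)"
proof -
  have "nx i \<in> insert M (lo ` {j \<in> I. hi i < lo j})" unfolding nx_def using fin by (intro Min_in) auto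
  then show ?thesis by auto
qed

lemma nx_greater: "i \<in> I \<Longrightarrow> hi i < nx i"
  using nx_cases[of i] lohi by auto

lemma gap_seg:
  assumes i: "i \<in> I" and j: "j \<in> I" and t: "hi i \<le> t" "t \<le> nx i" "lo j \<le> t" "t \<le> hi j"
  shows "j = i \<and> t = hi i \<or> lo j = t \<and> t = nx i"
proof (cases "j = i")
  case False
  then consider "hi i < lo j" | "hi j < lo i" using disj[OF i j] by auto
  then show ?thesis
  proof cases
    case 1
    then show ?thesis using nx_le(2)[OF j] t by fastforce
  next
    case 2
    then show ?thesis using lohi[OF i] t by linarith
  qed
qed (use t in auto)

lemma gap_gap:
  assumes i: "i \<in> I" and j: "j \<in> I" and t: "hi i \<le> t" "t \<le> nx i" "hi j \<le> t" "t \<le> nx j"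
  shows "i = j"
proof -
  have *: False if "i \<in> I" "j \<in> I" "i \<noteq> j" "hi i \<le> hi j" "hi j \<le> t" "t \<le> nx i" for i j
  proof -
    have "hi i < lo j" using disj[OF that(1-3)] lohi[OF that(1)] that(4) by auto
    then have "nx i \<le> lo j" using nx_le that(2) by blast
    then show False using lohi[OF that(2)] that by linarith
  qed
  show ?thesis using *[of i j] *[of j i] assms by (cases "hi i \<le> hi j") auto
qed

lemma seg_or_gap:
  assumes t: "lo i0 \<le> t" "t \<le> M"
  shows "\<exists>i\<in>I. lo i \<le> t \<and> t \<le> hi i \<or> hi i \<le> t \<and> t \<le> nx i"
proof (rule ccontr)
  assume n: "\<not> ?thesis"
  let ?J = "{i \<in> I. hi i \<le> t}"
  have "i0 \<in> ?J" using n i0 t by auto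
  then have J: "finite ?J" "?J \<noteq> {}" using fin by auto
  have "Max (hi ` ?J) \<in> hi ` ?J" using J by (intro Max_in) auto
  then obtain j where jJ: "j \<in> ?J" "hi j = Max (hi ` ?J)" by auto
  have j: "j \<in> ?J" "i \<in> ?J \<Longrightarrow> hi i \<le> hi j" for i
    using jJ J by (auto intro!: Max_ge)
  have "nx j < t" using n j by auto
  then obtain k where k: "k \<in> I" "hi j < lo k" "nx j = lo k" using nx_cases[of j] t by auto
  then have "lo k \<le> t" using \<open>nx j < t\<close> by simp
  then have "hi k \<le> t" using n k by auto
  then have "hi k \<le> hi j" using j k by auto
  then show False using lohi[OF k(1)] k by auto
qed

text \<open>The gap that ends at \<open>M\<close> is followed by the first interval.\<close>

definition succ :: "'s \<Rightarrow> 's" where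
  "succ i = (if nx i = M then i0 else (SOME j. j \<in> I \<and> lo j = nx i))"

lemma succ: "i \<in> I \<Longrightarrow> succ i \<in> I \<and> (nx i = M \<and> succ i = i0 \<or> nx i = lo (succ i) \<and> nx i \<noteq> M)"
proof -
  assume "i \<in> I"
  show ?thesis
  proof (cases "nx i = M")
    case False
    then have "\<exists>j. j \<in> I \<and> lo j = nx i" using nx_cases[of i] by auto
    from someI_ex[OF this] have "succ i \<in> I \<and> lo (succ i) = nx i" unfolding succ_def using False by simp
    then show ?thesis using False by auto
  qed (use i0 in \<open>simp add: succ_def\<close>)
qed

lemma succ_bij: "bij_betw succ I I"
proof -
  have "inj_on succ I"
  proof (rule inj_onI)
    fix i j assume ij: "i \<in> I" "j \<in> I" "succ i = succ j"
    have "nx i = nx j"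
      using succ[OF ij(1)] succ[OF ij(2)] ij(3) nx_greater[OF ij(1)] nx_greater[OF ij(2)] lohi[OF ij(1)] lohi[OF ij(2)]
      by auto
    then show "i = j"
      using gap_gap[OF ij(1,2), of "nx i"] nx_greater[OF ij(1)] nx_greater[OF ij(2)] by auto
  qed
  moreover have "succ ` I \<subseteq> I" using succ by auto
  ultimately show ?thesis using endo_inj_surj[OF fin, of succ] by (simp add: bij_betw_def)
qed

end

section \<open>Charts of a ribbon graph\<close>

lemma disc_param:
  assumes "is_disc D"
  obtains g where "continuous_on (cball (0::complex) 1) g" "inj_on g (cball 0 1)" "g ` cball 0 1 = D"
proof -
  obtain f g where "homeomorphism D (cball (0::complex) 1) f g" using assms by (auto simp: is_disc_def homeomorphic_def)
  then show ?thesis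
    by (intro that[of g]) (auto simp: homeomorphism_def intro: inj_on_inverseI[of _ f])
qed

lemma image_filter_eq:
  "(\<And>q. q \<in> Q \<Longrightarrow> H q \<in> B \<longleftrightarrow> P q) \<Longrightarrow> B \<subseteq> H ` Q \<Longrightarrow> B = H ` {q \<in> Q. P q}"
  by auto

lemma disc_boundary:
  assumes "continuous_on (cball (0::complex) 1) g" "inj_on g (cball 0 1)" "g ` cball 0 1 = (D :: 'a::t2_space set)"
  shows "surface_boundary D = g ` sphere 0 1"
proof -
  have "g q \<in> surface_boundary D \<longleftrightarrow> q \<in> sphere 0 1" if "q \<in> cball 0 1" for q
    using boundary_of_patch[OF _ assms(1,2), of "{}" q] that assms(3) by auto
  moreover have "surface_boundary D \<subseteq> D" by (auto simp: surface_boundary_def)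
  ultimately show ?thesis using assms(3) by fastforce
qed

lemma strip_boundary:
  assumes "strip H (D :: 'a::t2_space set)"
  shows "surface_boundary D = sideL H \<union> sideR H \<union> (\<lambda>x. H (x, 0)) ` I01 \<union> (\<lambda>x. H (x, 1)) ` I01"
proof -
  have int: "interior Sq = {0<..<1} \<times> {0<..<1}" by (simp add: interior_Times interior_atLeastAtMost_real)
  have "H q \<in> surface_boundary D \<longleftrightarrow> q \<notin> {0<..<1} \<times> {0<..<1}" if "q \<in> Sq" for q
    using boundary_of_patch[OF _ stripD(1)[OF assms], of "{}" q] that assms
    unfolding int by (simp add: strip_def compact_Times)
  moreover have "surface_boundary D \<subseteq> H ` Sq" using stripD(2)[OF assms] by (auto simp: surface_boundary_def)
  ultimately have "surface_boundary D = H ` {q \<in> Sq. q \<notin> {0<..<1} \<times> {0<..<1}}" by (rule image_filter_eq)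
  also have "{q \<in> Sq. q \<notin> {0<..<1} \<times> {0<..<1}} = {0} \<times> I01 \<union> {1} \<times> I01 \<union> I01 \<times> {0} \<union> I01 \<times> {1}" by auto
  finally show ?thesis by (auto simp: sideL_def sideR_def image_Un image_def)
qed

lemma chart_segment:
  fixes g :: "complex \<Rightarrow> 'a::t2_space"
  assumes g: "continuous_on (cball 0 1) g" "inj_on g (cball 0 1)"
    and s: "s \<subseteq> g ` sphere 0 1" "is_segment s"
  obtains a b where "a < b" "b < a + 2 * pi" "s = g ` cis ` {a..b}"
proof -
  have sub: "sphere 0 1 \<subseteq> cball (0::complex) 1" by auto
  obtain k where k: "homeomorphism (cball 0 1) (g ` cball 0 1) g k"
    using homeomorphism_compact[OF compact_cball g(1) refl g(2)] by (elim exE)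
  let ?s = "k ` s"
  have ks: "k x \<in> sphere 0 1 \<and> g (k x) = x" if "x \<in> s" for x
  proof -
    obtain z where z: "z \<in> sphere 0 1" "x = g z" using s(1) \<open>x \<in> s\<close> by blast
    then have "k x = z" using k sub by (auto simp: homeomorphism_def)
    then show ?thesis using z by simp
  qed
  have gs: "g ` ?s = s" using ks by (force simp: image_image)
  have "homeomorphism ?s s g k"
    by (rule homeomorphism_of_subsets[OF k]) (use ks gs sub in \<open>auto simp: subset_iff\<close>)
  then have "?s homeomorphic s" by (auto simp: homeomorphic_def)
  then have seg: "is_segment ?s" using s(2) homeomorphic_trans[of ?s s] unfolding is_segment_def by simp
  have sph: "?s \<subseteq> sphere 0 1" using ks by auto
  obtain a b where ab: "a < b" "b < a + 2 * pi" "?s = cis ` {a..b}" by (rule circle_segment[OF sph seg])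
  then have "s = g ` cis ` {a..b}" using gs by simp
  then show ?thesis by (rule that[OF ab(1,2)])
qed

lemma cis_shift: "cis (x + 2 * pi * of_int n) = cis x"
  unfolding cis_eq_cis_iff by (intro exI[of _ n]) (simp add: algebra_simps)

text \<open>The second interval is shifted by a multiple of \<open>2 * pi\<close>.\<close>

lemma arcs_order:
  assumes ab: "a < b" "b < a + 2 * pi" and cd: "c' < d'" "d' < c' + 2 * pi"
    and disj: "cis ` {a..b} \<inter> cis ` {c'..d'} = {}"
  obtains c d where "b < c" "c < d" "d < a + 2 * pi" "cis ` {c'..d'} = cis ` {c..d}"
proof -
  obtain c where c: "a \<le> c" "c < a + 2 * pi" "cis c' = cis c" using cis_surj_interval[of "cis c'" a] by auto
  then obtain n :: int where n: "c' = c + 2 * of_int n * pi" by (auto simp: cis_eq_cis_iff)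
  define d where "d = d' - 2 * pi * of_int n"
  have im: "cis ` {c'..d'} = cis ` {c..d}"
  proof -
    have "{c'..d'} = (\<lambda>x. x + 2 * pi * of_int n) ` {c..d}"
      unfolding image_add_atLeastAtMost' using n by (simp add: d_def mult.commute mult.left_commute)
    then have "cis ` {c'..d'} = (\<lambda>x. cis (x + 2 * pi * of_int n)) ` {c..d}" by (simp only: image_image)
    then show ?thesis unfolding cis_shift .
  qed
  have "c < d" using cd n by (simp add: d_def algebra_simps)
  have "cis c \<in> cis ` {c'..d'}" using im \<open>c < d\<close> by auto
  then have "cis c \<notin> cis ` {a..b}" using disj by blast
  then have "b < c" using c by (meson atLeastAtMost_iff imageI not_le)
  moreover have "d < a + 2 * pi"
  proof (rule ccontr)
    assume "\<not> d < a + 2 * pi"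
    then have "cis (a + 2 * pi) \<in> cis ` {c'..d'}" using im c by auto
    moreover have "cis (a + 2 * pi) = cis a" using cis_shift[of a 1] by simp
    ultimately have "cis a \<in> cis ` {c'..d'}" by simp
    moreover have "cis a \<in> cis ` {a..b}" using ab by (intro imageI) simp
    ultimately show False using disj by blast
  qed
  ultimately show ?thesis using \<open>c < d\<close> im by (intro that[of c d])
qed

lemma disc_strip:
  fixes g :: "complex \<Rightarrow> 'a::t2_space"
  assumes g: "continuous_on (cball 0 1) g" "inj_on g (cball 0 1)" "g ` cball 0 1 = D"
    and abcd: "a < b" "b < c" "c < d" "d < a + 2 * pi"
  obtains H where "strip H D" "sideL H = g ` cis ` {a..b}" "sideR H = g ` cis ` {c..d}"
    "H (0, 0) = g (cis a)" "H (0, 1) = g (cis b)" "H (1, 1) = g (cis c)" "H (1, 0) = g (cis d)"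
proof -
  obtain H where H: "strip H (cball (0::complex) 1)"
    "\<And>y. y \<in> {0..1} \<Longrightarrow> H (0, y) = cis (a + (b - a) * y)"
    "\<And>y. y \<in> {0..1} \<Longrightarrow> H (1, y) = cis (d - (d - c) * y)"
    by (rule square_to_disc[OF abcd]) blast
  have "strip (g \<circ> H) D"
    unfolding strip_def
  proof (intro conjI)
    show "continuous_on Sq (g \<circ> H)" using H(1) g by (intro continuous_on_compose) (auto simp: strip_def)
    show "inj_on (g \<circ> H) Sq" using H(1) g by (intro comp_inj_on) (auto simp: strip_def)
    show "(g \<circ> H) ` Sq = D" using H(1) g(3) unfolding strip_def by (metis image_comp)
  qed
  moreover have "sideL (g \<circ> H) = g ` cis ` {a..b}"
  proof -
    have "sideL (g \<circ> H) = g ` cis ` (\<lambda>y. a + (b - a) * y) ` I01"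
      unfolding sideL_def image_image by (rule image_cong) (use H(2) in auto)
    also have "(\<lambda>y. a + (b - a) * y) ` I01 = {a..b}"
      using image_affinity_atLeastAtMost[of "b - a" a 0 1] abcd by (simp add: add.commute)
    finally show ?thesis .
  qed
  moreover have "sideR (g \<circ> H) = g ` cis ` {c..d}"
  proof -
    have "sideR (g \<circ> H) = g ` cis ` (\<lambda>y. (c - d) * y + d) ` I01"
      unfolding sideR_def image_image by (rule image_cong) (use H(3) in \<open>auto simp: algebra_simps\<close>)
    also have "(\<lambda>y. (c - d) * y + d) ` I01 = {c..d}"
      using image_affinity_atLeastAtMost[of "c - d" d 0 1] abcd by simp
    finally show ?thesis .
  qed
  ultimately show ?thesis using H(2)[of 0] H(2)[of 1] H(3)[of 0] H(3)[of 1] by (intro that[of "g \<circ> H"]) auto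
qed

lemma ends_side:
  assumes "strip H M"
  shows "ends (sideL H) = {H (0, 0), H (0, 1)}" "ends (sideR H) = {H (1, 0), H (1, 1)}"
  unfolding sideL_def sideR_def
  by (rule ends_param strip_col[OF assms] zero_less_one | simp)+

lemma ends_chart_arc:
  assumes g: "continuous_on (cball 0 1) g" "inj_on g (cball (0::complex) 1)" and ab: "a < b" "b < a + 2 * pi"
  shows "ends (g ` cis ` {a..b}) = {g (cis a), g (cis b)}"
  unfolding image_image
proof (rule ends_param)
  show "continuous_on {a..b} (\<lambda>x. g (cis x))" by (rule continuous_on_compose2[OF g(1)]) (auto intro!: continuous_intros)
  show "inj_on (\<lambda>x. g (cis x)) {a..b}"
  proof (rule comp_inj_on[OF inj_on_cis[OF ab(2)], unfolded o_def])
    show "inj_on g (cis ` {a..b})" by (rule inj_on_subset[OF g(2)]) auto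
  qed
qed (rule ab)

context ribbon_graph
begin

abbreviation Seg :: "'a set set" where "Seg \<equiv> rg_segments V E"

definition vtx :: "'a set \<Rightarrow> 'a set" where "vtx s = (THE v. v \<in> V \<and> s \<subseteq> surface_boundary v)"
definition edg :: "'a set \<Rightarrow> 'a set" where "edg s = (THE e. e \<in> E \<and> s \<subseteq> surface_boundary e)"

lemma surface_boundary_subset: "surface_boundary S \<subseteq> S" by (auto simp: surface_boundary_def)

lemma vtx: "s \<in> Seg \<Longrightarrow> vtx s \<in> V \<and> s \<subseteq> surface_boundary (vtx s)"
  unfolding vtx_def using theI'[OF segment_vertex] by blast

lemma edg: "s \<in> Seg \<Longrightarrow> edg s \<in> E \<and> s \<subseteq> surface_boundary (edg s)"
  unfolding edg_def using theI'[OF segment_edge] by blast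

lemma seg_sub: "s \<in> Seg \<Longrightarrow> s \<subseteq> vtx s" "s \<in> Seg \<Longrightarrow> s \<subseteq> edg s"
  using vtx edg surface_boundary_subset by blast+

lemma seg_nonempty: "s \<in> Seg \<Longrightarrow> s \<noteq> {}"
  unfolding rg_segments_def by (rule in_components_nonempty)

lemma seg_disjoint: "s \<in> Seg \<Longrightarrow> s' \<in> Seg \<Longrightarrow> x \<in> s \<Longrightarrow> x \<in> s' \<Longrightarrow> s = s'"
  unfolding rg_segments_def using components_eq by blast

lemma V_unique: "v \<in> V \<Longrightarrow> v' \<in> V \<Longrightarrow> x \<in> v \<Longrightarrow> x \<in> v' \<Longrightarrow> v = v'"
  using disjoint_V unfolding pairwise_def disjnt_def by blast

lemma E_unique: "e \<in> E \<Longrightarrow> e' \<in> E \<Longrightarrow> x \<in> e \<Longrightarrow> x \<in> e' \<Longrightarrow> e = e'"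
  using disjoint_E unfolding pairwise_def disjnt_def by blast

lemma seg_vtx_eq: "s \<in> Seg \<Longrightarrow> x \<in> s \<Longrightarrow> v \<in> V \<Longrightarrow> x \<in> v \<Longrightarrow> vtx s = v"
  using V_unique[of "vtx s" v x] vtx seg_sub(1) by blast

lemma seg_edg_eq: "s \<in> Seg \<Longrightarrow> x \<in> s \<Longrightarrow> e \<in> E \<Longrightarrow> x \<in> e \<Longrightarrow> edg s = e"
  using E_unique[of "edg s" e x] edg seg_sub(2) by blast

lemma edg_iff: "s \<in> Seg \<Longrightarrow> e \<in> E \<Longrightarrow> s \<subseteq> e \<longleftrightarrow> edg s = e"
proof -
  assume s: "s \<in> Seg" and e: "e \<in> E"
  obtain x where x: "x \<in> s" using seg_nonempty[OF s] by blast
  show "s \<subseteq> e \<longleftrightarrow> edg s = e" using seg_sub(2)[OF s] seg_edg_eq[OF s x e] x by blast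
qed

lemma in_seg: "v \<in> V \<Longrightarrow> e \<in> E \<Longrightarrow> x \<in> v \<Longrightarrow> x \<in> e \<Longrightarrow> \<exists>s\<in>Seg. x \<in> s \<and> vtx s = v \<and> edg s = e"
proof -
  assume ve: "v \<in> V" "e \<in> E" "x \<in> v" "x \<in> e"
  then have "x \<in> \<Union>Seg" unfolding rg_segments_def Union_components by blast
  then obtain s where "s \<in> Seg" "x \<in> s" by blast
  then show ?thesis using seg_vtx_eq[of s x v] seg_edg_eq[of s x e] ve by blast
qed

lemma finite_Seg: "finite Seg"
proof -
  have "finite {s \<in> Seg. s \<subseteq> e}" if "e \<in> E" for e
    using two_segments[OF that] by (metis card.infinite zero_neq_numeral)
  then have "finite (\<Union>e\<in>E. {s \<in> Seg. s \<subseteq> e})" using finite_E by blast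
  moreover have "Seg \<subseteq> (\<Union>e\<in>E. {s \<in> Seg. s \<subseteq> e})"
  proof
    fix s assume "s \<in> Seg"
    then show "s \<in> (\<Union>e\<in>E. {s \<in> Seg. s \<subseteq> e})" using edg[of s] seg_sub(2)[of s] by auto
  qed
  ultimately show ?thesis by (rule rev_finite_subset)
qed

lemma disc_closed_connected: "is_disc D \<Longrightarrow> closed D \<and> connected D \<and> compact D"
proof -
  assume "is_disc D"
  then obtain g where g: "continuous_on (cball (0::complex) 1) g" "inj_on g (cball 0 1)" "g ` cball 0 1 = D"
    by (rule disc_param)
  have "compact D" using compact_continuous_image[OF g(1) compact_cball] g(3) by simp
  moreover have "connected D" using connected_continuous_image[OF g(1)] g(3) by (metis connected_cball)
  ultimately show ?thesis using compact_imp_closed by blast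
qed

definition is_chart :: "(complex \<Rightarrow> 'a) \<Rightarrow> 'a set \<Rightarrow> bool" where
  "is_chart g D \<longleftrightarrow> continuous_on (cball 0 1) g \<and> inj_on g (cball 0 1) \<and> g ` cball 0 1 = D"

end

text \<open>Parametrisations of all discs: \<open>g v\<close> by the unit disc, \<open>sq e\<close> by the unit square with the two segments of
\<open>e\<close> as left and right side, and the segment \<open>s\<close> as an interval of angles from \<open>lo s\<close> to \<open>hi s\<close>. The
angles at one vertex are taken in one period, which starts at the segment \<open>base v\<close>.\<close>

locale ribbon_charts = ribbon_graph V E for V E :: "'a::t2_space set set" +
  fixes g :: "'a set \<Rightarrow> complex \<Rightarrow> 'a" and sq :: "'a set \<Rightarrow> real \<times> real \<Rightarrow> 'a"
    and lo hi :: "'a set \<Rightarrow> real" and base :: "'a set \<Rightarrow> 'a set"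
  assumes chart: "v \<in> V \<Longrightarrow> is_chart (g v) v"
    and edge_strip: "e \<in> E \<Longrightarrow> strip (sq e) e \<and> sideL (sq e) \<noteq> sideR (sq e) \<and>
      {s \<in> rg_segments V E. s \<subseteq> e} = {sideL (sq e), sideR (sq e)}"
    and seg_arc: "s \<in> rg_segments V E \<Longrightarrow> lo s < hi s \<and> s = g (vtx s) ` cis ` {lo s..hi s}"
    and base: "s \<in> rg_segments V E \<Longrightarrow> base (vtx s) \<in> rg_segments V E \<and> vtx (base (vtx s)) = vtx s \<and>
      lo (base (vtx s)) \<le> lo s \<and> hi s < lo (base (vtx s)) + 2 * pi"

context ribbon_graph
begin

lemma edge_strip_exists:
  assumes e: "e \<in> E"
  shows "\<exists>H. strip H e \<and> sideL H \<noteq> sideR H \<and> {s \<in> Seg. s \<subseteq> e} = {sideL H, sideR H}"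
proof -
  obtain s s' where ss: "{s \<in> Seg. s \<subseteq> e} = {s, s'}" "s \<noteq> s'" using two_segments[OF e] by (auto simp: card_2_iff)
  then have s: "s \<in> Seg" "s \<subseteq> e" "s' \<in> Seg" "s' \<subseteq> e" by auto
  obtain k where k: "continuous_on (cball (0::complex) 1) k" "inj_on k (cball 0 1)" "k ` cball 0 1 = e"
    by (rule disc_param[OF edge_disc[OF e]])
  have bd: "surface_boundary e = k ` sphere 0 1" by (rule disc_boundary[OF k])
  have "edg s = e" "edg s' = e" using edg_iff s e by auto
  then have sub: "s \<subseteq> k ` sphere 0 1" "s' \<subseteq> k ` sphere 0 1" using edg[OF s(1)] edg[OF s(3)] bd by simp_all
  obtain a b where ab: "a < b" "b < a + 2 * pi" "s = k ` cis ` {a..b}" by (rule chart_segment[OF k(1,2) sub(1) segments[OF s(1)]])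
  obtain c' d' where cd': "c' < d'" "d' < c' + 2 * pi" "s' = k ` cis ` {c'..d'}" by (rule chart_segment[OF k(1,2) sub(2) segments[OF s(3)]])
  have "cis ` {a..b} \<inter> cis ` {c'..d'} = {}"
  proof (rule ccontr)
    assume "cis ` {a..b} \<inter> cis ` {c'..d'} \<noteq> {}"
    then have "s \<inter> s' \<noteq> {}" unfolding ab(3) cd'(3) by blast
    then show False using seg_disjoint[OF s(1,3)] ss(2) by blast
  qed
  then obtain c d where cd: "b < c" "c < d" "d < a + 2 * pi" "cis ` {c'..d'} = cis ` {c..d}"
    by (rule arcs_order[OF ab(1,2) cd'(1,2)])
  obtain H where "strip H e" "sideL H = k ` cis ` {a..b}" "sideR H = k ` cis ` {c..d}"
    by (rule disc_strip[OF k ab(1) cd(1-3)])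
  then show ?thesis using ss ab(3) cd'(3) cd(4) by (intro exI[of _ H]) simp
qed

lemma charts_exist:
  obtains g sq lo hi base where "ribbon_charts V E g sq lo hi base"
proof -
  have "\<exists>g. is_chart g v" if "v \<in> V" for v
    by (rule disc_param[OF vertex_disc[OF that]]) (auto simp: is_chart_def)
  then obtain g where g: "\<And>v. v \<in> V \<Longrightarrow> is_chart (g v) v" by metis
  obtain sq where sq: "\<And>e. e \<in> E \<Longrightarrow> strip (sq e) e \<and> sideL (sq e) \<noteq> sideR (sq e) \<and>
      {s \<in> Seg. s \<subseteq> e} = {sideL (sq e), sideR (sq e)}"
    using edge_strip_exists by metis
  have gv: "continuous_on (cball 0 1) (g v)" "inj_on (g v) (cball 0 1)" "surface_boundary v = g v ` sphere 0 1"
    if "v \<in> V" for v using g[OF that] disc_boundary[of "g v" v] unfolding is_chart_def by simp_all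
  have arc: "\<exists>a b. a < b \<and> b < a + 2 * pi \<and> s = g (vtx s) ` cis ` {a..b}" if s: "s \<in> Seg" for s
  proof -
    have v: "vtx s \<in> V" "s \<subseteq> g (vtx s) ` sphere 0 1" using vtx[OF s] gv(3)[of "vtx s"] by auto
    show ?thesis by (rule chart_segment[OF gv(1,2)[OF v(1)] v(2) segments[OF s]]) auto
  qed
  define base where "base v = (SOME s. s \<in> Seg \<and> vtx s = v)" for v
  have base: "base (vtx s) \<in> Seg \<and> vtx (base (vtx s)) = vtx s" if "s \<in> Seg" for s
    unfolding base_def by (rule someI_ex) (use that in auto)
  obtain a0 b0 where ab0: "\<And>s. s \<in> Seg \<Longrightarrow> a0 s < b0 s \<and> b0 s < a0 s + 2 * pi \<and> s = g (vtx s) ` cis ` {a0 s..b0 s}"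
    using arc by metis
  have "\<exists>l h. l < h \<and> s = g (vtx s) ` cis ` {l..h} \<and> a0 (base (vtx s)) \<le> l \<and> h < a0 (base (vtx s)) + 2 * pi \<and>
      (s = base (vtx s) \<longrightarrow> l = a0 s)" if s: "s \<in> Seg" for s
  proof (cases "s = base (vtx s)")
    case True
    then show ?thesis using ab0[OF s] by (intro exI[of _ "a0 s"] exI[of _ "b0 s"]) auto
  next
    case False
    let ?t = "base (vtx s)"
    have t: "?t \<in> Seg" "vtx ?t = vtx s" using base[OF s] by auto
    have at: "a0 ?t < b0 ?t" "b0 ?t < a0 ?t + 2 * pi" "?t = g (vtx s) ` cis ` {a0 ?t..b0 ?t}" using ab0[OF t(1)] t(2) by auto
    have as: "a0 s < b0 s" "b0 s < a0 s + 2 * pi" "s = g (vtx s) ` cis ` {a0 s..b0 s}" using ab0[OF s] by auto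
    have "cis ` {a0 ?t..b0 ?t} \<inter> cis ` {a0 s..b0 s} = {}"
    proof (rule ccontr)
      assume "cis ` {a0 ?t..b0 ?t} \<inter> cis ` {a0 s..b0 s} \<noteq> {}"
      then obtain z where z: "z \<in> cis ` {a0 ?t..b0 ?t}" "z \<in> cis ` {a0 s..b0 s}" by blast
      have "g (vtx s) z \<in> ?t" "g (vtx s) z \<in> s" using z at(3) as(3) by blast+
      then show False using seg_disjoint[OF t(1) s] False by metis
    qed
    then obtain c d where "b0 ?t < c" "c < d" "d < a0 ?t + 2 * pi" "cis ` {a0 s..b0 s} = cis ` {c..d}"
      by (rule arcs_order[OF at(1,2) as(1,2)])
    then show ?thesis using at(1) as(3) False by (intro exI[of _ c] exI[of _ d]) auto
  qed
  then obtain lo hi where lh: "\<And>s. s \<in> Seg \<Longrightarrow> lo s < hi s \<and> s = g (vtx s) ` cis ` {lo s..hi s} \<and>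
      a0 (base (vtx s)) \<le> lo s \<and> hi s < a0 (base (vtx s)) + 2 * pi \<and> (s = base (vtx s) \<longrightarrow> lo s = a0 s)"
    by metis
  have "lo (base (vtx s)) = a0 (base (vtx s))" if "s \<in> Seg" for s using lh[of "base (vtx s)"] base[OF that] by auto
  then have "ribbon_charts V E g sq lo hi base"
    using g sq lh base by unfold_locales auto
  then show ?thesis by (rule that)
qed

end

section \<open>Gaps and flags of a ribbon graph\<close>

lemma strip_eq_iff:
  assumes "strip H M" "x \<in> I01" "y \<in> I01" "x' \<in> I01" "y' \<in> I01"
  shows "H (x, y) = H (x', y') \<longleftrightarrow> x = x' \<and> y = y'"
  using stripD(4)[OF assms(1) _ assms(2-5)] by auto

context ribbon_charts
begin

lemma g: "v \<in> V \<Longrightarrow> continuous_on (cball 0 1) (g v)" "v \<in> V \<Longrightarrow> inj_on (g v) (cball 0 1)"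
  "v \<in> V \<Longrightarrow> g v ` cball 0 1 = v"
  using chart unfolding is_chart_def by auto

lemma bd_vertex: "v \<in> V \<Longrightarrow> surface_boundary v = g v ` sphere 0 1"
  using disc_boundary[OF g] by simp

lemma g_cis_eq: "v \<in> V \<Longrightarrow> g v (cis t) = g v (cis t') \<longleftrightarrow> cis t = cis t'"
  using g(2)[of v] by (auto dest: inj_onD)

lemma g_cis_bd: "v \<in> V \<Longrightarrow> g v (cis t) \<in> surface_boundary v"
  using bd_vertex by auto

lemma g_cis_in: "v \<in> V \<Longrightarrow> g v (cis t) \<in> v"
  using g_cis_bd surface_boundary_subset by blast

definition start :: "'a set \<Rightarrow> 'a" where "start s = g (vtx s) (cis (lo s))"
definition fin :: "'a set \<Rightarrow> 'a" where "fin s = g (vtx s) (cis (hi s))"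
definition segs_at :: "'a set \<Rightarrow> 'a set set" where "segs_at v = {s \<in> Seg. vtx s = v}"
definition full :: "'a set \<Rightarrow> real" where "full v = lo (base v) + 2 * pi"
definition nxt :: "'a set \<Rightarrow> real" where
  "nxt s = disjoint_intervals.nx (segs_at (vtx s)) lo hi (full (vtx s)) s"
definition suc :: "'a set \<Rightarrow> 'a set" where
  "suc s = disjoint_intervals.succ (segs_at (vtx s)) lo hi (base (vtx s)) (full (vtx s)) s"
definition gap :: "'a set \<Rightarrow> 'a set" where "gap s = g (vtx s) ` cis ` {hi s..nxt s}"

lemma vV: "s \<in> Seg \<Longrightarrow> vtx s \<in> V" using vtx by blast

lemma seg_angle: "s \<in> Seg \<Longrightarrow> x \<in> s \<Longrightarrow> \<exists>t. lo s \<le> t \<and> t \<le> hi s \<and> x = g (vtx s) (cis t)"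
proof -
  assume s: "s \<in> Seg" and x: "x \<in> s"
  have "x \<in> g (vtx s) ` cis ` {lo s..hi s}" using seg_arc[OF s] x by blast
  then show ?thesis by auto
qed

lemma angle_seg: "s \<in> Seg \<Longrightarrow> lo s \<le> t \<Longrightarrow> t \<le> hi s \<Longrightarrow> g (vtx s) (cis t) \<in> s"
proof -
  assume s: "s \<in> Seg" and t: "lo s \<le> t" "t \<le> hi s"
  have "g (vtx s) (cis t) \<in> g (vtx s) ` cis ` {lo s..hi s}" using t by auto
  then show ?thesis using seg_arc[OF s] by blast
qed

lemma intervals:
  assumes s: "s \<in> Seg"
  shows "disjoint_intervals (segs_at (vtx s)) lo hi (base (vtx s)) (full (vtx s))"
proof
  show "finite (segs_at (vtx s))" using finite_Seg by (auto simp: segs_at_def)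
  show "base (vtx s) \<in> segs_at (vtx s)" using base[OF s] by (auto simp: segs_at_def)
  show "lo i < hi i \<and> lo (base (vtx s)) \<le> lo i \<and> hi i < full (vtx s)" if "i \<in> segs_at (vtx s)" for i
  proof -
    have i: "i \<in> Seg" "vtx i = vtx s" using that by (auto simp: segs_at_def)
    show ?thesis using seg_arc[OF i(1)] base[OF i(1)] i(2) by (auto simp: full_def)
  qed
  show "hi i < lo j \<or> hi j < lo i" if ij: "i \<in> segs_at (vtx s)" "j \<in> segs_at (vtx s)" "i \<noteq> j" for i j
  proof (rule ccontr)
    assume n: "\<not> (hi i < lo j \<or> hi j < lo i)"
    have i: "i \<in> Seg" "j \<in> Seg" "vtx i = vtx s" "vtx j = vtx s" using ij by (auto simp: segs_at_def)
    let ?t = "max (lo i) (lo j)"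
    have "g (vtx s) (cis ?t) \<in> i" "g (vtx s) (cis ?t) \<in> j"
      using angle_seg[OF i(1), of ?t] angle_seg[OF i(2), of ?t] seg_arc[OF i(1)] seg_arc[OF i(2)] n i(3,4) by auto
    then show False using seg_disjoint[OF i(1,2)] ij(3) by blast
  qed
qed

lemma self_at: "s \<in> Seg \<Longrightarrow> s \<in> segs_at (vtx s)" by (simp add: segs_at_def)

lemma angle_bounds:
  assumes s: "s \<in> Seg"
  shows "lo (base (vtx s)) \<le> lo s" "lo s < hi s" "hi s < nxt s" "nxt s \<le> full (vtx s)" "hi s < lo s + 2 * pi"
proof -
  interpret disjoint_intervals "segs_at (vtx s)" lo hi "base (vtx s)" "full (vtx s)" by (rule intervals[OF s])
  show "lo (base (vtx s)) \<le> lo s" "lo s < hi s" using lohi self_at[OF s] by auto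
  show "hi s < nxt s" "nxt s \<le> full (vtx s)" using nx_greater[OF self_at[OF s]] nx_le(1) by (auto simp: nxt_def)
  show "hi s < lo s + 2 * pi" using lohi[OF self_at[OF s]] by (auto simp: full_def)
qed

lemma suc:
  assumes s: "s \<in> Seg"
  shows "suc s \<in> Seg" "vtx (suc s) = vtx s" "cis (nxt s) = cis (lo (suc s))"
proof -
  interpret disjoint_intervals "segs_at (vtx s)" lo hi "base (vtx s)" "full (vtx s)" by (rule intervals[OF s])
  have c: "suc s \<in> segs_at (vtx s)" "nxt s = full (vtx s) \<and> suc s = base (vtx s) \<or> nxt s = lo (suc s)"
    using succ[OF self_at[OF s]] by (auto simp: suc_def nxt_def)
  then show "suc s \<in> Seg" "vtx (suc s) = vtx s" by (auto simp: segs_at_def)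
  have "cis (full (vtx s)) = cis (lo (base (vtx s)))" using cis_shift[of _ 1] by (simp add: full_def)
  then show "cis (nxt s) = cis (lo (suc s))" using c(2) by auto
qed

lemma start_suc: "s \<in> Seg \<Longrightarrow> start (suc s) = g (vtx s) (cis (nxt s))"
  using suc by (simp add: start_def)

lemma same_angle:
  assumes v: "v \<in> V" and eq: "g v (cis t) = g v (cis t')" and t: "b \<le> t" "t \<le> b + 2 * pi" "b \<le> t'" "t' \<le> b + 2 * pi"
  shows "t = t' \<or> t = b \<and> t' = b + 2 * pi \<or> t' = b \<and> t = b + 2 * pi"
proof -
  have c: "cis t = cis t'" using g_cis_eq[OF v] eq by simp
  show ?thesis
  proof (cases "\<bar>t - t'\<bar> < 2 * pi")
    case True
    then show ?thesis using cis_inj[OF c] by simp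
  next
    case False
    then show ?thesis using t by auto
  qed
qed

lemma gap_sub: "s \<in> Seg \<Longrightarrow> gap s \<subseteq> surface_boundary (vtx s)"
  using g_cis_bd[OF vV] by (auto simp: gap_def)

lemma gap_sub_vtx: "s \<in> Seg \<Longrightarrow> gap s \<subseteq> vtx s"
  using gap_sub surface_boundary_subset by blast

text \<open>Points on the boundary of a vertex have unique angles in one period, up to the coincidence of
its two ends; this reduces the claim to intervals of angles.\<close>

lemma gap_seg_flag:
  assumes s: "s \<in> Seg" and s': "s' \<in> Seg" and x: "x \<in> gap s" "x \<in> s'"
  shows "x = fin s \<and> s' = s \<or> x = start (suc s) \<and> s' = suc s"
proof -
  interpret disjoint_intervals "segs_at (vtx s)" lo hi "base (vtx s)" "full (vtx s)" by (rule intervals[OF s])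
  have v: "vtx s' = vtx s" using seg_vtx_eq[OF s' x(2) vV[OF s]] gap_sub_vtx[OF s] x(1) by blast
  have at: "s \<in> segs_at (vtx s)" "s' \<in> segs_at (vtx s)" using s s' v by (auto simp: segs_at_def)
  obtain t where t: "hi s \<le> t" "t \<le> nxt s" "x = g (vtx s) (cis t)" using x(1) by (auto simp: gap_def)
  obtain t' where t': "lo s' \<le> t'" "t' \<le> hi s'" "x = g (vtx s) (cis t')" using seg_angle[OF s' x(2)] v by auto
  note b = angle_bounds[OF s] angle_bounds[OF s', unfolded v]
  have end_case: "x = start (suc s) \<and> s' = suc s" if "t = nxt s"
  proof -
    have "x = start (suc s)" using t that start_suc[OF s] by simp
    moreover have "start (suc s) \<in> suc s"
      using angle_seg[OF suc(1)[OF s], of "lo (suc s)"] angle_bounds(2)[OF suc(1)[OF s]] by (simp add: start_def)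
    ultimately show ?thesis using seg_disjoint[OF s' suc(1)[OF s]] x(2) by blast
  qed
  consider "t = t'" | "t = full (vtx s)"
    using same_angle[OF vV[OF s], of t t' "lo (base (vtx s))"] t t' b by (fastforce simp: full_def)
  then show ?thesis
  proof cases
    case 1
    have "s' = s \<and> t = hi s \<or> lo s' = t \<and> t = nxt s"
      using gap_seg[OF at, of t] t t' 1 by (auto simp: nxt_def)
    then show ?thesis using end_case t by (auto simp: fin_def)
  next
    case 2
    then show ?thesis using end_case t b(4) by auto
  qed
qed

lemma gap_gap_eq:
  assumes s: "s \<in> Seg" and s': "s' \<in> Seg" and x: "x \<in> gap s" "x \<in> gap s'"
  shows "s = s'"
proof -
  interpret disjoint_intervals "segs_at (vtx s)" lo hi "base (vtx s)" "full (vtx s)" by (rule intervals[OF s])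
  have v: "vtx s' = vtx s" using V_unique[OF vV[OF s'] vV[OF s]] gap_sub_vtx[OF s] gap_sub_vtx[OF s'] x by blast
  have at: "s \<in> segs_at (vtx s)" "s' \<in> segs_at (vtx s)" using s s' v by (auto simp: segs_at_def)
  obtain t where t: "hi s \<le> t" "t \<le> nxt s" "x = g (vtx s) (cis t)" using x(1) by (auto simp: gap_def)
  obtain t' where t': "hi s' \<le> t'" "t' \<le> nxt s'" "x = g (vtx s) (cis t')" using x(2) v by (auto simp: gap_def)
  note b = angle_bounds[OF s] angle_bounds[OF s', unfolded v]
  have "t = t'"
    using same_angle[OF vV[OF s], of t t' "lo (base (vtx s))"] t t' b by (fastforce simp: full_def)
  moreover have "nx s = nxt s" "nx s' = nxt s'" by (simp_all add: nxt_def v)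
  ultimately show ?thesis by (intro gap_gap[OF at, of t]) (use t t' in simp_all)
qed

lemma boundary_cover:
  assumes s: "s \<in> Seg" and x: "x \<in> surface_boundary (vtx s)"
  shows "\<exists>s'\<in>Seg. vtx s' = vtx s \<and> (x \<in> s' \<or> x \<in> gap s')"
proof -
  interpret disjoint_intervals "segs_at (vtx s)" lo hi "base (vtx s)" "full (vtx s)" by (rule intervals[OF s])
  obtain z where z: "z \<in> sphere 0 1" "x = g (vtx s) z" using x bd_vertex[OF vV[OF s]] by auto
  then have "norm z = 1" by simp
  then obtain t where t: "lo (base (vtx s)) \<le> t" "t < lo (base (vtx s)) + 2 * pi" "z = cis t"
    using cis_surj_interval by blast
  then obtain i where i: "i \<in> segs_at (vtx s)" "lo i \<le> t \<and> t \<le> hi i \<or> hi i \<le> t \<and> t \<le> nx i"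
    using seg_or_gap[of t] by (auto simp: full_def)
  have iS: "i \<in> Seg" "vtx i = vtx s" using i by (auto simp: segs_at_def)
  have "x \<in> i \<or> x \<in> gap i"
    using i(2) angle_seg[OF iS(1), of t] z t iS(2) by (auto simp: gap_def nxt_def)
  then show ?thesis using iS by blast
qed

lemma gap_closed_connected: "s \<in> Seg \<Longrightarrow> closed (gap s) \<and> connected (gap s)"
proof -
  assume s: "s \<in> Seg"
  have c: "continuous_on {hi s..nxt s} (\<lambda>t. g (vtx s) (cis t))"
    by (rule continuous_on_compose2[OF g(1)[OF vV[OF s]]]) (auto intro!: continuous_intros)
  have "gap s = (\<lambda>t. g (vtx s) (cis t)) ` {hi s..nxt s}" by (simp add: gap_def image_image)
  then show ?thesis
    using connected_continuous_image[OF c] compact_continuous_image[OF c] compact_imp_closed by auto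
qed

lemma seg_closed_connected: "s \<in> Seg \<Longrightarrow> closed s \<and> connected s"
proof -
  assume s: "s \<in> Seg"
  have "s homeomorphic {0..1::real}" using segments[OF s] by (simp add: is_segment_def)
  then show ?thesis
    using homeomorphic_compactness[of s "{0..1::real}"] homeomorphic_connectedness[of s "{0..1::real}"] compact_imp_closed by auto
qed

lemma start_in: "s \<in> Seg \<Longrightarrow> start s \<in> s"
  using angle_seg[of s "lo s"] seg_arc[of s] by (auto simp: start_def)

lemma fin_in: "s \<in> Seg \<Longrightarrow> fin s \<in> s"
  using angle_seg[of s "hi s"] seg_arc[of s] by (auto simp: fin_def)

lemma fin_in_gap: "s \<in> Seg \<Longrightarrow> fin s \<in> gap s"
  using angle_bounds(3)[of s] by (auto simp: fin_def gap_def)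

lemma start_in_gap: "s \<in> Seg \<Longrightarrow> start (suc s) \<in> gap s"
  using angle_bounds(3)[of s] by (auto simp: start_suc gap_def)

lemma ends_seg: "s \<in> Seg \<Longrightarrow> ends s = {start s, fin s}"
proof -
  assume s: "s \<in> Seg"
  have "ends (g (vtx s) ` cis ` {lo s..hi s}) = {g (vtx s) (cis (lo s)), g (vtx s) (cis (hi s))}"
    by (rule ends_chart_arc[OF g(1,2)[OF vV[OF s]] angle_bounds(2,5)[OF s]])
  moreover have "g (vtx s) ` cis ` {lo s..hi s} = s" using seg_arc[OF s] by simp
  ultimately show ?thesis by (simp add: start_def fin_def)
qed

lemma start_fin: "s \<in> Seg \<Longrightarrow> s' \<in> Seg \<Longrightarrow> start s \<noteq> fin s'"
proof
  assume s: "s \<in> Seg" "s' \<in> Seg" and eq: "start s = fin s'"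
  then have "s = s'" using seg_disjoint[OF s, of "start s"] start_in[OF s(1)] fin_in[OF s(2)] by simp
  then have "cis (lo s) = cis (hi s)" using eq g_cis_eq[OF vV[OF s(1)]] by (simp add: start_def fin_def)
  then have "lo s = hi s" using angle_bounds(2,5)[OF s(1)] by (intro cis_inj) auto
  then show False using angle_bounds(2)[OF s(1)] by simp
qed

lemma inj_start: "inj_on start Seg"
proof (rule inj_onI)
  fix s s' assume "s \<in> Seg" "s' \<in> Seg" "start s = start s'"
  then show "s = s'" using seg_disjoint[of s s' "start s"] start_in[of s] start_in[of s'] by simp
qed

lemma inj_fin: "inj_on fin Seg"
proof (rule inj_onI)
  fix s s' assume "s \<in> Seg" "s' \<in> Seg" "fin s = fin s'"
  then show "s = s'" using seg_disjoint[of s s' "fin s"] fin_in[of s] fin_in[of s'] by simp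
qed

lemma suc_bij: "bij_betw suc Seg Seg"
proof -
  have "inj_on suc Seg"
  proof (rule inj_onI)
    fix s s' assume s: "s \<in> Seg" "s' \<in> Seg" "suc s = suc s'"
    interpret disjoint_intervals "segs_at (vtx s)" lo hi "base (vtx s)" "full (vtx s)" by (rule intervals[OF s(1)])
    have v: "vtx s' = vtx s" using suc(2)[OF s(1)] suc(2)[OF s(2)] s(3) by simp
    then have at: "s \<in> segs_at (vtx s)" "s' \<in> segs_at (vtx s)" using s by (auto simp: segs_at_def)
    have "succ s = succ s'" using s(3) v by (simp add: suc_def)
    then show "s = s'" using succ_bij at by (auto simp: bij_betw_def dest: inj_onD)
  qed
  moreover have "suc ` Seg \<subseteq> Seg" using suc(1) by auto
  ultimately show ?thesis using endo_inj_surj[OF finite_Seg, of suc] by (simp add: bij_betw_def)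
qed

text \<open>A gap joins the end \<open>fin s\<close> of a segment with the start of the next one, which gives the involution \<open>al\<close>. A
vertex without segments has no flag and is represented by a point on its boundary.\<close>

definition Flags :: "'a set" where "Flags = start ` Seg \<union> fin ` Seg"
definition isolated :: "'a set set" where "isolated = {v \<in> V. segs_at v = {}}"
definition pt :: "'a set \<Rightarrow> 'a" where "pt v = g v 1"
definition Marks :: "'a set" where "Marks = Flags \<union> pt ` isolated"
definition al :: "'a \<Rightarrow> 'a" where
  "al p = (if p \<in> start ` Seg then fin (inv_into Seg suc (inv_into Seg start p)) else start (suc (inv_into Seg fin p)))"
definition ca :: "'a set \<Rightarrow> 'a" where "ca e = sq e (0, 0)"
definition cb :: "'a set \<Rightarrow> 'a" where "cb e = sq e (0, 1)"
definition cc :: "'a set \<Rightarrow> 'a" where "cc e = sq e (1, 0)"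
definition cd :: "'a set \<Rightarrow> 'a" where "cd e = sq e (1, 1)"
definition sL :: "'a set \<Rightarrow> 'a set" where "sL e = sideL (sq e)"
definition sR :: "'a set \<Rightarrow> 'a set" where "sR e = sideR (sq e)"

lemma al_fin: "s \<in> Seg \<Longrightarrow> al (fin s) = start (suc s)"
proof -
  assume s: "s \<in> Seg"
  have "fin s \<notin> start ` Seg" using start_fin[OF _ s] by fastforce
  then show ?thesis using inv_into_f_f[OF inj_fin s] by (simp add: al_def)
qed

lemma al_start: "s \<in> Seg \<Longrightarrow> al (start (suc s)) = fin s"
proof -
  assume s: "s \<in> Seg"
  have "inv_into Seg start (start (suc s)) = suc s" by (rule inv_into_f_f[OF inj_start suc(1)[OF s]])
  moreover have "inv_into Seg suc (suc s) = s" using suc_bij s by (simp add: bij_betw_def)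
  ultimately show ?thesis using suc(1)[OF s] by (simp add: al_def)
qed

lemma flag_cases:
  assumes "p \<in> Flags"
  obtains s where "s \<in> Seg" "p = fin s" | s where "s \<in> Seg" "p = start (suc s)"
proof -
  have "\<exists>s\<in>Seg. p = start (suc s)" if p: "p \<in> start ` Seg"
  proof -
    obtain s where s: "s \<in> Seg" "p = start s" using p by auto
    have "s \<in> suc ` Seg" using suc_bij s(1) by (simp add: bij_betw_def)
    then show ?thesis using s(2) by auto
  qed
  then show ?thesis using assms that unfolding Flags_def by auto
qed

lemma sL: "e \<in> E \<Longrightarrow> sL e \<in> Seg \<and> edg (sL e) = e" and sR: "e \<in> E \<Longrightarrow> sR e \<in> Seg \<and> edg (sR e) = e"
  and sLR: "e \<in> E \<Longrightarrow> sL e \<noteq> sR e" and seg_LR: "s \<in> Seg \<Longrightarrow> s = sL (edg s) \<or> s = sR (edg s)"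
proof -
  have *: "{s \<in> Seg. s \<subseteq> e} = {sL e, sR e} \<and> sL e \<noteq> sR e" if "e \<in> E" for e
    using edge_strip[OF that] by (simp add: sL_def sR_def)
  have mem: "s \<in> Seg \<and> edg s = e" if e: "e \<in> E" and s: "s \<in> {sL e, sR e}" for e s
  proof -
    have "s \<in> {s \<in> Seg. s \<subseteq> e}" using *[OF e] s by simp
    then show ?thesis using edg_iff[of s e] e by simp
  qed
  show "sL e \<in> Seg \<and> edg (sL e) = e" if "e \<in> E" by (rule mem[OF that]) simp
  show "sR e \<in> Seg \<and> edg (sR e) = e" if "e \<in> E" by (rule mem[OF that]) simp
  show "sL e \<noteq> sR e" if "e \<in> E" using *[OF that] by simp
  show "s = sL (edg s) \<or> s = sR (edg s)" if s: "s \<in> Seg"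
  proof -
    have "s \<in> {t \<in> Seg. t \<subseteq> edg s}" using s seg_sub(2)[OF s] by simp
    then have "s \<in> {sL (edg s), sR (edg s)}" using *[of "edg s"] edg[OF s] by simp
    then show ?thesis by simp
  qed
qed

lemma strip_e: "e \<in> E \<Longrightarrow> strip (sq e) e" using edge_strip by blast

lemma ends_LR: "e \<in> E \<Longrightarrow> {ca e, cb e} = {start (sL e), fin (sL e)}" "e \<in> E \<Longrightarrow> {cc e, cd e} = {start (sR e), fin (sR e)}"
  using ends_side[OF strip_e, of e] ends_seg[of "sL e"] ends_seg[of "sR e"] sL[of e] sR[of e]
  by (auto simp: sL_def sR_def ca_def cb_def cc_def cd_def)

lemma corners_in: "e \<in> E \<Longrightarrow> ca e \<in> sL e \<and> cb e \<in> sL e \<and> cc e \<in> sR e \<and> cd e \<in> sR e"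
  by (auto simp: ca_def cb_def cc_def cd_def sL_def sR_def sideL_def sideR_def)

lemma corners_in_e: "e \<in> E \<Longrightarrow> ca e \<in> e \<and> cb e \<in> e \<and> cc e \<in> e \<and> cd e \<in> e"
  using corners_in[of e] sL[of e] sR[of e] seg_sub(2)[of "sL e"] seg_sub(2)[of "sR e"] by auto

lemma Flags_corners: "Flags = (\<Union>e\<in>E. {ca e, cb e, cc e, cd e})"
proof -
  have "Seg = (\<Union>e\<in>E. {sL e, sR e})"
  proof (intro set_eqI iffI)
    fix s assume "s \<in> Seg"
    then show "s \<in> (\<Union>e\<in>E. {sL e, sR e})" using seg_LR[of s] edg[of s] by blast
  qed (use sL sR in auto)
  then have "Flags = (\<Union>e\<in>E. {start (sL e), fin (sL e)} \<union> {start (sR e), fin (sR e)})" unfolding Flags_def by auto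
  also have "\<dots> = (\<Union>e\<in>E. {ca e, cb e} \<union> {cc e, cd e})" by (rule SUP_cong) (simp_all only: ends_LR)
  finally show ?thesis by auto
qed

sublocale flag_graph Marks Flags E al ca cb cc cd "\<lambda>p. p \<in> start ` Seg"
proof
  show "finite Marks" using finite_Seg finite_V by (auto simp: Marks_def Flags_def isolated_def)
  show "finite E" by (rule finite_E)
  show "Flags \<subseteq> Marks" by (auto simp: Marks_def)
  show "al p \<in> Flags \<and> al (al p) = p" if "p \<in> Flags" for p
    using that by (cases rule: flag_cases) (auto simp: al_fin al_start Flags_def suc(1))
  show "distinct [ca e, cb e, cc e, cd e]" if e: "e \<in> E" for e
    by (simp add: ca_def cb_def cc_def cd_def strip_eq_iff[OF strip_e[OF e]])
  show "{ca e, cb e, cc e, cd e} \<inter> {ca e', cb e', cc e', cd e'} = {}" if ee: "e \<in> E" "e' \<in> E" "e \<noteq> e'" for e e'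
  proof (rule ccontr)
    assume "{ca e, cb e, cc e, cd e} \<inter> {ca e', cb e', cc e', cd e'} \<noteq> {}"
    then obtain x where x: "x \<in> {ca e, cb e, cc e, cd e}" "x \<in> {ca e', cb e', cc e', cd e'}" by blast
    have "x \<in> e" using x(1) corners_in_e[OF ee(1)] by auto
    moreover have "x \<in> e'" using x(2) corners_in_e[OF ee(2)] by auto
    ultimately show False using E_unique[OF ee(1,2)] ee(3) by blast
  qed
  show "Flags = (\<Union>e\<in>E. {ca e, cb e, cc e, cd e})" by (rule Flags_corners)
  have nst: "fin s \<notin> start ` Seg" if "s \<in> Seg" for s using start_fin[OF _ that] by fastforce
  show "(al p \<in> start ` Seg) \<noteq> (p \<in> start ` Seg)" if "p \<in> Flags" for p
    using that by (cases rule: flag_cases) (auto simp: al_fin al_start nst suc(1))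
  show "(ca e \<in> start ` Seg) \<noteq> (cb e \<in> start ` Seg) \<and> (cc e \<in> start ` Seg) \<noteq> (cd e \<in> start ` Seg)" if e: "e \<in> E" for e
  proof -
    have "start (sL e) \<in> start ` Seg" "start (sR e) \<in> start ` Seg" "fin (sL e) \<notin> start ` Seg" "fin (sR e) \<notin> start ` Seg"
      using sL[OF e] sR[OF e] nst by auto
    moreover have "x = u \<and> y = w \<or> x = w \<and> y = u \<Longrightarrow> u \<in> S \<Longrightarrow> w \<notin> S \<Longrightarrow> (x \<in> S) \<noteq> (y \<in> S)" for x y u w and S :: "'a set"
      by blast
    ultimately show ?thesis using ends_LR[OF e] unfolding doubleton_eq_iff by metis
  qed
qed

end

section \<open>The boundary of the surface of an edge set\<close>

lemma patch_disc:
  fixes D C :: "'a::t2_space set"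
  assumes D: "is_disc D" and C: "closed C" and x: "x \<in> D" "x \<notin> C"
  shows "x \<in> surface_boundary (D \<union> C) \<longleftrightarrow> x \<in> surface_boundary D"
proof -
  obtain k where k: "continuous_on (cball (0::complex) 1) k" "inj_on k (cball 0 1)" "k ` cball 0 1 = D"
    by (rule disc_param[OF D])
  obtain q where q: "q \<in> cball 0 1" "x = k q" using x(1) k(3) by blast
  show ?thesis
    using boundary_of_patch[OF compact_cball k(1,2) C q(1)] boundary_of_patch[OF compact_cball k(1,2) closed_empty q(1)] x(2) q(2) k(3)
    by simp
qed

lemma sides_flip: "sideL (\<lambda>z. H (fst z, 1 - snd z)) = sideL H" "sideR (\<lambda>z. H (fst z, 1 - snd z)) = sideR H"
proof -
  have I: "(\<lambda>y::real. 1 - y) ` I01 = I01" by simp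
  have "sideL (\<lambda>z. H (fst z, 1 - snd z)) = (\<lambda>y. H (0, y)) ` (\<lambda>y. 1 - y) ` I01"
    by (simp only: sideL_def image_image fst_conv snd_conv)
  then show "sideL (\<lambda>z. H (fst z, 1 - snd z)) = sideL H" unfolding I by (simp only: sideL_def)
  have "sideR (\<lambda>z. H (fst z, 1 - snd z)) = (\<lambda>y. H (1, y)) ` (\<lambda>y. 1 - y) ` I01"
    by (simp only: sideR_def image_image fst_conv snd_conv)
  then show "sideR (\<lambda>z. H (fst z, 1 - snd z)) = sideR H" unfolding I by (simp only: sideR_def)
qed

lemma strip_align:
  fixes H1 H2 :: "real \<times> real \<Rightarrow> 'a::t2_space"
  assumes H1: "strip H1 M" and H2: "strip H2 N" and eq: "sideR H1 = sideL H2"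
  obtains H where "strip H N" "sideL H = sideL H2" "sideR H = sideR H2"
    "H1 (1, 0) = H (0, 0)" "H1 (1, 1) = H (0, 1)" "H = H2 \<or> H = (\<lambda>z. H2 (fst z, 1 - snd z))"
proof -
  have "{H1 (1, 0), H1 (1, 1)} = {H2 (0, 0), H2 (0, 1)}" using ends_side[OF H1] ends_side[OF H2] eq by simp
  then consider "H1 (1, 0) = H2 (0, 0)" "H1 (1, 1) = H2 (0, 1)" | "H1 (1, 0) = H2 (0, 1)" "H1 (1, 1) = H2 (0, 0)"
    by (auto simp: doubleton_eq_iff)
  then show ?thesis
  proof cases
    case 1
    then show ?thesis by (intro that[of H2] H2) auto
  next
    case 2
    then show ?thesis by (intro that[of "\<lambda>z. H2 (fst z, 1 - snd z)"] strip_flip[OF H2] sides_flip) auto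
  qed
qed

lemma strip_reverse:
  assumes H: "strip H M" shows "strip (\<lambda>z. H (1 - fst z, snd z)) M"
proof -
  let ?T = "\<lambda>z::real \<times> real. (1 - fst z, snd z)"
  have im: "?T ` Sq = Sq"
  proof (intro set_eqI iffI)
    fix p assume "p \<in> Sq"
    then show "p \<in> ?T ` Sq" by (intro image_eqI[of _ _ "?T p"]) auto
  qed auto
  have "strip (\<lambda>z. H (?T z)) (H ` ?T ` Sq)"
    by (rule strip_compose[OF H]) (auto simp: inj_on_def intro!: continuous_intros)
  then show ?thesis unfolding im stripD(2)[OF H] .
qed

lemma sides_reverse: "sideL (\<lambda>z. H (1 - fst z, snd z)) = sideR H" "sideR (\<lambda>z. H (1 - fst z, snd z)) = sideL H"
  by (simp_all add: sideL_def sideR_def)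

lemma strip_half:
  assumes H: "strip H M"
  shows "strip (\<lambda>z. H (fst z / 2, snd z)) (H ` ({0..1/2} \<times> I01))" "closed (H ` ({1/2..1} \<times> I01))"
    "M = H ` ({0..1/2} \<times> I01) \<union> H ` ({1/2..1} \<times> I01)"
proof -
  let ?T = "\<lambda>z::real \<times> real. (fst z / 2, snd z)"
  have im: "?T ` Sq = {0..1/2} \<times> I01"
  proof (intro set_eqI iffI)
    fix p assume "p \<in> {0..1/2::real} \<times> I01"
    then show "p \<in> ?T ` Sq" by (intro image_eqI[of _ _ "(2 * fst p, snd p)"]) auto
  qed auto
  have "strip (\<lambda>z. H (?T z)) (H ` ?T ` Sq)"
    by (rule strip_compose[OF H]) (auto simp: inj_on_def intro!: continuous_intros)
  then show "strip (\<lambda>z. H (fst z / 2, snd z)) (H ` ({0..1/2} \<times> I01))" unfolding im .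
  have sub: "{1/2..1::real} \<times> I01 \<subseteq> Sq" by auto
  have "compact (H ` ({1/2..1} \<times> I01))"
    by (intro compact_continuous_image continuous_on_subset[OF stripD(1)[OF H] sub] compact_Times compact_Icc)
  then show "closed (H ` ({1/2..1} \<times> I01))" by (rule compact_imp_closed)
  have "Sq = {0..1/2} \<times> I01 \<union> {1/2..1} \<times> I01" by auto
  then show "M = H ` ({0..1/2} \<times> I01) \<union> H ` ({1/2..1} \<times> I01)" using stripD(2)[OF H] by (metis image_Un)
qed

context ribbon_charts
begin

abbreviation surf :: "'a set set \<Rightarrow> 'a set" where "surf A \<equiv> rg_surface V A"

lemma closed_V: "W \<subseteq> V \<Longrightarrow> closed (\<Union>W)"
  using finite_V disc_closed_connected vertex_disc finite_subset by (intro closed_Union) auto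

lemma closed_E: "A \<subseteq> E \<Longrightarrow> closed (\<Union>A)"
  using finite_E disc_closed_connected edge_disc finite_subset by (intro closed_Union) auto

lemma vertex_only_boundary:
  assumes A: "A \<subseteq> E" and v: "v \<in> V" and x: "x \<in> v" "x \<notin> \<Union>A"
  shows "x \<in> surface_boundary (surf A) \<longleftrightarrow> x \<in> surface_boundary v"
proof -
  have "surf A = v \<union> (\<Union>(V - {v}) \<union> \<Union>A)" using v by (auto simp: rg_surface_def)
  moreover have "x \<notin> \<Union>(V - {v}) \<union> \<Union>A" using x V_unique[OF v _ x(1)] by auto
  moreover have "closed (\<Union>(V - {v}) \<union> \<Union>A)" by (intro closed_Un closed_V closed_E A) auto
  ultimately show ?thesis using patch_disc[OF vertex_disc[OF v], of "\<Union>(V - {v}) \<union> \<Union>A" x] x(1) by simp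
qed

lemma edge_only_boundary:
  assumes A: "A \<subseteq> E" and e: "e \<in> A" and x: "x \<in> e" "x \<notin> \<Union>V"
  shows "x \<in> surface_boundary (surf A) \<longleftrightarrow> x \<in> surface_boundary e"
proof -
  have eE: "e \<in> E" using A e by auto
  have "surf A = e \<union> (\<Union>(A - {e}) \<union> \<Union>V)" using e by (auto simp: rg_surface_def)
  moreover have "x \<notin> \<Union>(A - {e}) \<union> \<Union>V" using x E_unique[OF eE _ x(1)] A by auto
  moreover have "closed (\<Union>(A - {e}) \<union> \<Union>V)" using A by (intro closed_Un closed_V closed_E) auto
  ultimately show ?thesis using patch_disc[OF edge_disc[OF eE], of "\<Union>(A - {e}) \<union> \<Union>V" x] x(1) by simp
qed

lemma vertex_strip_ending:
  assumes s: "s \<in> Seg"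
  obtains H where "strip H (vtx s)" "sideR H = s"
proof -
  let ?v = "vtx s"
  \<comment> \<open>The other side of the strip is the middle third of the complement of the segment.\<close>
  define r where "r = (lo s - (hi s - 2 * pi)) / 3"
  have r: "r > 0" using angle_bounds(5)[OF s] by (simp add: r_def)
  have lo: "lo s = hi s - 2 * pi + 3 * r" by (simp add: r_def field_simps)
  obtain H where "strip H ?v" "sideR H = g ?v ` cis ` {lo s..hi s}"
    by (rule disc_strip[OF g[OF vV[OF s]], of "hi s - 2 * pi + r" "hi s - 2 * pi + 2 * r" "lo s" "hi s"])
      (use r lo angle_bounds(2)[OF s] in auto)
  then show ?thesis using seg_arc[OF s] by (intro that[of H]) auto
qed

lemma edge_strip_from:
  assumes s: "s \<in> Seg"
  obtains H where "strip H (edg s)" "sideL H = s" "sideL H \<union> sideR H = sL (edg s) \<union> sR (edg s)"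
proof -
  let ?e = "edg s"
  have e: "?e \<in> E" using edg[OF s] by simp
  consider "s = sL ?e" | "s = sR ?e" using seg_LR[OF s] by auto
  then show ?thesis
  proof cases
    case 1
    then show ?thesis by (intro that[of "sq ?e"] strip_e[OF e]) (auto simp: sL_def sR_def)
  next
    case 2
    then show ?thesis
      by (intro that[of "\<lambda>z. sq ?e (1 - fst z, snd z)"] strip_reverse[OF strip_e[OF e]])
        (auto simp: sL_def sR_def sides_reverse)
  qed
qed

lemma vertex_edge_meet: "v \<in> V \<Longrightarrow> e \<in> E \<Longrightarrow> x \<in> v \<Longrightarrow> x \<in> e \<Longrightarrow> x \<in> sL e \<union> sR e"
proof -
  assume "v \<in> V" "e \<in> E" "x \<in> v" "x \<in> e"
  then obtain s where "s \<in> Seg" "x \<in> s" "edg s = e" using in_seg[of v e x] by blast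
  then show ?thesis using seg_LR[of s] by auto
qed

lemma side_disjoint: "strip H M \<Longrightarrow> x \<in> I01 \<Longrightarrow> y \<in> I01 \<Longrightarrow> H (x, y) \<in> sideL H \<longleftrightarrow> x = 0"
  "strip H M \<Longrightarrow> x \<in> I01 \<Longrightarrow> y \<in> I01 \<Longrightarrow> H (x, y) \<in> sideR H \<longleftrightarrow> x = 1"
  unfolding sideL_def sideR_def image_iff by (auto simp: strip_eq_iff)

text \<open>Around a point of a segment the surface is the union of the vertex and the edge, glued along that segment
to one strip, in which the segment is a vertical line. Only half of the edge is used, as the other half
may be attached to the same vertex.\<close>

lemma segment_boundary:
  assumes A: "A \<subseteq> E" and s: "s \<in> Seg" "edg s \<in> A" and x: "x \<in> s"
  shows "x \<in> surface_boundary (surf A) \<longleftrightarrow> x \<in> ends s"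
proof -
  let ?v = "vtx s" and ?e = "edg s"
  have v: "?v \<in> V" and e: "?e \<in> E" using vtx[OF s(1)] edg[OF s(1)] by auto
  obtain H1 where H1: "strip H1 ?v" "sideR H1 = s" by (rule vertex_strip_ending[OF s(1)])
  obtain K where K: "strip K ?e" "sideL K = s" "sideL K \<union> sideR K = sL ?e \<union> sR ?e" by (rule edge_strip_from[OF s(1)])
  let ?N = "K ` ({0..1/2} \<times> I01)" and ?N' = "K ` ({1/2..1} \<times> I01)"
  let ?K2 = "\<lambda>z. K (fst z / 2, snd z)"
  note half = strip_half[OF K(1)]
  have K2L: "sideL ?K2 = s" using K(2) by (simp add: sideL_def)
  have "sideR H1 = sideL ?K2" using H1(2) K2L by simp
  then obtain H2 where H2: "strip H2 ?N" "sideL H2 = sideL ?K2" "H1 (1, 0) = H2 (0, 0)" "H1 (1, 1) = H2 (0, 1)"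
    by (rule strip_align[OF H1(1) half(1)])
  have sN: "s \<subseteq> ?N" using K(2) by (auto simp: sideL_def)
  have vN: "?v \<inter> ?N = s"
  proof (intro set_eqI iffI)
    fix z assume z: "z \<in> ?v \<inter> ?N"
    then obtain p q where pq: "p \<in> {0..1/2}" "q \<in> I01" "z = K (p, q)" by auto
    have "z \<in> ?e" using pq stripD(3)[OF K(1), of p q] by auto
    then have "z \<in> sideL K \<union> sideR K" using vertex_edge_meet[OF v e] z K(3) by auto
    moreover have "z \<notin> sideR K" using side_disjoint(2)[OF K(1), of p q] pq by auto
    ultimately show "z \<in> s" using K(2) by auto
  next
    fix z assume "z \<in> s"
    then show "z \<in> ?v \<inter> ?N" using sN seg_sub(1)[OF s(1)] by auto
  qed
  obtain H where H: "strip H (?v \<union> ?N)" "\<And>y. y \<in> I01 \<Longrightarrow> H (0, y) = H1 (0, y) \<and> H (1/2, y) = H1 (1, y) \<and> H (1, y) = H2 (1, y)"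
    by (rule strip_join[OF H1(1) H2(1)]) (use vN H1(2) H2(2-4) K2L in auto)
  have s_eq: "s = (\<lambda>y. H (1/2, y)) ` I01"
    unfolding H1(2)[symmetric] sideR_def by (rule image_cong) (use H(2) in auto)
  let ?C = "\<Union>(V - {?v}) \<union> \<Union>(A - {?e}) \<union> ?N'"
  have C: "closed ?C" using A by (intro closed_Un closed_V closed_E half(2)) auto
  have xC: "x \<notin> ?C"
  proof -
    have "x \<notin> \<Union>(V - {?v})" using V_unique[OF v] seg_sub(1)[OF s(1)] x by auto
    moreover have "x \<notin> \<Union>(A - {?e})" using E_unique[OF e] seg_sub(2)[OF s(1)] x A by auto
    moreover have "x \<notin> ?N'"
    proof
      assume "x \<in> ?N'"
      then obtain p q where pq: "p \<in> {1/2..1}" "q \<in> I01" "x = K (p, q)" by auto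
      then have "p = 0" using side_disjoint(1)[OF K(1), of p q] x K(2) by auto
      then show False using pq by simp
    qed
    ultimately show ?thesis by auto
  qed
  have S: "surf A = H ` Sq \<union> ?C"
    using stripD(2)[OF H(1)] half(3) v s(2) by (auto simp: rg_surface_def)
  obtain y where y: "y \<in> I01" "x = H (1/2, y)" using x s_eq by auto
  have "x \<in> surface_boundary (H ` Sq \<union> ?C) \<longleftrightarrow> (1/2, y) \<notin> interior Sq"
    unfolding y(2)
    by (rule boundary_of_patch[OF _ stripD(1)[OF H(1)] _ C])
      (use y xC H(1) in \<open>auto simp: strip_def compact_Times\<close>)
  also have "\<dots> \<longleftrightarrow> y = 0 \<or> y = 1"
    using y(1) by (auto simp: interior_Times interior_atLeastAtMost_real)
  also have "\<dots> \<longleftrightarrow> x \<in> ends s"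
  proof -
    have h: "(1/2::real) \<in> I01" by simp
    have "ends s = {H (1/2, 0), H (1/2, 1)}"
      unfolding s_eq by (rule ends_param[OF strip_col[OF H(1) h]]) simp
    then show ?thesis using y strip_eq_iff[OF H(1)] by auto
  qed
  finally show ?thesis using S by simp
qed

end

context ribbon_charts
begin

definition bot :: "'a set \<Rightarrow> 'a set" where "bot e = (\<lambda>x. sq e (x, 0)) ` I01"
definition tp :: "'a set \<Rightarrow> 'a set" where "tp e = (\<lambda>x. sq e (x, 1)) ` I01"

lemma bd_edge: "e \<in> E \<Longrightarrow> surface_boundary e = sL e \<union> sR e \<union> bot e \<union> tp e"
  using strip_boundary[OF strip_e] by (simp add: sL_def sR_def bot_def tp_def)

lemma bot_tp_sub: "e \<in> E \<Longrightarrow> bot e \<subseteq> e" "e \<in> E \<Longrightarrow> tp e \<subseteq> e"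
  using stripD(3)[OF strip_e] by (auto simp: bot_def tp_def)

lemma bot_tp_disjoint: "e \<in> E \<Longrightarrow> x \<in> bot e \<Longrightarrow> x \<notin> tp e"
  by (auto simp: bot_def tp_def strip_eq_iff[OF strip_e])

lemma bot_meets: "e \<in> E \<Longrightarrow> x \<in> bot e \<Longrightarrow> x \<in> sL e \<union> sR e \<Longrightarrow> x = ca e \<or> x = cc e"
  by (auto simp: bot_def sL_def sR_def sideL_def sideR_def ca_def cc_def strip_eq_iff[OF strip_e])

lemma tp_meets: "e \<in> E \<Longrightarrow> x \<in> tp e \<Longrightarrow> x \<in> sL e \<union> sR e \<Longrightarrow> x = cb e \<or> x = cd e"
  by (auto simp: tp_def sL_def sR_def sideL_def sideR_def cb_def cd_def strip_eq_iff[OF strip_e])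

lemma bot_tp_corners: "e \<in> E \<Longrightarrow> ca e \<in> bot e \<and> cc e \<in> bot e \<and> cb e \<in> tp e \<and> cd e \<in> tp e"
  by (auto simp: bot_def tp_def ca_def cb_def cc_def cd_def)

lemma bot_tp_closed_connected: "e \<in> E \<Longrightarrow> closed (bot e) \<and> connected (bot e) \<and> closed (tp e) \<and> connected (tp e)"
proof -
  assume e: "e \<in> E"
  have c: "continuous_on I01 (\<lambda>x. sq e (x, y))" if "y \<in> I01" for y
    by (rule continuous_on_compose2[OF stripD(1)[OF strip_e[OF e]]]) (use that in \<open>auto intro!: continuous_intros\<close>)
  have "compact (bot e)" "compact (tp e)" "connected (bot e)" "connected (tp e)"
    unfolding bot_def tp_def using c[of 0] c[of 1]
    by (auto intro!: compact_continuous_image connected_continuous_image)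
  then show ?thesis using compact_imp_closed by auto
qed

lemma flag_in_seg: "p \<in> Flags \<Longrightarrow> \<exists>s\<in>Seg. p \<in> s \<and> p \<in> ends s"
  using start_in fin_in ends_seg by (auto simp: Flags_def)

lemma seg_flag: "s \<in> Seg \<Longrightarrow> p \<in> Flags \<Longrightarrow> p \<in> s \<Longrightarrow> p \<in> ends s"
  using flag_in_seg[of p] seg_disjoint[of s _ p] by blast

lemma isolated_no_flag: "v \<in> isolated \<Longrightarrow> s \<in> Seg \<Longrightarrow> x \<in> s \<Longrightarrow> x \<notin> v"
  using seg_vtx_eq[of s x v] by (auto simp: isolated_def segs_at_def)

lemma isolated_V: "v \<in> isolated \<Longrightarrow> v \<in> V" by (simp add: isolated_def)

lemma pt_in: "v \<in> isolated \<Longrightarrow> pt v \<in> surface_boundary v \<and> pt v \<in> v"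
  using g_cis_bd[of v 0] g_cis_in[of v 0] isolated_V[of v] by (simp add: pt_def)

lemma pt_not_seg: "v \<in> isolated \<Longrightarrow> s \<in> Seg \<Longrightarrow> pt v \<notin> s"
  using isolated_no_flag[of v s "pt v"] pt_in[of v] by auto

lemma isolated_boundary: "v \<in> isolated \<Longrightarrow> closed (surface_boundary v) \<and> connected (surface_boundary v)"
proof -
  assume "v \<in> isolated"
  then have v: "v \<in> V" by (rule isolated_V)
  have c: "continuous_on (sphere 0 1) (g v)" by (rule continuous_on_subset[OF g(1)[OF v]]) auto
  have "connected (sphere (0::complex) 1)" by (rule connected_sphere) simp
  then show ?thesis unfolding bd_vertex[OF v]
    using compact_continuous_image[OF c compact_sphere] connected_continuous_image[OF c] compact_imp_closed by blast
qed

text \<open>The boundary circles of the vertices without segments, the gaps, the segments of the edges outside \<open>A\<close> and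
the sides of the edges in \<open>A\<close>.\<close>

definition pieces :: "'a set set \<Rightarrow> 'a set set" where
  "pieces A = surface_boundary ` isolated \<union> gap ` Seg \<union> {s \<in> Seg. edg s \<notin> A} \<union> bot ` A \<union> tp ` A"

lemma in_piece_cases:
  assumes "Q \<in> pieces A"
  obtains v where "v \<in> isolated" "Q = surface_boundary v" | s where "s \<in> Seg" "Q = gap s"
    | "Q \<in> Seg" "edg Q \<notin> A" | e where "e \<in> A" "Q = bot e" | e where "e \<in> A" "Q = tp e"
  using assms unfolding pieces_def by blast

text \<open>A point off the edges in \<open>A\<close> is a boundary point if and only if it is one of its vertex, a point off the
vertices if and only if it is one of its edge, and on a segment of an edge in \<open>A\<close> only the two ends are
boundary points.\<close>

lemma boundary_pieces:
  assumes A: "A \<subseteq> E"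
  shows "surface_boundary (surf A) = \<Union>(pieces A)"
proof (intro set_eqI iffI)
  fix x assume x: "x \<in> surface_boundary (surf A)"
  then have "x \<in> \<Union>V \<or> x \<in> \<Union>A" using surface_boundary_subset[of "surf A"] by (auto simp: rg_surface_def)
  then consider v e where "v \<in> V" "x \<in> v" "e \<in> A" "x \<in> e" | v where "v \<in> V" "x \<in> v" "x \<notin> \<Union>A" | e where "e \<in> A" "x \<in> e" "x \<notin> \<Union>V"
    by blast
  then show "x \<in> \<Union>(pieces A)"
  proof cases
    case 1
    have eE: "e \<in> E" using 1 A by auto
    obtain s where s: "s \<in> Seg" "x \<in> s" "edg s = e" using in_seg[OF 1(1) eE 1(2,4)] by blast
    have "x \<in> ends s" using segment_boundary[OF A s(1) _ s(2)] s(3) 1(3) x by simp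
    then have "x = start s \<or> x = fin s" using ends_seg[OF s(1)] by simp
    moreover have "fin s \<in> gap s" by (rule fin_in_gap[OF s(1)])
    moreover obtain s' where "s' \<in> Seg" "s = suc s'" using suc_bij s(1) unfolding bij_betw_def by blast
    ultimately have "\<exists>t\<in>Seg. x \<in> gap t" using start_in_gap[of s'] s(1) by blast
    then show ?thesis by (auto simp: pieces_def)
  next
    case 2
    have xb: "x \<in> surface_boundary v" using vertex_only_boundary[OF A 2] x by simp
    show ?thesis
    proof (cases "v \<in> isolated")
      case True
      then show ?thesis using xb by (auto simp: pieces_def)
    next
      case False
      then obtain s where s: "s \<in> Seg" "vtx s = v" using 2(1) by (auto simp: isolated_def segs_at_def)
      obtain s' where s': "s' \<in> Seg" "x \<in> s' \<or> x \<in> gap s'" using boundary_cover[OF s(1), of x] xb s(2) by auto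
      show ?thesis
      proof (cases "x \<in> s'")
        case True
        then have "edg s' \<notin> A" using 2(3) seg_sub(2)[OF s'(1)] by auto
        then show ?thesis using True s' by (auto simp: pieces_def)
      next
        case False
        then show ?thesis using s' by (auto simp: pieces_def)
      qed
    qed
  next
    case 3
    have eE: "e \<in> E" using 3 A by auto
    have "x \<in> surface_boundary e" using edge_only_boundary[OF A 3] x by simp
    moreover have "x \<notin> sL e" "x \<notin> sR e"
      using 3(3) sL[OF eE] sR[OF eE] seg_sub(1)[of "sL e"] seg_sub(1)[of "sR e"] vV[of "sL e"] vV[of "sR e"] by blast+
    ultimately have "x \<in> bot e \<or> x \<in> tp e" using bd_edge[OF eE] by blast
    then show ?thesis using 3(1) by (auto simp: pieces_def)
  qed
next
  fix x assume "x \<in> \<Union>(pieces A)"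
  then obtain Q where Q: "Q \<in> pieces A" "x \<in> Q" by blast
  have flag: "x \<in> surface_boundary (surf A)" if s: "s \<in> Seg" "edg s \<in> A" "x \<in> ends s" for s
    using segment_boundary[OF A s(1,2)] s(3) by (auto simp: ends_def)
  show "x \<in> surface_boundary (surf A)"
    using Q(1)
  proof (cases rule: in_piece_cases)
    case (1 v)
    have v: "v \<in> V" by (rule isolated_V[OF 1(1)])
    have xv: "x \<in> v" using Q(2) 1(2) surface_boundary_subset by blast
    have "x \<notin> \<Union>A"
    proof
      assume "x \<in> \<Union>A"
      then obtain e where e: "e \<in> E" "x \<in> e" using A by blast
      obtain s where "s \<in> Seg" "x \<in> s" using in_seg[OF v e(1) xv e(2)] by blast
      then show False using isolated_no_flag[OF 1(1)] xv by blast
    qed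
    then show ?thesis using vertex_only_boundary[OF A v xv] Q(2) 1(2) by simp
  next
    case (2 s)
    have v: "vtx s \<in> V" by (rule vV[OF 2(1)])
    have x: "x \<in> gap s" "x \<in> surface_boundary (vtx s)" "x \<in> vtx s"
      using Q(2) 2 gap_sub[OF 2(1)] gap_sub_vtx[OF 2(1)] by auto
    show ?thesis
    proof (cases "x \<in> \<Union>A")
      case False
      then show ?thesis using vertex_only_boundary[OF A v x(3)] x(2) by simp
    next
      case True
      then obtain e where e: "e \<in> A" "x \<in> e" by blast
      obtain s' where s': "s' \<in> Seg" "x \<in> s'" "edg s' = e" using in_seg[OF v _ x(3) e(2)] e A by blast
      have "x = fin s' \<or> x = start s'" using gap_seg_flag[OF 2(1) s'(1) x(1) s'(2)] by auto
      then have "x \<in> ends s'" using ends_seg[OF s'(1)] by auto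
      then show ?thesis using flag s' e by blast
    qed
  next
    case 3
    have x: "x \<in> vtx Q" "x \<in> surface_boundary (vtx Q)" "x \<in> edg Q" "edg Q \<in> E"
      using Q(2) vtx[OF 3(1)] seg_sub[OF 3(1)] edg[OF 3(1)] by auto
    have "x \<notin> \<Union>A" using E_unique[OF x(4) _ x(3)] A 3(2) by blast
    then show ?thesis using vertex_only_boundary[OF A vV[OF 3(1)] x(1)] x(2) by simp
  next
    case (4 e)
    have eE: "e \<in> E" using 4 A by auto
    have xe: "x \<in> e" "x \<in> surface_boundary e" using Q(2) 4 bot_tp_sub[OF eE] bd_edge[OF eE] by auto
    show ?thesis
    proof (cases "x \<in> \<Union>V")
      case False
      then show ?thesis using edge_only_boundary[OF A 4(1) xe(1)] xe(2) by simp
    next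
      case True
      then obtain v where "v \<in> V" "x \<in> v" by blast
      then have "x \<in> sL e \<union> sR e" using vertex_edge_meet[OF _ eE _ xe(1)] by blast
      then have "x = ca e \<or> x = cc e" using bot_meets[OF eE] Q(2) 4(2) by blast
      then have "x \<in> ends (sL e) \<or> x \<in> ends (sR e)"
        using ends_LR[OF eE] ends_seg[of "sL e"] ends_seg[of "sR e"] sL[OF eE] sR[OF eE] by auto
      then show ?thesis using flag[of "sL e"] flag[of "sR e"] sL[OF eE] sR[OF eE] 4(1) by auto
    qed
  next
    case (5 e)
    have eE: "e \<in> E" using 5 A by auto
    have xe: "x \<in> e" "x \<in> surface_boundary e" using Q(2) 5 bot_tp_sub[OF eE] bd_edge[OF eE] by auto
    show ?thesis
    proof (cases "x \<in> \<Union>V")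
      case False
      then show ?thesis using edge_only_boundary[OF A 5(1) xe(1)] xe(2) by simp
    next
      case True
      then obtain v where "v \<in> V" "x \<in> v" by blast
      then have "x \<in> sL e \<union> sR e" using vertex_edge_meet[OF _ eE _ xe(1)] by blast
      then have "x = cb e \<or> x = cd e" using tp_meets[OF eE] Q(2) 5(2) by blast
      then have "x \<in> ends (sL e) \<or> x \<in> ends (sR e)"
        using ends_LR[OF eE] ends_seg[of "sL e"] ends_seg[of "sR e"] sL[OF eE] sR[OF eE] by auto
      then show ?thesis using flag[of "sL e"] flag[of "sR e"] sL[OF eE] sR[OF eE] 5(1) by auto
    qed
  qed
qed

lemma piece_vertex:
  assumes A: "A \<subseteq> E" and Q: "Q \<in> pieces A" "x \<in> Q" "x \<notin> Flags" and v: "v \<in> V" "x \<in> v"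
  shows "Q = surface_boundary v \<and> v \<in> isolated \<or> (\<exists>s\<in>Seg. vtx s = v \<and> Q = gap s) \<or> Q \<in> Seg \<and> vtx Q = v"
  using Q(1)
proof (cases rule: in_piece_cases)
  case (1 w)
  then have "w = v" using V_unique[OF isolated_V[OF 1(1)] v(1)] Q(2) v(2) surface_boundary_subset by blast
  then show ?thesis using 1 by simp
next
  case (2 s)
  then have "vtx s = v" using V_unique[OF vV[OF 2(1)] v(1)] gap_sub_vtx[OF 2(1)] Q(2) v(2) by blast
  then show ?thesis using 2 by blast
next
  case 3
  then show ?thesis using seg_vtx_eq[OF 3(1) Q(2) v] by simp
next
  case (4 e)
  have eE: "e \<in> E" using 4 A by auto
  have "x \<in> sL e \<union> sR e" using vertex_edge_meet[OF v(1) eE v(2)] bot_tp_sub[OF eE] Q(2) 4(2) by blast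
  then have "x = ca e \<or> x = cc e" using bot_meets[OF eE] Q(2) 4(2) by blast
  then show ?thesis using Q(3) corner_in[OF eE] by blast
next
  case (5 e)
  have eE: "e \<in> E" using 5 A by auto
  have "x \<in> sL e \<union> sR e" using vertex_edge_meet[OF v(1) eE v(2)] bot_tp_sub[OF eE] Q(2) 5(2) by blast
  then have "x = cb e \<or> x = cd e" using tp_meets[OF eE] Q(2) 5(2) by blast
  then show ?thesis using Q(3) corner_in[OF eE] by blast
qed

text \<open>So the pieces of the boundary meet in flags only.\<close>

lemma piece_unique:
  assumes A: "A \<subseteq> E" and Q: "Q \<in> pieces A" "x \<in> Q" and Q': "Q' \<in> pieces A" "x \<in> Q'" and x: "x \<notin> Flags"
  shows "Q = Q'"
proof (cases "x \<in> \<Union>V")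
  case True
  then obtain v where v: "v \<in> V" "x \<in> v" by blast
  have gs: False if "s \<in> Seg" "s' \<in> Seg" "x \<in> gap s" "x \<in> s'" for s s'
    using gap_seg_flag[OF that] x that suc(1)[OF that(1)] by (auto simp: Flags_def)
  have iso: False if "v \<in> isolated" "s \<in> Seg" "vtx s = v" for s
    using that by (auto simp: isolated_def segs_at_def)
  show ?thesis
    using piece_vertex[OF A Q x v] piece_vertex[OF A Q' x v]
  proof (elim disjE)
    assume "\<exists>s\<in>Seg. vtx s = v \<and> Q = gap s" "\<exists>s\<in>Seg. vtx s = v \<and> Q' = gap s"
    then show ?thesis using gap_gap_eq Q(2) Q'(2) by blast
  next
    assume "Q \<in> Seg \<and> vtx Q = v" "Q' \<in> Seg \<and> vtx Q' = v"
    then show ?thesis using seg_disjoint[of Q Q' x] Q(2) Q'(2) by blast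
  qed (use gs iso Q(2) Q'(2) in blast)+
next
  case False
  have e: "\<exists>e\<in>A. x \<in> e \<and> (R = bot e \<or> R = tp e)" if R: "R \<in> pieces A" "x \<in> R" for R
    using R(1)
  proof (cases rule: in_piece_cases)
    case (1 w)
    then show ?thesis using False R(2) isolated_V[OF 1(1)] surface_boundary_subset by blast
  next
    case (2 s)
    then show ?thesis using False R(2) vV[OF 2(1)] gap_sub_vtx[OF 2(1)] by blast
  next
    case 3
    then show ?thesis using False R(2) vV[OF 3(1)] seg_sub(1)[OF 3(1)] by blast
  next
    case (4 e)
    then show ?thesis using R(2) A bot_tp_sub(1)[of e] by blast
  next
    case (5 e)
    then show ?thesis using R(2) A bot_tp_sub(2)[of e] by blast
  qed
  obtain e where e1: "e \<in> A" "x \<in> e" "Q = bot e \<or> Q = tp e" using e[OF Q] by blast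
  obtain e' where e2: "e' \<in> A" "x \<in> e'" "Q' = bot e' \<or> Q' = tp e'" using e[OF Q'] by blast
  have E: "e \<in> E" "e' \<in> E" using e1 e2 A by auto
  have "e = e'" by (rule E_unique[OF E e1(2) e2(2)])
  then show ?thesis using e1(3) e2(3) bot_tp_disjoint[OF E(1), of x] Q(2) Q'(2) by auto
qed

lemma piece_marks:
  assumes A: "A \<subseteq> E" and Q: "Q \<in> pieces A" and p: "p \<in> Q" "p \<in> Marks" and q: "q \<in> Q" "q \<in> Marks"
  shows "(p, q) \<in> conn (Rf A)"
proof -
  have two: "(p, q) \<in> conn (Rf A)" if "(u, w) \<in> Rf A" "p = u \<or> p = w" "q = u \<or> q = w" for u w
    using that conn_base[OF that(1)] conn_sym[OF conn_base[OF that(1)]] by auto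
  have flag: "r \<in> Flags" if r: "r \<in> Marks" "s \<in> Seg" "r \<in> vtx s" for r s
  proof (rule ccontr)
    assume "r \<notin> Flags"
    then obtain v where v: "v \<in> isolated" "r = pt v" using r(1) by (auto simp: Marks_def)
    then have "v = vtx s" using V_unique[OF isolated_V[OF v(1)] vV[OF r(2)]] pt_in[OF v(1)] r(3) by blast
    then show False using v(1) r(2) by (auto simp: isolated_def segs_at_def)
  qed
  have edge_flag: "r \<in> Flags" if r: "r \<in> Marks" "e \<in> E" "r \<in> e" for r e
  proof (rule ccontr)
    assume "r \<notin> Flags"
    then obtain v where v: "v \<in> isolated" "r = pt v" using r(1) by (auto simp: Marks_def)
    then obtain s where "s \<in> Seg" "r \<in> s" using in_seg[OF isolated_V[OF v(1)] r(2)] pt_in[OF v(1)] r(3) by blast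
    then show False using pt_not_seg[OF v(1)] v(2) by blast
  qed
  have flag_LR: "r \<in> sL e \<union> sR e" if r: "r \<in> Flags" "e \<in> E" "r \<in> e" for r e
  proof -
    obtain s where s: "s \<in> Seg" "r \<in> s" using flag_in_seg[OF r(1)] by blast
    then show ?thesis using vertex_edge_meet[OF vV[OF s(1)] r(2) _ r(3)] seg_sub(1)[OF s(1)] by blast
  qed
  show ?thesis
    using Q
  proof (cases rule: in_piece_cases)
    case (1 v)
    have "r = pt v" if r: "r \<in> Q" "r \<in> Marks" for r
    proof -
      have rv: "r \<in> v" using r(1) 1(2) surface_boundary_subset by blast
      have "r \<notin> Flags" using flag_in_seg[of r] isolated_no_flag[OF 1(1) _ _ ] rv by blast
      then obtain w where w: "w \<in> isolated" "r = pt w" using r(2) by (auto simp: Marks_def)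
      then have "w = v" using V_unique[OF isolated_V[OF w(1)] isolated_V[OF 1(1)]] pt_in[OF w(1)] rv by blast
      then show ?thesis using w by simp
    qed
    then have "p = pt v" "q = pt v" using p q by blast+
    then show ?thesis by simp
  next
    case (2 s)
    have "r = fin s \<or> r = start (suc s)" if r: "r \<in> Q" "r \<in> Marks" for r
    proof -
      have "r \<in> Flags" using flag[OF r(2) 2(1)] gap_sub_vtx[OF 2(1)] r(1) 2(2) by blast
      then obtain s' where "s' \<in> Seg" "r \<in> s'" using flag_in_seg by blast
      then show ?thesis using gap_seg_flag[OF 2(1)] r(1) 2(2) by blast
    qed
    moreover have "fin s \<in> Flags" using 2(1) by (auto simp: Flags_def)
    then have "(fin s, al (fin s)) \<in> Rf A" unfolding Rf_def gaps_def by blast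
    then have "(fin s, start (suc s)) \<in> Rf A" using al_fin[OF 2(1)] by simp
    ultimately show ?thesis using two p q by blast
  next
    case 3
    let ?e = "edg Q"
    have e: "?e \<in> E - A" using edg[OF 3(1)] 3(2) by auto
    have "r \<in> ends Q" if r: "r \<in> Q" "r \<in> Marks" for r
      using seg_flag[OF 3(1) flag[OF r(2) 3(1)] r(1)] seg_sub(1)[OF 3(1)] r(1) by blast
    then have pq: "p \<in> ends Q" "q \<in> ends Q" using p q by auto
    consider "Q = sL ?e" | "Q = sR ?e" using seg_LR[OF 3(1)] by auto
    then show ?thesis
    proof cases
      case L: 1
      have "ends Q = {ca ?e, cb ?e}" using L ends_seg[OF 3(1)] ends_LR(1)[of ?e] e by auto
      moreover have "(ca ?e, cb ?e) \<in> Rf A" using e by (auto simp: Rf_def segs_def)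
      ultimately show ?thesis using two pq by blast
    next
      case R: 2
      have "ends Q = {cc ?e, cd ?e}" using R ends_seg[OF 3(1)] ends_LR(2)[of ?e] e by auto
      moreover have "(cc ?e, cd ?e) \<in> Rf A" using e by (auto simp: Rf_def segs_def)
      ultimately show ?thesis using two pq by blast
    qed
  next
    case (4 e)
    have eE: "e \<in> E" using 4 A by auto
    have "r = ca e \<or> r = cc e" if r: "r \<in> Q" "r \<in> Marks" for r
    proof -
      have re: "r \<in> e" using bot_tp_sub(1)[OF eE] r(1) 4(2) by blast
      show ?thesis using bot_meets[OF eE _ flag_LR[OF edge_flag[OF r(2) eE re] eE re]] r(1) 4(2) by blast
    qed
    moreover have "(ca e, cc e) \<in> Rf A" using 4 by (auto simp: Rf_def sides_def)
    ultimately show ?thesis using two p q by blast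
  next
    case (5 e)
    have eE: "e \<in> E" using 5 A by auto
    have "r = cb e \<or> r = cd e" if r: "r \<in> Q" "r \<in> Marks" for r
    proof -
      have re: "r \<in> e" using bot_tp_sub(2)[OF eE] r(1) 5(2) by blast
      show ?thesis using tp_meets[OF eE _ flag_LR[OF edge_flag[OF r(2) eE re] eE re]] r(1) 5(2) by blast
    qed
    moreover have "(cb e, cd e) \<in> Rf A" using 5 by (auto simp: Rf_def sides_def)
    ultimately show ?thesis using two p q by blast
  qed
qed

lemma boundary_cover_marked:
  assumes A: "A \<subseteq> E"
  shows "marked_cover (pieces A) Marks (Rf A)"
proof
  have finA: "finite A" using A finite_E finite_subset by blast
  show "finite (pieces A)" using finite_Seg finite_V finA by (auto simp: pieces_def isolated_def)
  show "closed Q \<and> connected Q \<and> (\<exists>x\<in>Marks. x \<in> Q)" if Q: "Q \<in> pieces A" for Q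
    using Q
  proof (cases rule: in_piece_cases)
    case (1 v)
    then show ?thesis using isolated_boundary[OF 1(1)] pt_in[OF 1(1)] by (auto simp: Marks_def)
  next
    case (2 s)
    then show ?thesis using gap_closed_connected[OF 2(1)] fin_in_gap[OF 2(1)] by (auto simp: Marks_def Flags_def)
  next
    case 3
    then show ?thesis using seg_closed_connected[OF 3(1)] fin_in[OF 3(1)] by (auto simp: Marks_def Flags_def)
  next
    case (4 e)
    then show ?thesis using bot_tp_closed_connected[of e] bot_tp_corners[of e] corner_in_X[of e] A by blast
  next
    case (5 e)
    then show ?thesis using bot_tp_closed_connected[of e] bot_tp_corners[of e] corner_in_X[of e] A by blast
  qed
  show "\<exists>x\<in>Marks. x \<in> Q \<and> x \<in> Q'" if Q: "Q \<in> pieces A" "Q' \<in> pieces A" "Q \<inter> Q' \<noteq> {}" for Q Q'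
  proof -
    obtain x where x: "x \<in> Q" "x \<in> Q'" using Q(3) by blast
    show ?thesis
    proof (cases "x \<in> Flags")
      case True
      then show ?thesis using x by (auto simp: Marks_def)
    next
      case False
      then have "Q = Q'" using piece_unique[OF A Q(1) x(1) Q(2) x(2)] by simp
      then show ?thesis using \<open>\<And>Q. Q \<in> pieces A \<Longrightarrow> closed Q \<and> connected Q \<and> (\<exists>x\<in>Marks. x \<in> Q)\<close>[OF Q(1)] by blast
    qed
  qed
  show "(x, y) \<in> conn (Rf A)" if "Q \<in> pieces A" "x \<in> Q" "y \<in> Q" "x \<in> Marks" "y \<in> Marks" for Q x y
    using piece_marks[OF A that(1,2,4,3,5)] .
  show "\<exists>Q\<in>pieces A. x \<in> Q \<and> y \<in> Q" if "(x, y) \<in> Rf A" for x y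
  proof -
    consider "y = al x" "x \<in> Flags" | e where "e \<in> E - A" "x = ca e \<and> y = cb e \<or> x = cc e \<and> y = cd e"
      | e where "e \<in> A" "x = ca e \<and> y = cc e \<or> x = cb e \<and> y = cd e"
      using \<open>(x, y) \<in> Rf A\<close> unfolding Rf_def gaps_def segs_def sides_def by blast
    then show ?thesis
    proof cases
      case 1
      have "\<exists>s\<in>Seg. x \<in> gap s \<and> y \<in> gap s"
        using 1(2)
      proof (cases rule: flag_cases)
        case (1 s)
        then show ?thesis using \<open>y = al x\<close> al_fin[OF 1(1)] fin_in_gap[OF 1(1)] start_in_gap[OF 1(1)] by auto
      next
        case (2 s)
        then show ?thesis using \<open>y = al x\<close> al_start[OF 2(1)] fin_in_gap[OF 2(1)] start_in_gap[OF 2(1)] by auto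
      qed
      then show ?thesis by (auto simp: pieces_def)
    next
      case (2 e)
      then have "sL e \<in> pieces A" "sR e \<in> pieces A" using sL[of e] sR[of e] by (auto simp: pieces_def)
      then show ?thesis using 2 corners_in[of e] by blast
    next
      case (3 e)
      then have "bot e \<in> pieces A" "tp e \<in> pieces A" by (auto simp: pieces_def)
      moreover have "ca e \<in> bot e \<and> cc e \<in> bot e \<and> cb e \<in> tp e \<and> cd e \<in> tp e"
        using bot_tp_corners[of e] 3(1) A by auto
      ultimately show ?thesis using 3(2) by metis
    qed
  qed
  show "Marks \<subseteq> \<Union>(pieces A)"
  proof
    fix x assume "x \<in> Marks"
    then consider "x \<in> Flags" | v where "v \<in> isolated" "x = pt v" by (auto simp: Marks_def)
    then show "x \<in> \<Union>(pieces A)"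
    proof cases
      case 1
      then show ?thesis
      proof (cases rule: flag_cases)
        case (1 s)
        then show ?thesis using fin_in_gap[OF 1(1)] by (auto simp: pieces_def)
      next
        case (2 s)
        then show ?thesis using start_in_gap[OF 2(1)] by (auto simp: pieces_def)
      qed
    next
      case (2 v)
      then show ?thesis using pt_in[OF 2(1)] by (auto simp: pieces_def)
    qed
  qed
qed

theorem rg_f_eq: "A \<subseteq> E \<Longrightarrow> rg_f V A = nf A"
  using marked_cover.card_components[OF boundary_cover_marked] boundary_pieces by (simp add: rg_f_def nf_def)

text \<open>The boundary circle of a vertex is connected and covered by the boundary pieces of the surface without
edges.\<close>

lemma vertex_flags_connected:
  assumes v: "v \<in> V" and p: "p \<in> Flags" "p \<in> v" and q: "q \<in> Flags" "q \<in> v"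
  shows "(p, q) \<in> conn (Rk {})"
proof -
  interpret marked_cover "pieces {}" Marks "Rf {}" by (rule boundary_cover_marked) simp
  obtain s where s: "s \<in> Seg" "p \<in> s" using flag_in_seg[OF p(1)] by blast
  obtain s' where s': "s' \<in> Seg" "q \<in> s'" using flag_in_seg[OF q(1)] by blast
  have bd: "p \<in> surface_boundary v" "q \<in> surface_boundary v"
    using seg_vtx_eq[OF s v p(2)] seg_vtx_eq[OF s' v q(2)] vtx[OF s(1)] vtx[OF s'(1)] s(2) s'(2) by auto
  have "surface_boundary v \<subseteq> \<Union>(pieces {})"
  proof
    fix x assume x: "x \<in> surface_boundary v"
    then have "x \<in> v" using surface_boundary_subset by blast
    then have "x \<in> surface_boundary (surf {})" using vertex_only_boundary[of "{}" v x] v x by simp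
    then show "x \<in> \<Union>(pieces {})" using boundary_pieces[of "{}"] by simp
  qed
  moreover have "connected (surface_boundary v)"
  proof -
    have c: "continuous_on (sphere 0 1) (g v)" by (rule continuous_on_subset[OF g(1)[OF v]]) auto
    have "connected (sphere (0::complex) 1)" by (rule connected_sphere) simp
    then show ?thesis unfolding bd_vertex[OF v] using connected_continuous_image[OF c] by blast
  qed
  ultimately have "(p, q) \<in> conn (Rf {})" using connected_marks[of "surface_boundary v" p q] bd p q by (auto simp: Marks_def)
  then show ?thesis using Rf_sub_Rk by blast
qed

lemma edge_flags_connected:
  assumes e: "e \<in> A" "A \<subseteq> E" and p: "p \<in> {ca e, cb e, cc e, cd e}" and q: "q \<in> {ca e, cb e, cc e, cd e}"
  shows "(p, q) \<in> conn (Rk A)"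
proof -
  have eE: "e \<in> E" using e by auto
  have "(ca e, x) \<in> conn (Rk A)" if "x \<in> {ca e, cb e, cc e, cd e}" for x
  proof -
    have ab: "(ca e, cb e) \<in> conn (Rk A)" "(cc e, cd e) \<in> conn (Rk A)" using seg_in_Rk[OF eE, of A] by (auto intro: conn_base)
    have ac: "(ca e, cc e) \<in> conn (Rk A)" using e by (intro conn_base) (auto simp: Rk_def sides_def)
    then have "(ca e, cd e) \<in> conn (Rk A)" using conn_trans[OF ac ab(2)] by simp
    then show ?thesis using ab ac that by auto
  qed
  then show ?thesis using conn_trans[OF conn_sym] p q by metis
qed

lemma surface_cover_marked:
  assumes A: "A \<subseteq> E"
  shows "marked_cover (V \<union> A) Marks (Rk A)"
proof
  have finA: "finite A" using A finite_E finite_subset by blast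
  show "finite (V \<union> A)" using finite_V finA by simp
  have v_mark: "\<exists>x\<in>Marks. x \<in> v" if v: "v \<in> V" for v
  proof (cases "v \<in> isolated")
    case True
    then show ?thesis using pt_in[OF True] by (auto simp: Marks_def)
  next
    case False
    then obtain s where s: "s \<in> Seg" "vtx s = v" using v by (auto simp: isolated_def segs_at_def)
    then show ?thesis using start_in[OF s(1)] seg_sub(1)[OF s(1)] by (auto simp: Marks_def Flags_def)
  qed
  have e_mark: "\<exists>x\<in>Marks. x \<in> e" if "e \<in> A" for e
    using that A corners_in_e[of e] corner_in_X[of e] by blast
  show 1: "closed Q \<and> connected Q \<and> (\<exists>x\<in>Marks. x \<in> Q)" if Q: "Q \<in> V \<union> A" for Q
    using Q v_mark e_mark disc_closed_connected[of Q] vertex_disc[of Q] edge_disc[of Q] A by blast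
  have VE: "\<exists>x\<in>Marks. x \<in> v \<and> x \<in> e" if v: "v \<in> V" and e: "e \<in> A" and x: "x \<in> v" "x \<in> e" for v e x
  proof -
    obtain s where s: "s \<in> Seg" "vtx s = v" "edg s = e" using in_seg[OF v _ x] e A by blast
    then show ?thesis using start_in[OF s(1)] seg_sub[OF s(1)] by (auto simp: Marks_def Flags_def)
  qed
  show "\<exists>x\<in>Marks. x \<in> Q \<and> x \<in> Q'" if Q: "Q \<in> V \<union> A" "Q' \<in> V \<union> A" "Q \<inter> Q' \<noteq> {}" for Q Q'
  proof -
    obtain x where x: "x \<in> Q" "x \<in> Q'" using Q(3) by blast
    consider "Q \<in> V" "Q' \<in> V" | "Q \<in> A" "Q' \<in> A" | "Q \<in> V" "Q' \<in> A" | "Q \<in> A" "Q' \<in> V" using Q by blast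
    then show ?thesis
    proof cases
      case 1
      then have "Q = Q'" using V_unique x by blast
      then show ?thesis using v_mark 1 by blast
    next
      case 2
      then have "Q = Q'" using E_unique[of Q Q' x] x A by blast
      then show ?thesis using e_mark 2 by blast
    next
      case 3
      then show ?thesis using VE x by blast
    next
      case 4
      then show ?thesis using VE[of Q' Q x] x by blast
    qed
  qed
  show "(x, y) \<in> conn (Rk A)" if Q: "Q \<in> V \<union> A" "x \<in> Q" "y \<in> Q" "x \<in> Marks" "y \<in> Marks" for Q x y
  proof (cases "Q \<in> V")
    case True
    show ?thesis
    proof (cases "Q \<in> isolated")
      case iso: True
      have "r = pt Q" if r: "r \<in> Q" "r \<in> Marks" for r
      proof -
        have "r \<notin> Flags" using flag_in_seg[of r] isolated_no_flag[OF iso] r(1) by blast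
        then obtain w where w: "w \<in> isolated" "r = pt w" using r(2) by (auto simp: Marks_def)
        then have "w = Q" using V_unique[OF isolated_V[OF w(1)] True] pt_in[OF w(1)] r(1) by blast
        then show ?thesis using w by simp
      qed
      then have "x = pt Q" "y = pt Q" using Q by blast+
      then show ?thesis by simp
    next
      case False
      have fl: "r \<in> Flags" if r: "r \<in> Q" "r \<in> Marks" for r
      proof (rule ccontr)
        assume "r \<notin> Flags"
        then obtain w where w: "w \<in> isolated" "r = pt w" using r(2) by (auto simp: Marks_def)
        then have "w = Q" using V_unique[OF isolated_V[OF w(1)] True] pt_in[OF w(1)] r(1) by blast
        then show False using w(1) False by simp
      qed
      have "(x, y) \<in> conn (Rk {})" using vertex_flags_connected[OF True fl _ fl] Q by simp
      then show ?thesis using Rk_mono[of "{}" A] by auto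
    qed
  next
    case False
    then have QA: "Q \<in> A" "Q \<in> E" using Q(1) A by auto
    have "r \<in> {ca Q, cb Q, cc Q, cd Q}" if r: "r \<in> Q" "r \<in> Marks" for r
    proof -
      have "r \<in> Flags"
      proof (rule ccontr)
        assume "r \<notin> Flags"
        then obtain w where w: "w \<in> isolated" "r = pt w" using r(2) by (auto simp: Marks_def)
        then obtain s where "s \<in> Seg" "r \<in> s" using in_seg[OF isolated_V[OF w(1)] QA(2)] pt_in[OF w(1)] r(1) by blast
        then show False using pt_not_seg[OF w(1)] w(2) by blast
      qed
      then obtain s where s: "s \<in> Seg" "r \<in> s" "r \<in> ends s" using flag_in_seg by blast
      have "edg s = Q" by (rule seg_edg_eq[OF s(1,2) QA(2) r(1)])
      then have "s = sL Q \<or> s = sR Q" using seg_LR[OF s(1)] by simp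
      then show ?thesis using ends_LR[OF QA(2)] ends_seg[OF s(1)] s(3) by auto
    qed
    then show ?thesis using edge_flags_connected[OF QA(1) A] Q by blast
  qed
  show "\<exists>Q\<in>V \<union> A. x \<in> Q \<and> y \<in> Q" if xy: "(x, y) \<in> Rk A" for x y
  proof -
    consider "y = al x" "x \<in> Flags" | e where "e \<in> E" "x = ca e \<and> y = cb e \<or> x = cc e \<and> y = cd e"
      | e where "e \<in> A" "x = ca e \<and> y = cc e \<or> x = cb e \<and> y = cd e"
      using xy unfolding Rk_def gaps_def segs_def sides_def by blast
    then show ?thesis
    proof cases
      case 1
      have "\<exists>s\<in>Seg. x \<in> gap s \<and> y \<in> gap s"
        using 1(2)
      proof (cases rule: flag_cases)
        case (1 s)
        then show ?thesis using \<open>y = al x\<close> al_fin[OF 1(1)] fin_in_gap[OF 1(1)] start_in_gap[OF 1(1)] by auto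
      next
        case (2 s)
        then show ?thesis using \<open>y = al x\<close> al_start[OF 2(1)] fin_in_gap[OF 2(1)] start_in_gap[OF 2(1)] by auto
      qed
      then obtain s where s: "s \<in> Seg" "x \<in> gap s" "y \<in> gap s" by blast
      then show ?thesis using gap_sub_vtx[OF s(1)] vV[OF s(1)] by blast
    next
      case (2 e)
      have "ca e \<in> vtx (sL e) \<and> cb e \<in> vtx (sL e)" "cc e \<in> vtx (sR e) \<and> cd e \<in> vtx (sR e)" "vtx (sL e) \<in> V" "vtx (sR e) \<in> V"
        using corners_in[OF 2(1)] sL[OF 2(1)] sR[OF 2(1)] seg_sub(1)[of "sL e"] seg_sub(1)[of "sR e"] vV by auto
      then show ?thesis using 2(2) by blast
    next
      case (3 e)
      moreover have "ca e \<in> e \<and> cb e \<in> e \<and> cc e \<in> e \<and> cd e \<in> e"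
        using corners_in_e[of e] 3(1) A by auto
      ultimately show ?thesis by (metis UnI2)
    qed
  qed
  show "Marks \<subseteq> \<Union>(V \<union> A)"
  proof
    fix x assume "x \<in> Marks"
    then consider "x \<in> Flags" | v where "v \<in> isolated" "x = pt v" by (auto simp: Marks_def)
    then show "x \<in> \<Union>(V \<union> A)"
    proof cases
      case 1
      then obtain s where s: "s \<in> Seg" "x \<in> s" using flag_in_seg by blast
      then show ?thesis using seg_sub(1)[OF s(1)] vV[OF s(1)] by blast
    next
      case (2 v)
      then show ?thesis using pt_in[OF 2(1)] isolated_V[OF 2(1)] by blast
    qed
  qed
qed

theorem rg_k_eq: "A \<subseteq> E \<Longrightarrow> rg_k V A = nk A"
  using marked_cover.card_components[OF surface_cover_marked] by (simp add: rg_k_def nk_def rg_surface_def)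

text \<open>The vertices, each marked by its centre, form a cover of their union by disjoint pieces.\<close>

lemma card_V: "card V = nk {}"
proof -
  let ?p = "\<lambda>v. g v 0"
  have p: "?p v \<in> v" if "v \<in> V" for v using g(3)[OF that] by force
  interpret marked_cover V "?p ` V" "{}"
  proof
    show "finite V" by (rule finite_V)
    show "closed Q \<and> connected Q \<and> (\<exists>x\<in>?p ` V. x \<in> Q)" if "Q \<in> V" for Q
      using disc_closed_connected[OF vertex_disc[OF that]] p[OF that] that by blast
    show "\<exists>x\<in>?p ` V. x \<in> Q \<and> x \<in> Q'" if Q: "Q \<in> V" "Q' \<in> V" "Q \<inter> Q' \<noteq> {}" for Q Q'
    proof -
      have "Q = Q'" using Q V_unique by blast
      then show ?thesis using p[OF Q(1)] Q(1) by blast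
    qed
    show "(x, y) \<in> conn {}" if Q: "Q \<in> V" "x \<in> Q" "y \<in> Q" "x \<in> ?p ` V" "y \<in> ?p ` V" for Q x y
    proof -
      obtain v w where vw: "v \<in> V" "x = ?p v" "w \<in> V" "y = ?p w" using Q by blast
      have "v = Q" "w = Q" using V_unique[OF vw(1) Q(1)] V_unique[OF vw(3) Q(1)] p[OF vw(1)] p[OF vw(3)] vw Q by blast+
      then show ?thesis using vw by simp
    qed
    show "?p ` V \<subseteq> \<Union>V" using p by blast
  qed auto
  have "inj_on ?p V"
  proof (rule inj_onI)
    fix v w assume vw: "v \<in> V" "w \<in> V" "?p v = ?p w"
    show "v = w" using V_unique[OF vw(1,2) p[OF vw(1)]] p[OF vw(2)] vw(3) by simp
  qed
  then have "card V = ncomp (?p ` V) {}" by (simp add: ncomp_empty card_image)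
  also have "\<dots> = rg_k V {}" using card_components by (simp add: rg_k_def rg_surface_def)
  finally show ?thesis using rg_k_eq[of "{}"] by simp
qed

end

section \<open>Coloured surfaces are orientable\<close>

lemma continuous_on_inv_into_compact:
  fixes f :: "'b::topological_space \<Rightarrow> 'c::t2_space"
  assumes "continuous_on S f" "compact S" "inj_on f S"
  shows "continuous_on (f ` S) (inv_into S f)"
  by (rule continuous_on_inv[OF assms(1,2)]) (simp add: inv_into_f_f[OF assms(3)])

lemma arc_angle:
  fixes f :: "real \<Rightarrow> complex"
  assumes f: "continuous_on I01 f" "inj_on f I01" and im: "f ` I01 = cis ` {a..b}" and ab: "a < b" "b < a + 2 * pi"
    and e: "f 0 = cis a" "f 1 = cis b"
  obtains \<theta> where "continuous_on I01 \<theta>" "strict_mono_on I01 \<theta>" "\<And>y. y \<in> I01 \<Longrightarrow> f y = cis (\<theta> y)"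
proof -
  let ?g = "\<lambda>y. cis (a + (b - a) * y)"
  have im': "(\<lambda>y. a + (b - a) * y) ` I01 = {a..b}"
    using image_affinity_atLeastAtMost[of "b - a" a 0 1] ab by (simp add: add.commute)
  have gi: "inj_on ?g I01"
  proof -
    have "inj_on (\<lambda>y. a + (b - a) * y) I01" using ab by (auto simp: inj_on_def)
    moreover have "inj_on cis ((\<lambda>y. a + (b - a) * y) ` I01)" unfolding im' by (rule inj_on_cis[OF ab(2)])
    ultimately have "inj_on (cis \<circ> (\<lambda>y. a + (b - a) * y)) I01" by (rule comp_inj_on)
    then show ?thesis by (simp add: o_def)
  qed
  have "?g ` I01 = cis ` (\<lambda>y. a + (b - a) * y) ` I01" by (simp only: image_image)
  then have img: "f ` I01 = ?g ` I01" using im im' by simp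
  have gc: "continuous_on I01 ?g" by (intro continuous_intros)
  obtain \<phi> where \<phi>: "continuous_on I01 \<phi>" "strict_mono_on I01 \<phi>" "\<And>y. y \<in> I01 \<Longrightarrow> \<phi> y \<in> I01 \<and> ?g (\<phi> y) = f y"
    by (rule arc_reparam[OF f gc gi img]) (use e in auto)
  show ?thesis
  proof (rule that[of "\<lambda>y. a + (b - a) * \<phi> y"])
    show "continuous_on I01 (\<lambda>y. a + (b - a) * \<phi> y)" by (intro continuous_intros \<phi>)
    show "strict_mono_on I01 (\<lambda>y. a + (b - a) * \<phi> y)"
      using \<phi>(2) ab by (auto simp: strict_mono_on_def)
    show "f y = cis (a + (b - a) * \<phi> y)" if "y \<in> I01" for y using \<phi>(3)[OF that] by simp
  qed
qed

text \<open>In polar coordinates, with the angle as abscissa and the distance from the unit circle as ordinate,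
  an edge is mapped to the half annulus that joins two intervals of angles: its horizontal lines go to
  half circles from \<open>l y\<close> to \<open>r y\<close>. These are nested, hence disjoint, if \<open>l\<close> increases and
  \<open>r\<close> decreases, and this is what the colouring ensures.\<close>

definition bandX :: "(real \<Rightarrow> real) \<Rightarrow> (real \<Rightarrow> real) \<Rightarrow> real \<times> real \<Rightarrow> real" where
  "bandX l r z = (l (snd z) + r (snd z)) / 2 - (r (snd z) - l (snd z)) / 2 * cos (pi * fst z)"
definition bandY :: "(real \<Rightarrow> real) \<Rightarrow> (real \<Rightarrow> real) \<Rightarrow> real \<times> real \<Rightarrow> real" where
  "bandY l r z = (r (snd z) - l (snd z)) / 2 * sin (pi * fst z)"

locale nested =
  fixes l r :: "real \<Rightarrow> real"
  assumes lc: "continuous_on I01 l" and rc: "continuous_on I01 r"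
    and l_mono: "y \<in> I01 \<Longrightarrow> y' \<in> I01 \<Longrightarrow> y < y' \<Longrightarrow> l y < l y'"
    and r_mono: "y \<in> I01 \<Longrightarrow> y' \<in> I01 \<Longrightarrow> y < y' \<Longrightarrow> r y' < r y"
    and lr: "y \<in> I01 \<Longrightarrow> l y < r y"
begin

lemma band_continuous: "continuous_on Sq (bandX l r)" "continuous_on Sq (bandY l r)"
  unfolding bandX_def bandY_def
  by (intro continuous_intros continuous_on_compose2[OF lc] continuous_on_compose2[OF rc]; auto)+

lemma bandY_nonneg: "z \<in> Sq \<Longrightarrow> 0 \<le> bandY l r z"
proof -
  assume z: "z \<in> Sq"
  then have "pi * fst z \<le> pi" by (cases z) simp
  then have "0 \<le> sin (pi * fst z)" using z by (cases z) (auto intro!: sin_ge_zero)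
  then show ?thesis using z lr[of "snd z"] by (cases z) (auto simp: bandY_def)
qed

lemma bandY_zero: "z \<in> Sq \<Longrightarrow> bandY l r z = 0 \<Longrightarrow> fst z = 0 \<or> fst z = 1"
proof (rule ccontr)
  assume z: "z \<in> Sq" "bandY l r z = 0" and n: "\<not> (fst z = 0 \<or> fst z = 1)"
  have "0 < pi * fst z" "pi * fst z < pi" using z n by (cases z, auto)+
  then have "0 < sin (pi * fst z)" by (rule sin_gt_zero)
  moreover have "0 < r (snd z) - l (snd z)" using lr[of "snd z"] z by (cases z) auto
  ultimately show False using z(2) by (simp add: bandY_def)
qed

lemma band_sides: "bandX l r (0, y) = l y" "bandX l r (1, y) = r y" "bandY l r (0, y) = 0" "bandY l r (1, y) = 0"
  by (simp_all add: bandX_def bandY_def field_simps)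

lemma band_power:
  assumes "z \<in> Sq"
  shows "l (snd z) \<le> bandX l r z" "bandX l r z \<le> r (snd z)"
    "(bandX l r z - l (snd z)) * (r (snd z) - bandX l r z) = (bandY l r z)\<^sup>2"
proof -
  let ?R = "(r (snd z) - l (snd z)) / 2" and ?c = "cos (pi * fst z)" and ?s = "sin (pi * fst z)"
  have R: "?R > 0" using lr[of "snd z"] assms by (cases z) auto
  have X: "bandX l r z - l (snd z) = ?R * (1 - ?c)" "r (snd z) - bandX l r z = ?R * (1 + ?c)"
    by (simp_all add: bandX_def field_simps)
  have "0 \<le> ?R * (1 - ?c)" "0 \<le> ?R * (1 + ?c)"
    using R cos_le_one[of "pi * fst z"] cos_ge_minus_one[of "pi * fst z"]
    by (intro mult_nonneg_nonneg; linarith)+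
  then show "l (snd z) \<le> bandX l r z" "bandX l r z \<le> r (snd z)" using X by auto
  have "?s\<^sup>2 = (1 - ?c) * (1 + ?c)"
    using sin_squared_eq[of "pi * fst z"] by (simp add: power2_eq_square algebra_simps)
  moreover have "(R * (1 - c)) * (R * (1 + c)) = R\<^sup>2 * ((1 - c) * (1 + c))" for R c :: real
    by (simp only: power2_eq_square mult.assoc mult.left_commute)
  ultimately have "(?R * (1 - ?c)) * (?R * (1 + ?c)) = (?R * ?s)\<^sup>2" by (simp only: power_mult_distrib)
  then show "(bandX l r z - l (snd z)) * (r (snd z) - bandX l r z) = (bandY l r z)\<^sup>2"
    unfolding X by (simp only: bandY_def)
qed

text \<open>For a point on a half circle, the product of the distances of its abscissa from the two ends is the square
of its ordinate (\<open>band_power\<close>). Over the interval of an inner half circle this product is larger for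
the outer one.\<close>

lemma band_inj:
  assumes z: "z \<in> Sq" "z' \<in> Sq" and eq: "bandX l r z = bandX l r z'" "bandY l r z = bandY l r z'"
  shows "z = z'"
proof -
  have no: False if zz: "z \<in> Sq" "z' \<in> Sq" "bandX l r z = bandX l r z'" "bandY l r z = bandY l r z'" "snd z < snd z'" for z z'
  proof -
    have i: "snd z \<in> I01" "snd z' \<in> I01" using zz by auto
    note p = band_power[OF zz(1)] band_power[OF zz(2)]
    have "bandX l r z - l (snd z) > bandX l r z' - l (snd z')" "r (snd z) - bandX l r z > r (snd z') - bandX l r z'"
      using l_mono[OF i zz(5)] r_mono[OF i zz(5)] zz(3) by auto
    moreover have "0 \<le> bandX l r z' - l (snd z')" "0 \<le> r (snd z') - bandX l r z'" using p by auto
    ultimately have "(bandX l r z' - l (snd z')) * (r (snd z') - bandX l r z') < (bandX l r z - l (snd z)) * (r (snd z) - bandX l r z)"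
      by (intro mult_strict_mono') auto
    then show False using p(3,6) zz(4) by simp
  qed
  have y: "snd z = snd z'" using no[OF z eq] no[OF z(2,1) eq[symmetric]] by (cases "snd z" "snd z'" rule: linorder_cases) auto
  have "r (snd z) - l (snd z) > 0" using lr[of "snd z"] z by (cases z) auto
  then have c: "cos (pi * fst z) = cos (pi * fst z')" using eq(1) y by (simp add: bandX_def)
  have "0 \<le> pi * fst z" "pi * fst z \<le> pi" "0 \<le> pi * fst z'" "pi * fst z' \<le> pi" using z by auto
  then have "pi * fst z = pi * fst z'" using c by (rule cos_inj_pi)
  then show "z = z'" using y by (simp add: prod_eq_iff)
qed

end

context ribbon_charts
begin

context
  fixes A :: "'a set set" and eps :: "'a \<Rightarrow> bool"
  assumes A: "A \<subseteq> E" and bal: "balances eps A"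
begin

text \<open>Whether the colouring agrees with the orientation of the vertex by its chart.\<close>

definition pos :: "'a set \<Rightarrow> bool" where "pos v \<longleftrightarrow> (\<exists>s\<in>Seg. vtx s = v \<and> eps (start s))"

lemma eps_flip: "s \<in> Seg \<Longrightarrow> eps (fin s) \<noteq> eps (start s)"
proof -
  assume s: "s \<in> Seg"
  have e: "edg s \<in> E" using edg[OF s] by simp
  have "{ca (edg s), cb (edg s)} = {start s, fin s} \<or> {cc (edg s), cd (edg s)} = {start s, fin s}"
    using seg_LR[OF s] ends_LR[OF e] by metis
  then show ?thesis using balances_seg[OF bal e] by (auto simp: doubleton_eq_iff)
qed

text \<open>Along gaps and segments the colouring alternates as the orientation by charts does, and these connect all
flags of a vertex.\<close>

lemma eps_vertex:
  assumes s: "s \<in> Seg" "s' \<in> Seg" "vtx s = vtx s'"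
  shows "eps (start s) = eps (start s')"
proof -
  let ?o = "\<lambda>p. p \<in> start ` Seg"
  have flip: "eps p \<noteq> eps q \<and> ?o p \<noteq> ?o q" if pq: "(p, q) \<in> Rk {}" for p q
  proof -
    have "(p, q) \<in> Rk A" using pq by (auto simp: Rk_def sides_def)
    then have "eps p \<noteq> eps q" using bal by (auto simp: balances_def)
    moreover have "?o p \<noteq> ?o q"
    proof -
      consider "p \<in> Flags" "q = al p" | e where "e \<in> E" "p = ca e \<and> q = cb e \<or> p = cc e \<and> q = cd e"
        using pq unfolding Rk_def gaps_def segs_def sides_def by blast
      then show ?thesis
      proof cases
        case 1
        then show ?thesis using eps0_al[OF 1(1)] by simp
      next
        case 2
        then show ?thesis using eps0_seg[OF 2(1)] by auto
      qed
    qed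
    ultimately show ?thesis ..
  qed
  have "(eps p = eps q) = (?o p = ?o q)" if "(p, q) \<in> conn (Rk {})" for p q
    using that
  proof (induction rule: conn_induct)
    case (step q r)
    then show ?case using flip[of q r] flip[of r q] by auto
  qed simp
  moreover have "(start s, start s') \<in> conn (Rk {})"
    using s start_in[OF s(1)] start_in[OF s(2)] seg_sub(1)[OF s(1)] seg_sub(1)[OF s(2)]
    by (intro vertex_flags_connected[OF vV[OF s(1)]]) (auto simp: Flags_def)
  ultimately show ?thesis using s by simp
qed

lemma pos_iff: "s \<in> Seg \<Longrightarrow> pos (vtx s) \<longleftrightarrow> eps (start s)"
proof
  assume s: "s \<in> Seg"
  show "pos (vtx s) \<Longrightarrow> eps (start s)"
  proof -
    assume "pos (vtx s)"
    then obtain s' where s': "s' \<in> Seg" "vtx s' = vtx s" "eps (start s')" by (auto simp: pos_def)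
    then show "eps (start s)" using eps_vertex[OF s'(1) s s'(2)] by simp
  qed
  show "eps (start s) \<Longrightarrow> pos (vtx s)" using s by (auto simp: pos_def)
qed

text \<open>The chart of a vertex, reflected where necessary to agree with the colouring.\<close>

definition kv :: "'a set \<Rightarrow> 'a \<Rightarrow> complex" where
  "kv v x = (if pos v then inv_into (cball 0 1) (g v) x else cnj (inv_into (cball 0 1) (g v) x))"

lemma kv_g: "v \<in> V \<Longrightarrow> z \<in> cball 0 1 \<Longrightarrow> kv v (g v z) = (if pos v then z else cnj z)"
  using g(2)[of v] by (simp add: kv_def inv_into_f_f)

lemma kv:
  assumes v: "v \<in> V"
  shows "continuous_on v (kv v)" "inj_on (kv v) v" "x \<in> v \<Longrightarrow> norm (kv v x) \<le> 1"
proof -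
  have "continuous_on v (inv_into (cball 0 1) (g v))"
    using continuous_on_inv_into_compact[OF g(1)[OF v] compact_cball g(2)[OF v]] g(3)[OF v] by simp
  then show "continuous_on v (kv v)" unfolding kv_def by (cases "pos v") (auto intro!: continuous_intros)
  have ex: "\<exists>z\<in>cball 0 1. x = g v z" if "x \<in> v" for x using g(3)[OF v] that by blast
  show "inj_on (kv v) v"
  proof (rule inj_onI)
    fix x y assume xy: "x \<in> v" "y \<in> v" "kv v x = kv v y"
    obtain z w where "z \<in> cball 0 1" "x = g v z" "w \<in> cball 0 1" "y = g v w" using ex xy by metis
    then show "x = y" using xy(3) kv_g[OF v] by (cases "pos v") auto
  qed
  show "norm (kv v x) \<le> 1" if x: "x \<in> v"
  proof -
    obtain z where "z \<in> cball 0 1" "x = g v z" using ex[OF x] by blast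
    then show ?thesis using kv_g[OF v] by auto
  qed
qed

lemma kv_cis: "v \<in> V \<Longrightarrow> kv v (g v (cis t)) = cis (if pos v then t else - t)"
  using kv_g[of v "cis t"] by (simp add: cis_cnj)

text \<open>Through reflection of some charts the coloured end of every segment becomes the one at which its interval of
angles begins.\<close>

lemma seg_kv:
  assumes s: "s \<in> Seg"
  obtains a b where "a < b" "b < a + 2 * pi" "kv (vtx s) ` s = cis ` {a..b}"
    "\<And>p q. {p, q} = ends s \<Longrightarrow> p \<noteq> q \<Longrightarrow> eps p \<Longrightarrow> kv (vtx s) p = cis a \<and> kv (vtx s) q = cis b"
proof -
  let ?v = "vtx s"
  note v = vV[OF s]
  have arc: "kv ?v ` s = (\<lambda>t. cis (if pos ?v then t else - t)) ` {lo s..hi s}"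
  proof -
    have "kv ?v ` s = kv ?v ` g ?v ` cis ` {lo s..hi s}" using seg_arc[OF s] by simp
    then show ?thesis by (simp only: image_image kv_cis[OF v])
  qed
  have k: "kv ?v (start s) = cis (if pos ?v then lo s else - lo s)" "kv ?v (fin s) = cis (if pos ?v then hi s else - hi s)"
    by (simp_all add: start_def fin_def kv_cis[OF v])
  note b = angle_bounds(2,5)[OF s]
  show ?thesis
  proof (cases "pos ?v")
    case True
    then have "eps (start s)" "\<not> eps (fin s)" using pos_iff[OF s] eps_flip[OF s] by auto
    then show ?thesis
      using True arc k b ends_seg[OF s] by (intro that[of "lo s" "hi s"]) (auto simp: doubleton_eq_iff)
  next
    case False
    then have ee: "\<not> eps (start s)" "eps (fin s)" using pos_iff[OF s] eps_flip[OF s] by auto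
    have "(\<lambda>t. cis (- t)) ` {lo s..hi s} = cis ` uminus ` {lo s..hi s}" by (simp only: image_image)
    then have "kv ?v ` s = cis ` {- hi s..- lo s}" using arc False by (simp add: image_uminus_atLeastAtMost)
    then show ?thesis
      using False k b ends_seg[OF s] ee by (intro that[of "- hi s" "- lo s"]) (auto simp: doubleton_eq_iff)
  qed
qed

lemma side_angle:
  assumes s: "s \<in> Seg" and f: "continuous_on I01 f" "inj_on f I01" "f ` I01 = s" and e: "eps (f 0)"
  obtains \<theta> where "continuous_on I01 \<theta>" "strict_mono_on I01 \<theta>" "\<And>y. y \<in> I01 \<Longrightarrow> kv (vtx s) (f y) = cis (\<theta> y)"
proof -
  let ?v = "vtx s"
  note v = vV[OF s]
  have fv: "f ` I01 \<subseteq> ?v" using f(3) seg_sub(1)[OF s] by simp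
  have ends: "ends s = {f 0, f 1}" using ends_param[OF f(1,2)] f(3) by simp
  have ne: "f 0 \<noteq> f 1" using f(2) by (auto dest: inj_onD)
  obtain a b where ab: "a < b" "b < a + 2 * pi" "kv ?v ` s = cis ` {a..b}"
    "\<And>p q. {p, q} = ends s \<Longrightarrow> p \<noteq> q \<Longrightarrow> eps p \<Longrightarrow> kv (vtx s) p = cis a \<and> kv (vtx s) q = cis b"
    by (rule seg_kv[OF s]) blast
  have k: "kv ?v (f 0) = cis a \<and> kv ?v (f 1) = cis b" using ab(4)[of "f 0" "f 1"] ends ne e by simp
  have 1: "continuous_on I01 (\<lambda>y. kv ?v (f y))" by (rule continuous_on_compose2[OF kv(1)[OF v] f(1) fv])
  have 2: "inj_on (\<lambda>y. kv ?v (f y)) I01"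
    using comp_inj_on[OF f(2) inj_on_subset[OF kv(2)[OF v] fv]] by (simp add: o_def)
  have 3: "(\<lambda>y. kv ?v (f y)) ` I01 = cis ` {a..b}" using ab(3) f(3) by (metis image_image)
  obtain \<theta> where "continuous_on I01 \<theta>" "strict_mono_on I01 \<theta>" "\<And>y. y \<in> I01 \<Longrightarrow> kv ?v (f y) = cis (\<theta> y)"
    by (rule arc_angle[OF 1 2 3 ab(1,2)]) (use k in auto)
  then show ?thesis by (rule that)
qed

text \<open>The colours alternate around the edge, so its segments are run through in opposite directions when
they are followed from the bottom of the strip to its top.\<close>

lemma edge_band:
  assumes e: "e \<in> A"
  shows "\<exists>T l r. strip T e \<and> sideL T = sL e \<and> sideR T = sR e \<and> nested l r \<and>
    (\<forall>y\<in>I01. kv (vtx (sL e)) (T (0, y)) = cis (l y) \<and> kv (vtx (sR e)) (T (1, y)) = cis (r y))"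
proof -
  have eE: "e \<in> E" using e A by auto
  have col: "eps (ca e) \<noteq> eps (cb e)" "eps (cc e) \<noteq> eps (cd e)" "eps (ca e) \<noteq> eps (cc e)"
    using balances_seg[OF bal eE] balances_side[OF bal e] by auto
  obtain T where T: "strip T e" "sideL T = sL e" "sideR T = sR e" "eps (T (0, 0))" "eps (T (1, 1))"
  proof (cases "eps (ca e)")
    case True
    then show ?thesis using col
      by (intro that[of "sq e"] strip_e[OF eE]) (auto simp: sL_def sR_def ca_def cc_def cd_def)
  next
    case False
    then show ?thesis using col
      by (intro that[of "\<lambda>z. sq e (fst z, 1 - snd z)"] strip_flip[OF strip_e[OF eE]])
        (simp_all add: sides_flip sL_def sR_def ca_def cb_def cc_def)
  qed
  have 01: "(0::real) \<in> I01" "(1::real) \<in> I01" by auto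
  have sSeg: "sL e \<in> Seg" "sR e \<in> Seg" using sL[OF eE] sR[OF eE] by auto
  obtain l where l: "continuous_on I01 l" "strict_mono_on I01 l" "\<And>y. y \<in> I01 \<Longrightarrow> kv (vtx (sL e)) (T (0, y)) = cis (l y)"
    by (rule side_angle[OF sSeg(1) strip_col[OF T(1) 01(1)]]) (use T in \<open>auto simp: sideL_def\<close>)
  have flipR: "continuous_on I01 (\<lambda>y. T (1, 1 - y))" "inj_on (\<lambda>y. T (1, 1 - y)) I01" "(\<lambda>y. T (1, 1 - y)) ` I01 = sR e"
    using strip_col[OF strip_flip[OF T(1)] 01(2)] sides_flip(2)[of T] T(3) by (simp_all add: sideR_def)
  obtain r' where r': "continuous_on I01 r'" "strict_mono_on I01 r'"
    "\<And>y. y \<in> I01 \<Longrightarrow> kv (vtx (sR e)) (T (1, 1 - y)) = cis (r' y)"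
    by (rule side_angle[OF sSeg(2) flipR]) (use T in auto)
  \<comment> \<open>A number of full turns that moves all angles of the right side beyond those of the left side.\<close>
  define n where "n = \<lceil>(l 1 - r' 0) / (2 * pi)\<rceil> + 1"
  define r where "r y = r' (1 - y) + 2 * pi * of_int n" for y
  have big: "l 1 < r 1"
  proof -
    have "(l 1 - r' 0) / (2 * pi) < of_int n" unfolding n_def by linarith
    moreover have "0 < 2 * pi" by simp
    ultimately have "l 1 - r' 0 < of_int n * (2 * pi)" by (simp only: pos_divide_less_eq)
    then show ?thesis by (simp add: r_def algebra_simps)
  qed
  have lm: "l y < l y'" if "y \<in> I01" "y' \<in> I01" "y < y'" for y y' using strict_mono_onD[OF l(2) that] .
  have rm: "r y' < r y" if "y \<in> I01" "y' \<in> I01" "y < y'" for y y'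
    using strict_mono_onD[OF r'(2), of "1 - y'" "1 - y"] that by (auto simp: r_def)
  have "nested l r"
  proof
    show "continuous_on I01 l" by (rule l)
    show "continuous_on I01 r" unfolding r_def
      by (intro continuous_intros continuous_on_compose2[OF r'(1)]) auto
    show "l y < r y" if y: "y \<in> I01" for y
      using lm[OF y 01(2)] rm[OF y 01(2)] big y by (cases "y = 1") auto
  qed (use lm rm in auto)
  moreover have "kv (vtx (sR e)) (T (1, y)) = cis (r y)" if "y \<in> I01" for y
    using r'(3)[of "1 - y"] that by (simp add: r_def cis_shift)
  ultimately show ?thesis using T l(3) by blast
qed

text \<open>Vertices are mapped into the unit disc and edges to its complement, with the segments on the unit
circle; so a conflict can only arise between two points of one vertex, which are separated by its
chart, or between two points of one edge, which are separated if their polar angles are close.\<close>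

lemma balanced_immersion:
  obtains \<Phi> :: "'a \<Rightarrow> complex" where "continuous_on (surf A) \<Phi>"
    "\<And>x. x \<in> surf A \<Longrightarrow> \<exists>U. openin (top_of_set (surf A)) U \<and> x \<in> U \<and> inj_on \<Phi> U"
proof -
  obtain T l r where T: "\<And>e. e \<in> A \<Longrightarrow> strip (T e) e \<and> sideL (T e) = sL e \<and> sideR (T e) = sR e \<and> nested (l e) (r e) \<and>
    (\<forall>y\<in>I01. kv (vtx (sL e)) (T e (0, y)) = cis (l e y) \<and> kv (vtx (sR e)) (T e (1, y)) = cis (r e y))"
    using edge_band by metis
  define ti where "ti e = inv_into Sq (T e)" for e
  define X where "X e x = bandX (l e) (r e) (ti e x)" for e x
  define Y where "Y e x = bandY (l e) (r e) (ti e x)" for e x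
  define F where "F e x = complex_of_real (1 + Y e x) * cis (X e x)" for e x
  define \<Phi> where "\<Phi> x = (if x \<in> \<Union>V then kv (THE v. v \<in> V \<and> x \<in> v) x else F (THE e. e \<in> A \<and> x \<in> e) x)" for x
  have st: "strip (T e) e" and nest: "nested (l e) (r e)" if "e \<in> A" for e using T[OF that] by auto
  have ti: "ti e x \<in> Sq \<and> T e (ti e x) = x" if "e \<in> A" "x \<in> e" for e x
  proof -
    have "x \<in> T e ` Sq" using stripD(2)[OF st[OF that(1)]] that(2) by simp
    then show ?thesis unfolding ti_def by (intro conjI inv_into_into f_inv_into_f)
  qed
  have tic: "continuous_on e (ti e)" if e: "e \<in> A" for e
    using continuous_on_inv_into_compact[of Sq "T e"] st[OF e] by (simp add: ti_def strip_def compact_Times)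
  have Xc: "continuous_on e (X e)" and Yc: "continuous_on e (Y e)" if e: "e \<in> A" for e
  proof -
    have sub: "ti e ` e \<subseteq> Sq" using ti[OF e] by blast
    show "continuous_on e (X e)" unfolding X_def by (rule continuous_on_compose2[OF nested.band_continuous(1)[OF nest[OF e]] tic[OF e] sub])
    show "continuous_on e (Y e)" unfolding Y_def by (rule continuous_on_compose2[OF nested.band_continuous(2)[OF nest[OF e]] tic[OF e] sub])
  qed
  have Fc: "continuous_on e (F e)" if e: "e \<in> A" for e
    unfolding F_def by (intro continuous_intros Xc Yc e)
  have Y0: "0 \<le> Y e x" if "e \<in> A" "x \<in> e" for e x
    using nested.bandY_nonneg[OF nest[OF that(1)]] ti[OF that] by (simp add: Y_def)
  have normF: "norm (F e x) = 1 + Y e x" if "e \<in> A" "x \<in> e" for e x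
  proof -
    have "norm (F e x) = \<bar>1 + Y e x\<bar>" unfolding F_def norm_mult norm_of_real norm_cis by simp
    then show ?thesis using Y0[OF that] by simp
  qed
  have YV: "x \<in> \<Union>V" if e: "e \<in> A" "x \<in> e" "Y e x = 0" for e x
  proof -
    have eE: "e \<in> E" using e A by auto
    obtain p q where pq: "ti e x = (p, q)" by (cases "ti e x")
    have "p = 0 \<or> p = 1" using nested.bandY_zero[OF nest[OF e(1)], of "ti e x"] ti[OF e(1,2)] e(3) pq by (simp add: Y_def)
    then have "x \<in> sL e \<or> x \<in> sR e"
      using ti[OF e(1,2)] pq T[OF e(1)] by (auto simp: sideL_def sideR_def)
    then show ?thesis using sL[OF eE] sR[OF eE] seg_sub(1)[of "sL e"] seg_sub(1)[of "sR e"] vV by blast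
  qed
  have agree: "kv v x = F e x" if ve: "v \<in> V" "x \<in> v" "e \<in> A" "x \<in> e" for v e x
  proof -
    have eE: "e \<in> E" using ve A by auto
    have "x \<in> sL e \<or> x \<in> sR e" using vertex_edge_meet[OF ve(1) eE ve(2,4)] by auto
    then consider y where "y \<in> I01" "x = T e (0, y)" "x \<in> sL e" | y where "y \<in> I01" "x = T e (1, y)" "x \<in> sR e"
    proof
      assume x: "x \<in> sL e"
      moreover have "sL e = sideL (T e)" using T[OF ve(3)] by simp
      ultimately have "\<exists>y\<in>I01. x = T e (0, y)" by (auto simp: sideL_def)
      then show ?thesis using x that(1) by blast
    next
      assume x: "x \<in> sR e"
      moreover have "sR e = sideR (T e)" using T[OF ve(3)] by simp
      ultimately have "\<exists>y\<in>I01. x = T e (1, y)" by (auto simp: sideR_def)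
      then show ?thesis using x that(2) by blast
    qed
    then show ?thesis
    proof cases
      case (1 y)
      have "ti e x = (0, y)" unfolding ti_def 1(2) using st[OF ve(3)] 1(1) by (intro inv_into_f_f) (auto simp: strip_def)
      then have "F e x = cis (l e y)" using nested.band_sides[OF nest[OF ve(3)]] by (simp add: F_def X_def Y_def)
      moreover have "vtx (sL e) = v" using seg_vtx_eq[OF _ 1(3) ve(1,2)] sL[OF eE] by simp
      ultimately show ?thesis using T[OF ve(3)] 1 by auto
    next
      case (2 y)
      have "ti e x = (1, y)" unfolding ti_def 2(2) using st[OF ve(3)] 2(1) by (intro inv_into_f_f) (auto simp: strip_def)
      then have "F e x = cis (r e y)" using nested.band_sides[OF nest[OF ve(3)]] by (simp add: F_def X_def Y_def)
      moreover have "vtx (sR e) = v" using seg_vtx_eq[OF _ 2(3) ve(1,2)] sR[OF eE] by simp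
      ultimately show ?thesis using T[OF ve(3)] 2 by auto
    qed
  qed
  have PV: "\<Phi> x = kv v x" if v: "v \<in> V" "x \<in> v" for v x
  proof -
    have u: "w = v" if "w \<in> V \<and> x \<in> w" for w using V_unique[of w v x] that v by auto
    have "(THE v. v \<in> V \<and> x \<in> v) = v" using v by (intro the_equality conjI) (assumption | rule u)+
    then show ?thesis using v by (auto simp: \<Phi>_def)
  qed
  have PE: "\<Phi> x = F e x" if e: "e \<in> A" "x \<in> e" for e x
  proof (cases "x \<in> \<Union>V")
    case True
    then obtain v where v: "v \<in> V" "x \<in> v" by blast
    show ?thesis using PV[OF v] agree[OF v e] by simp
  next
    case False
    have "e \<in> E" using e A by auto
    then have u: "w = e" if "w \<in> A \<and> x \<in> w" for w using E_unique[of w e x] that e A by auto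
    have "(THE e. e \<in> A \<and> x \<in> e) = e" using e by (intro the_equality conjI) (assumption | rule u)+
    then show ?thesis using False by (simp add: \<Phi>_def)
  qed
  have cont: "continuous_on (surf A) \<Phi>"
  proof -
    have "continuous_on Q \<Phi>" if Q: "Q \<in> V \<union> A" for Q
      using Q
    proof
      assume v: "Q \<in> V"
      show ?thesis by (rule continuous_on_eq[OF kv(1)[OF v]]) (simp add: PV[OF v])
    next
      assume e: "Q \<in> A"
      show ?thesis by (rule continuous_on_eq[OF Fc[OF e]]) (simp add: PE[OF e])
    qed
    moreover have "closed Q" if "Q \<in> V \<union> A" for Q
      using that disc_closed_connected[of Q] vertex_disc[of Q] edge_disc[of Q] A by blast
    moreover have "finite (V \<union> A)" using finite_V finite_E A finite_subset by blast
    ultimately have "continuous_on (\<Union>Q\<in>V \<union> A. Q) \<Phi>"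
      by (intro continuous_on_closed_Union) auto
    then show ?thesis by (simp add: rg_surface_def)
  qed
  have loc: "\<exists>U. openin (top_of_set (surf A)) U \<and> x \<in> U \<and> inj_on \<Phi> U" if x: "x \<in> surf A" for x
  proof -
    \<comment> \<open>Removing the discs that miss \<open>x\<close>, and the points of an edge that are half a turn or more away,
      leaves a neighbourhood of \<open>x\<close> on which the map is injective.\<close>
    define far where "far e = {z \<in> e. pi \<le> \<bar>X e z - X e x\<bar>}" for e
    define C where "C = \<Union>{v \<in> V. x \<notin> v} \<union> \<Union>{e \<in> A. x \<notin> e} \<union> (\<Union>e\<in>{e \<in> A. x \<in> e}. far e)"
    have "closed (far e)" if e: "e \<in> A" for e
    proof -
      have "closed e" using disc_closed_connected[OF edge_disc] e A by blast
      then have "closed (e \<inter> (\<lambda>z. \<bar>X e z - X e x\<bar>) -` {pi..})"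
        by (intro continuous_closed_preimage continuous_intros Xc e closed_atLeast)
      moreover have "far e = e \<inter> (\<lambda>z. \<bar>X e z - X e x\<bar>) -` {pi..}" by (auto simp: far_def)
      ultimately show ?thesis by simp
    qed
    moreover have "finite {e \<in> A. x \<in> e}" using A finite_E finite_subset by (metis (no_types, lifting) mem_Collect_eq subsetI)
    ultimately have "closed (\<Union>e\<in>{e \<in> A. x \<in> e}. far e)" by (intro closed_UN) auto
    moreover have "closed (\<Union>{v \<in> V. x \<notin> v})" by (rule closed_V) auto
    moreover have "closed (\<Union>{e \<in> A. x \<notin> e})" by (rule closed_E) (use A in auto)
    ultimately have "closed C" unfolding C_def by (intro closed_Un)
    then have op: "openin (top_of_set (surf A)) (surf A - C)" unfolding openin_open by (intro exI[of _ "- C"]) auto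
    have "x \<notin> far e" for e by (simp add: far_def not_le)
    then have xU: "x \<in> surf A - C" using x by (auto simp: C_def)
    have inE: "x \<in> e \<and> \<bar>X e z - X e x\<bar> < pi" if z: "z \<in> surf A - C" "e \<in> A" "z \<in> e" for z e
      using z by (auto simp: C_def far_def)
    have inV: "x \<in> v" if z: "z \<in> surf A - C" "v \<in> V" "z \<in> v" for z v
      using z by (auto simp: C_def)
    have same_V: "z = z'" if z: "z \<in> surf A - C" "z' \<in> surf A - C" "z \<in> \<Union>V" "z' \<in> \<Union>V" "\<Phi> z = \<Phi> z'" for z z'
    proof -
      obtain v where v: "v \<in> V" "z \<in> v" using z(3) by blast
      obtain v' where v': "v' \<in> V" "z' \<in> v'" using z(4) by blast
      have "v' = v" using V_unique[OF v'(1) v(1)] inV[OF z(1) v] inV[OF z(2) v'] by blast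
      then show ?thesis using PV[OF v] PV[OF v'] z(5) kv(2)[OF v(1)] v v' by (auto dest: inj_onD)
    qed
    have VE: "z' \<in> \<Union>V" if z: "z \<in> \<Union>V" "e \<in> A" "z' \<in> e" "\<Phi> z = \<Phi> z'" for z z' e
    proof -
      obtain v where v: "v \<in> V" "z \<in> v" using z(1) by blast
      have "norm (\<Phi> z) \<le> 1" using PV[OF v] kv(3)[OF v] by simp
      then have "1 + Y e z' \<le> 1" using PE[OF z(2,3)] normF[OF z(2,3)] z(4) by simp
      then have "Y e z' = 0" using Y0[OF z(2,3)] by simp
      then show ?thesis using YV[OF z(2,3)] by simp
    qed
    have "inj_on \<Phi> (surf A - C)"
    proof (rule inj_onI)
      fix z z' assume z: "z \<in> surf A - C" "z' \<in> surf A - C" "\<Phi> z = \<Phi> z'"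
      consider "z \<in> \<Union>V" "z' \<in> \<Union>V" | e where "z \<in> \<Union>V" "e \<in> A" "z' \<in> e" | e where "z' \<in> \<Union>V" "e \<in> A" "z \<in> e"
        | e e' where "e \<in> A" "z \<in> e" "e' \<in> A" "z' \<in> e'"
        using z(1,2) unfolding rg_surface_def by blast
      then show "z = z'"
      proof cases
        case 1
        then show ?thesis using same_V z by blast
      next
        case 2
        then show ?thesis using same_V[OF z(1,2) 2(1) VE[OF 2 z(3)] z(3)] by simp
      next
        case 3
        then show ?thesis using same_V[OF z(1,2) VE[OF 3 z(3)[symmetric]] 3(1) z(3)] by simp
      next
        case (4 e e')
        note i = inE[OF z(1) 4(1,2)] inE[OF z(2) 4(3,4)]
        have ee: "e' = e" using E_unique[of e' e x] i 4 A by blast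
        have z'e: "z' \<in> e" using 4 ee by simp
        have eq: "F e z = F e z'" using PE[OF 4(1,2)] PE[OF 4(1) z'e] z(3) by simp
        then have Yeq: "Y e z = Y e z'" using normF[OF 4(1,2)] normF[OF 4(1) z'e] by simp
        have "1 + Y e z' \<noteq> 0" using Y0[OF 4(1) z'e] by simp
        then have "complex_of_real (1 + Y e z') \<noteq> 0" by (simp only: of_real_eq_0_iff not_False_eq_True)
        then have c: "cis (X e z) = cis (X e z')" using eq Yeq unfolding F_def by simp
        have "\<bar>X e z - X e x\<bar> < pi" "\<bar>X e z' - X e x\<bar> < pi" using i unfolding ee by auto
        then have "\<bar>X e z - X e z'\<bar> < 2 * pi" by linarith
        then have Xeq: "X e z = X e z'" by (rule cis_inj[OF c])
        have tz: "ti e z \<in> Sq" "T e (ti e z) = z" "ti e z' \<in> Sq" "T e (ti e z') = z'"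
          using ti[OF 4(1,2)] ti[OF 4(1) z'e] by auto
        have "ti e z = ti e z'"
          using nested.band_inj[OF nest[OF 4(1)] tz(1,3)] Xeq Yeq unfolding X_def Y_def by blast
        then have "T e (ti e z) = T e (ti e z')" by (rule arg_cong)
        then show ?thesis unfolding tz(2,4) .
      qed
    qed
    then show ?thesis using op xU by blast
  qed
  show ?thesis by (rule that[OF cont loc])
qed

text \<open>The immersion of the surface would restrict to an immersion of a Moebius band.\<close>

lemma balanced_orientable: "\<not> nonorientable (surf A)"
proof
  assume "nonorientable (surf A)"
  then obtain M where M: "M \<subseteq> surf A" "moebius_band M" by (auto simp: nonorientable_def)
  obtain \<Phi> :: "'a \<Rightarrow> complex" where \<Phi>: "continuous_on (surf A) \<Phi>"
    "\<And>x. x \<in> surf A \<Longrightarrow> \<exists>U. openin (top_of_set (surf A)) U \<and> x \<in> U \<and> inj_on \<Phi> U"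
    by (rule balanced_immersion) blast
  show False
  proof (rule moebius_not_immersible[OF M(2) continuous_on_subset[OF \<Phi>(1) M(1)]])
    fix x assume x: "x \<in> M"
    then obtain U where U: "openin (top_of_set (surf A)) U" "x \<in> U" "inj_on \<Phi> U" using \<Phi>(2)[of x] M(1) by auto
    have "openin (top_of_set M) (M \<inter> U)"
    proof -
      obtain S where "open S" "U = surf A \<inter> S" using U(1) by (auto simp: openin_open)
      then show ?thesis using M(1) unfolding openin_open by (intro exI[of _ S]) auto
    qed
    moreover have "inj_on \<Phi> (M \<inter> U)" using U(3) by (rule inj_on_subset) auto
    ultimately show "\<exists>U. openin (top_of_set M) U \<and> x \<in> U \<and> inj_on \<Phi> U" using x U(2) by blast
  qed
qed

end

end

section \<open>Surfaces without a colouring contain a Moebius band\<close>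

context ribbon_charts
begin

text \<open>A strip that is made of vertices and compatible edges alternately, beginning and ending with a vertex, has an
odd number of parts and so joins flags of different colours; \<open>c\<close> records this parity.\<close>

definition coloured_strip :: "('a \<Rightarrow> bool) \<Rightarrow> bool \<Rightarrow> 'a set \<Rightarrow> 'a set \<Rightarrow> 'a set \<Rightarrow> bool" where
  "coloured_strip eps c M s s' \<longleftrightarrow> (\<exists>H. strip H M \<and> sideL H = s \<and> sideR H = s' \<and>
     (eps (H (0, 0)) \<noteq> eps (H (1, 0)) \<longleftrightarrow> c))"

definition flips :: "('a \<Rightarrow> bool) \<Rightarrow> 'a set \<Rightarrow> bool" where
  "flips eps s \<longleftrightarrow> (\<forall>p q. ends s = {p, q} \<longrightarrow> p \<noteq> q \<longrightarrow> eps p \<noteq> eps q)"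

lemma flips_sides:
  assumes H: "strip H M"
  shows "flips eps (sideL H) \<Longrightarrow> eps (H (0, 1)) \<longleftrightarrow> \<not> eps (H (0, 0))" "flips eps (sideR H) \<Longrightarrow> eps (H (1, 1)) \<longleftrightarrow> \<not> eps (H (1, 0))"
proof -
  have "H (0, 0) \<noteq> H (0, 1)" "H (1, 0) \<noteq> H (1, 1)" by (simp_all add: strip_eq_iff[OF H])
  then show "flips eps (sideL H) \<Longrightarrow> eps (H (0, 1)) \<longleftrightarrow> \<not> eps (H (0, 0))" "flips eps (sideR H) \<Longrightarrow> eps (H (1, 1)) \<longleftrightarrow> \<not> eps (H (1, 0))"
    using ends_side[OF H] unfolding flips_def by blast+
qed

lemma coloured_strip_sides: "coloured_strip eps c M s s' \<Longrightarrow> s \<subseteq> M \<and> s' \<subseteq> M"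
  using stripD(3) by (fastforce simp: coloured_strip_def sideL_def sideR_def)

lemma coloured_strip_join:
  assumes 1: "coloured_strip eps c M s t" and 2: "coloured_strip eps c' N t u" and MN: "M \<inter> N = t"
    and fl: "flips eps t" "flips eps u"
  shows "coloured_strip eps (c \<noteq> c') (M \<union> N) s u"
proof -
  obtain H1 where H1: "strip H1 M" "sideL H1 = s" "sideR H1 = t" "eps (H1 (0, 0)) \<noteq> eps (H1 (1, 0)) \<longleftrightarrow> c"
    using 1 unfolding coloured_strip_def by blast
  obtain K where K: "strip K N" "sideL K = t" "sideR K = u" "eps (K (0, 0)) \<noteq> eps (K (1, 0)) \<longleftrightarrow> c'"
    using 2 unfolding coloured_strip_def by blast
  have "sideR H1 = sideL K" using H1 K by simp
  then obtain H2 where H2: "strip H2 N" "sideL H2 = sideL K" "sideR H2 = sideR K" "H1 (1, 0) = H2 (0, 0)" "H1 (1, 1) = H2 (0, 1)"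
    "H2 = K \<or> H2 = (\<lambda>z. K (fst z, 1 - snd z))"
    by (rule strip_align[OF H1(1) K(1)])
  have "eps (K (0, 1)) \<longleftrightarrow> \<not> eps (K (0, 0))" "eps (K (1, 1)) \<longleftrightarrow> \<not> eps (K (1, 0))"
    using flips_sides[OF K(1)] K fl by auto
  then have col2: "eps (H2 (0, 0)) \<noteq> eps (H2 (1, 0)) \<longleftrightarrow> c'" using H2(6) K(4) by auto
  obtain H where H: "strip H (M \<union> N)" "\<And>y. y \<in> I01 \<Longrightarrow> H (0, y) = H1 (0, y) \<and> H (1/2, y) = H1 (1, y) \<and> H (1, y) = H2 (1, y)"
    by (rule strip_join[OF H1(1) H2(1)]) (use MN H1 H2 K in auto)
  have "sideL H = sideL H1" "sideR H = sideR H2" unfolding sideL_def sideR_def using H(2) by auto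
  moreover have "eps (H (0, 0)) \<noteq> eps (H (1, 0)) \<longleftrightarrow> (c \<noteq> c')"
    using H(2)[of 0] H1(4) H2(4) col2 by auto
  ultimately show ?thesis
    unfolding coloured_strip_def using H(1) H1(2) H2(3) K(3) by (intro exI[of _ H]) simp
qed

lemma vertex_strip:
  assumes s: "s \<in> Seg" "s' \<in> Seg" "vtx s' = vtx s" "s \<noteq> s'"
  obtains H where "strip H (vtx s)" "sideL H = s" "sideR H = s'" "H (0, 0) = start s" "H (1, 0) = fin s'"
proof -
  interpret disjoint_intervals "segs_at (vtx s)" lo hi "base (vtx s)" "full (vtx s)" by (rule intervals[OF s(1)])
  have at: "s \<in> segs_at (vtx s)" "s' \<in> segs_at (vtx s)" using s by (auto simp: segs_at_def)
  note b = lohi[OF at(1)] lohi[OF at(2)]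
  note v = vV[OF s(1)]
  have arcs: "s = g (vtx s) ` cis ` {lo s..hi s}" "s' = g (vtx s) ` cis ` {lo s'..hi s'}"
    using seg_arc[OF s(1)] seg_arc[OF s(2)] s(3) by auto
  have fin': "fin s' = g (vtx s) (cis (hi s'))" by (simp add: fin_def s(3))
  from disj[OF at s(4)] show ?thesis
  proof
    assume lt: "hi s < lo s'"
    obtain H where "strip H (vtx s)" "sideL H = g (vtx s) ` cis ` {lo s..hi s}" "sideR H = g (vtx s) ` cis ` {lo s'..hi s'}"
      "H (0, 0) = g (vtx s) (cis (lo s))" "H (1, 0) = g (vtx s) (cis (hi s'))"
      by (rule disc_strip[OF g[OF v], of "lo s" "hi s" "lo s'" "hi s'"]) (use lt b in \<open>auto simp: full_def\<close>)
    then show ?thesis using arcs fin' by (intro that[of H]) (simp_all add: start_def)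
  next
    assume lt: "hi s' < lo s"
    let ?c = "lo s' + 2 * pi" and ?d = "hi s' + 2 * pi"
    have shift: "cis (t + 2 * pi) = cis t" for t using cis_shift[of t 1] by simp
    have "{?c..?d} = (\<lambda>t. t + 2 * pi) ` {lo s'..hi s'}" by simp
    then have "cis ` {?c..?d} = (\<lambda>t. cis (t + 2 * pi)) ` {lo s'..hi s'}" by (simp only: image_image)
    then have im: "cis ` {?c..?d} = cis ` {lo s'..hi s'}" unfolding shift .
    obtain H where "strip H (vtx s)" "sideL H = g (vtx s) ` cis ` {lo s..hi s}" "sideR H = g (vtx s) ` cis ` {?c..?d}"
      "H (0, 0) = g (vtx s) (cis (lo s))" "H (1, 0) = g (vtx s) (cis ?d)"
      by (rule disc_strip[OF g[OF v], of "lo s" "hi s" "?c" "?d"]) (use lt b in \<open>auto simp: full_def\<close>)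
    then show ?thesis using arcs fin' im shift by (intro that[of H]) (simp_all add: start_def)
  qed
qed

context
  fixes T :: "'a set set" and eps :: "'a \<Rightarrow> bool"
  assumes T: "T \<subseteq> E" and bal: "balances eps T"
begin

lemma flips_seg: "s \<in> Seg \<Longrightarrow> flips eps s"
  using eps_flip[OF T bal] ends_seg by (auto simp: flips_def doubleton_eq_iff)

lemma coloured_vertex:
  assumes s: "s \<in> Seg" "s' \<in> Seg" "vtx s' = vtx s" "s \<noteq> s'"
  shows "coloured_strip eps True (vtx s) s s'"
proof -
  obtain H where H: "strip H (vtx s)" "sideL H = s" "sideR H = s'" "H (0, 0) = start s" "H (1, 0) = fin s'"
    by (rule vertex_strip[OF s])
  have "eps (start s) = eps (start s')" using eps_vertex[OF T bal s(1,2)] s(3) by simp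
  then have "eps (H (0, 0)) \<noteq> eps (H (1, 0))" using eps_flip[OF T bal s(2)] H(4,5) by auto
  then show ?thesis using H(1-3) unfolding coloured_strip_def by blast
qed

lemma coloured_edge:
  assumes s: "s \<in> Seg" "s' \<in> Seg" "edg s' = edg s" "s \<noteq> s'" and t: "edg s \<in> T"
  shows "coloured_strip eps True (edg s) s s'"
proof -
  let ?e = "edg s"
  have e: "?e \<in> E" using edg[OF s(1)] by simp
  have col: "eps (sq ?e (0, 0)) \<noteq> eps (sq ?e (1, 0))" using balances_side[OF bal t] by (simp add: ca_def cc_def)
  consider "s = sL ?e" "s' = sR ?e" | "s = sR ?e" "s' = sL ?e" using seg_LR[OF s(1)] seg_LR[OF s(2)] s(3,4) by metis
  then show ?thesis
  proof cases
    case 1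
    have "strip (sq ?e) ?e \<and> sideL (sq ?e) = s \<and> sideR (sq ?e) = s'" using 1 strip_e[OF e] by (simp add: sL_def sR_def)
    then show ?thesis using col unfolding coloured_strip_def by blast
  next
    case 2
    let ?H = "\<lambda>z. sq ?e (1 - fst z, snd z)"
    have "strip ?H ?e \<and> sideL ?H = s \<and> sideR ?H = s'"
      using 2 strip_reverse[OF strip_e[OF e]] by (simp add: sL_def sR_def sides_reverse)
    moreover have "eps (?H (0, 0)) \<noteq> eps (?H (1, 0))" using col by simp
    ultimately show ?thesis unfolding coloured_strip_def by blast
  qed
qed

definition adj :: "'a set \<Rightarrow> 'a set \<Rightarrow> bool" where
  "adj v w \<longleftrightarrow> v \<noteq> w \<and> (\<exists>s\<in>Seg. \<exists>s'\<in>Seg. edg s = edg s' \<and> edg s \<in> T \<and> vtx s = v \<and> vtx s' = w)"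

text \<open>The edges of the forest with both segments on vertices in \<open>W\<close>.\<close>

definition inner :: "'a set set \<Rightarrow> 'a set set" where
  "inner W = {t \<in> T. vtx (sL t) \<in> W \<and> vtx (sR t) \<in> W}"

lemma inner_seg: "s \<in> Seg \<Longrightarrow> edg s \<in> inner W \<Longrightarrow> vtx s \<in> W"
  using seg_LR[of s] by (auto simp: inner_def)

lemma inner_mono: "W \<subseteq> W' \<Longrightarrow> inner W \<subseteq> inner W'"
  by (auto simp: inner_def)

text \<open>The strip follows the path. That no vertex is repeated makes its parts meet in the expected segments only;
the bound on \<open>M\<close> keeps this invariant in the induction.\<close>

lemma path_strip:
  assumes "rtrancl_path adj u vs w" "distinct (u # vs)"
    and s: "s \<in> Seg" "vtx s = u" "edg s \<notin> inner (set (u # vs))" and s': "s' \<in> Seg" "vtx s' = w" "edg s' \<notin> T" "s \<noteq> s'"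
  shows "\<exists>M. coloured_strip eps True M s s' \<and> M \<subseteq> \<Union>(set (u # vs)) \<union> \<Union>(inner (set (u # vs))) \<and> set (u # vs) \<subseteq> V"
  using assms(1,2) s s'(2,4)
proof (induction arbitrary: s rule: rtrancl_path.induct)
  case (base u)
  then show ?case
    using coloured_vertex[of s s'] s'(1) vV[of s] by (intro exI[of _ u]) auto
next
  case (step x y ys w)
  have xy: "x \<noteq> y" using step.hyps(1) by (simp add: adj_def)
  obtain s1 s2 where s12: "s1 \<in> Seg" "s2 \<in> Seg" "edg s1 = edg s2" "edg s1 \<in> T" "vtx s1 = x" "vtx s2 = y"
    using step.hyps(1) unfolding adj_def by blast
  let ?t = "edg s1" and ?W = "set (y # ys)" and ?W' = "set (x # y # ys)"
  have tE: "?t \<in> E" using edg[OF s12(1)] by simp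
  have ne12: "s1 \<noteq> s2" using s12 xy by auto
  have LR: "{s1, s2} = {sL ?t, sR ?t}" using seg_LR[OF s12(1)] seg_LR[OF s12(2)] s12(3) ne12 by auto
  then have t': "?t \<in> inner ?W'" using s12 by (auto simp: inner_def doubleton_eq_iff)
  have x: "x \<notin> ?W" using step.prems(1) by auto
  have xV: "x \<in> V" using vV[OF s12(1)] s12(5) by simp
  have "edg s2 \<notin> inner ?W" using LR x s12 by (auto simp: inner_def doubleton_eq_iff)
  moreover have "s2 \<noteq> s'" using s12 s'(3) by auto
  moreover have "distinct (y # ys)" using step.prems(1) by simp
  ultimately obtain N where N: "coloured_strip eps True N s2 s'" "N \<subseteq> \<Union>?W \<union> \<Union>(inner ?W)" "?W \<subseteq> V"
    using step.IH[of s2] s12(2,6) step.prems(5) by blast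
  have ss1: "s \<noteq> s1" using step.prems(4) t' by auto
  have cx: "coloured_strip eps True x s s1"
    using coloured_vertex[of s s1] step.prems(2,3) s12(1,5) ss1 by simp
  have ct: "coloured_strip eps True ?t s1 s2" using coloured_edge[of s1 s2] s12 ne12 by simp
  have tmeet: "z \<in> s1 \<and> v = x \<or> z \<in> s2 \<and> v = y" if z: "z \<in> ?t" "z \<in> v" "v \<in> V" for z v
  proof -
    have "z \<in> s1 \<or> z \<in> s2" using vertex_edge_meet[OF z(3) tE z(2,1)] LR by auto
    then show ?thesis using seg_vtx_eq[OF s12(1) _ z(3,2)] seg_vtx_eq[OF s12(2) _ z(3,2)] s12(5,6) by auto
  qed
  have xt: "x \<inter> ?t = s1"
    using tmeet[OF _ _ xV] xy seg_sub[OF s12(1)] s12(5) by auto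
  have c1: "coloured_strip eps False (x \<union> ?t) s s2"
    using coloured_strip_join[OF cx ct xt flips_seg[OF s12(1)] flips_seg[OF s12(2)]] by simp
  have xtN: "(x \<union> ?t) \<inter> N = s2"
  proof (intro set_eqI iffI)
    fix z assume z: "z \<in> (x \<union> ?t) \<inter> N"
    then consider v where "v \<in> ?W" "z \<in> v" | t where "t \<in> inner ?W" "z \<in> t" using N(2) by blast
    then show "z \<in> s2"
    proof cases
      case (1 v)
      then have v: "v \<in> V" "v \<noteq> x" using N(3) x by auto
      then have "z \<notin> x" using V_unique[OF v(1) xV 1(2)] by auto
      then show ?thesis using tmeet[OF _ 1(2) v(1)] z v(2) by auto
    next
      case (2 t)
      have tE': "t \<in> E" using 2(1) T by (auto simp: inner_def)
      have "z \<notin> x"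
      proof
        assume "z \<in> x"
        then obtain q where q: "q \<in> Seg" "vtx q = x" "edg q = t" using in_seg[OF xV tE' _ 2(2)] by blast
        then show False using inner_seg[OF q(1), of ?W] 2(1) x by simp
      qed
      then have "z \<in> ?t" using z by auto
      then have "t = ?t" using E_unique[OF tE' tE 2(2)] by simp
      then have "vtx s1 \<in> ?W" using inner_seg[OF s12(1), of ?W] 2(1) by simp
      then show ?thesis using x s12(5) by simp
    qed
  next
    fix z assume "z \<in> s2"
    then show "z \<in> (x \<union> ?t) \<inter> N" using coloured_strip_sides[OF N(1)] seg_sub(2)[OF s12(2)] s12(3) by auto
  qed
  have "coloured_strip eps True ((x \<union> ?t) \<union> N) s s'"
    using coloured_strip_join[OF c1 N(1) xtN flips_seg[OF s12(2)] flips_seg[OF s'(1)]] by simp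
  moreover have "(x \<union> ?t) \<union> N \<subseteq> \<Union>?W' \<union> \<Union>(inner ?W')"
  proof -
    have "inner ?W \<subseteq> inner ?W'" by (rule inner_mono) auto
    then have "\<Union>(inner ?W) \<subseteq> \<Union>(inner ?W')" by (rule Union_mono)
    moreover have "\<Union>?W \<subseteq> \<Union>?W'" by (rule Union_mono) auto
    ultimately have "N \<subseteq> \<Union>?W' \<union> \<Union>(inner ?W')" by (intro subset_trans[OF N(2)] Un_mono)
    moreover have "x \<subseteq> \<Union>?W'" by auto
    moreover have "?t \<subseteq> \<Union>(inner ?W')" using t' by blast
    ultimately show ?thesis by blast
  qed
  ultimately show ?case using N(3) xV by (intro exI[of _ "(x \<union> ?t) \<union> N"]) simp
qed

lemma conn_adj:
  assumes "(p, q) \<in> conn (Rk T)" "p \<in> v" "v \<in> V"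
  shows "\<exists>w\<in>V. q \<in> w \<and> adj\<^sup>*\<^sup>* v w"
  using assms(1)
proof (induction rule: conn_induct)
  case refl
  then show ?case using assms by auto
next
  case (step q r)
  then obtain w where w: "w \<in> V" "q \<in> w" "adj\<^sup>*\<^sup>* v w" by blast
  have adj_sym: "adj x y \<Longrightarrow> adj y x" for x y unfolding adj_def by metis
  have pair: "(\<exists>u\<in>V. x \<in> u \<and> y \<in> u) \<or> (\<exists>u\<in>V. \<exists>u'\<in>V. x \<in> u \<and> y \<in> u' \<and> adj u u')" if xy: "(x, y) \<in> Rk T" for x y
  proof -
    show ?thesis
    proof (cases "\<exists>u\<in>V. x \<in> u \<and> y \<in> u")
      case False
      then have "(x, y) \<notin> Rk {}"
        using marked_cover.edge[OF surface_cover_marked[of "{}"], of x y] by auto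
      then obtain t where t: "t \<in> T" "x = ca t \<and> y = cc t \<or> x = cb t \<and> y = cd t"
        using xy unfolding Rk_def sides_def by blast
      have tE: "t \<in> E" using t T by auto
      have S: "sL t \<in> Seg" "edg (sL t) = t" "sR t \<in> Seg" "edg (sR t) = t" using sL[OF tE] sR[OF tE] by auto
      have in': "x \<in> vtx (sL t)" "y \<in> vtx (sR t)"
        using t(2) corners_in[OF tE] seg_sub(1)[OF S(1)] seg_sub(1)[OF S(3)] by auto
      have "vtx (sL t) \<noteq> vtx (sR t)" using False in' vV[OF S(1)] by auto
      then have "adj (vtx (sL t)) (vtx (sR t))" unfolding adj_def using S t(1) by metis
      then show ?thesis using in' vV[OF S(1)] vV[OF S(3)] by blast
    qed simp
  qed
  from step.hyps(2) have "(\<exists>u\<in>V. q \<in> u \<and> r \<in> u) \<or> (\<exists>u\<in>V. \<exists>u'\<in>V. q \<in> u \<and> r \<in> u' \<and> adj u u')"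
    using pair[of q r] pair[of r q] adj_sym by blast
  then show ?case
  proof
    assume "\<exists>u\<in>V. q \<in> u \<and> r \<in> u"
    then obtain u where u: "u \<in> V" "q \<in> u" "r \<in> u" by blast
    have "u = w" by (rule V_unique[OF u(1) w(1) u(2) w(2)])
    then show ?case using w u by blast
  next
    assume "\<exists>u\<in>V. \<exists>u'\<in>V. q \<in> u \<and> r \<in> u' \<and> adj u u'"
    then obtain u u' where u: "u \<in> V" "u' \<in> V" "q \<in> u" "r \<in> u'" "adj u u'" by blast
    have "u = w" by (rule V_unique[OF u(1) w(1) u(3) w(2)])
    then have "adj\<^sup>*\<^sup>* v u'" using w(3) u(5) by simp
    then show ?case using u by blast
  qed
qed

text \<open>The strip along the path joins flags of different colours, the violating edge joins flags of equal colours;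
so the ends are identified with a reflection.\<close>

lemma moebius_from_edge:
  assumes e: "e \<in> E" "e \<notin> T" and col: "eps (ca e) = eps (cc e)" and conn: "(ca e, cc e) \<in> conn (Rk T)"
  shows "nonorientable (surf (insert e T))"
proof -
  have S: "sL e \<in> Seg" "edg (sL e) = e" "sR e \<in> Seg" "edg (sR e) = e" "sL e \<noteq> sR e" using sL[OF e(1)] sR[OF e(1)] sLR[OF e(1)] by auto
  let ?u = "vtx (sR e)" and ?w = "vtx (sL e)"
  have "ca e \<in> ?w" "cc e \<in> ?u" using corners_in[OF e(1)] seg_sub(1)[OF S(1)] seg_sub(1)[OF S(3)] by auto
  moreover have "(cc e, ca e) \<in> conn (Rk T)" by (rule conn_sym[OF conn])
  ultimately obtain w where "w \<in> V" "ca e \<in> w" "adj\<^sup>*\<^sup>* ?u w" using conn_adj[of "cc e" "ca e" ?u] vV[OF S(3)] by blast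
  then have "adj\<^sup>*\<^sup>* ?u ?w" using V_unique[OF _ vV[OF S(1)], of w "ca e"] \<open>ca e \<in> ?w\<close> by simp
  then obtain vs where vs: "rtrancl_path adj ?u vs ?w" by (auto simp: rtranclp_eq_rtrancl_path)
  obtain vs' where vs': "rtrancl_path adj ?u vs' ?w" "distinct (?u # vs')" by (rule rtrancl_path_distinct[OF vs])
  have ni: "edg (sR e) \<notin> inner W" "edg (sL e) \<notin> inner W" for W using e(2) S by (auto simp: inner_def)
  obtain M where M: "coloured_strip eps True M (sR e) (sL e)" "M \<subseteq> \<Union>(set (?u # vs')) \<union> \<Union>(inner (set (?u # vs')))" "set (?u # vs') \<subseteq> V"
    using path_strip[OF vs' S(3) refl ni(1) S(1) refl] S e(2) by auto
  obtain H1 where H1: "strip H1 M" "sideL H1 = sR e" "sideR H1 = sL e" "eps (H1 (0, 0)) \<noteq> eps (H1 (1, 0))"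
    using M(1) unfolding coloured_strip_def by blast
  have Me: "M \<inter> e = sideL H1 \<union> sideR H1"
  proof (intro set_eqI iffI)
    fix z assume z: "z \<in> M \<inter> e"
    then consider v where "v \<in> V" "z \<in> v" | t where "t \<in> T" "z \<in> t" using M(2,3) unfolding inner_def by blast
    then show "z \<in> sideL H1 \<union> sideR H1"
    proof cases
      case (1 v)
      then show ?thesis using vertex_edge_meet[OF 1(1) e(1) 1(2)] z H1 by auto
    next
      case (2 t)
      then show ?thesis using E_unique[of t e z] z T e by blast
    qed
  next
    fix z assume "z \<in> sideL H1 \<union> sideR H1"
    then show "z \<in> M \<inter> e" using H1(2,3) coloured_strip_sides[OF M(1)] seg_sub(2)[OF S(1)] seg_sub(2)[OF S(3)] S by auto
  qed
  have "sideR H1 = sideL (sq e)" using H1(3) by (simp add: sL_def)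
  then obtain H2 where H2: "strip H2 e" "sideL H2 = sideL (sq e)" "sideR H2 = sideR (sq e)" "H1 (1, 0) = H2 (0, 0)" "H1 (1, 1) = H2 (0, 1)"
    "H2 = sq e \<or> H2 = (\<lambda>z. sq e (fst z, 1 - snd z))"
    by (rule strip_align[OF H1(1) strip_e[OF e(1)]])
  have "eps (cb e) = eps (cd e)" using col balances_seg[OF bal e(1)] by auto
  then have c2: "eps (H2 (0, 0)) = eps (H2 (1, 0))" using H2(6) col by (auto simp: ca_def cb_def cc_def cd_def)
  have "{H2 (1, 0), H2 (1, 1)} = {H1 (0, 0), H1 (0, 1)}"
    using ends_side(2)[OF H2(1)] ends_side(1)[OF H1(1)] H2(3) H1(2) by (simp add: sR_def)
  moreover have "H2 (1, 0) \<noteq> H1 (0, 0)" using c2 H1(4) H2(4) by auto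
  ultimately have "H2 (1, 0) = H1 (0, 1)" "H2 (1, 1) = H1 (0, 0)" by (auto simp: doubleton_eq_iff)
  then have "moebius_band (M \<union> e)"
    using H1(2,3) H2 by (intro strips_moebius[OF H1(1) H2(1) Me]) (simp_all add: sL_def sR_def)
  moreover have "M \<union> e \<subseteq> surf (insert e T)"
  proof -
    have "\<Union>(inner (set (?u # vs'))) \<subseteq> \<Union>T" by (rule Union_mono) (auto simp: inner_def)
    moreover have "\<Union>(set (?u # vs')) \<subseteq> \<Union>V" using M(3) by (rule Union_mono)
    ultimately have "M \<subseteq> \<Union>V \<union> \<Union>T" by (intro subset_trans[OF M(2)] Un_mono)
    then show ?thesis unfolding rg_surface_def by auto
  qed
  ultimately show ?thesis unfolding nonorientable_def by blast
qed

end

theorem nonorientable_iff: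
  assumes A: "A \<subseteq> E"
  shows "nonorientable (surf A) \<longleftrightarrow> (\<nexists>eps. balances eps A)"
proof
  assume "nonorientable (surf A)"
  then show "\<nexists>eps. balances eps A" using balanced_orientable[OF A] by blast
next
  assume "\<nexists>eps. balances eps A"
  then obtain T eps e where T: "T \<subseteq> A" "balances eps T" "nf T = nk T" "conn (Rk T) = conn (Rk A)"
    "e \<in> A" "e \<notin> T" "eps (ca e) = eps (cc e)"
    by (rule unbalanced_edge[OF A])
  have e: "e \<in> E" and TE: "T \<subseteq> E" using A T by auto
  have "(ca e, cc e) \<in> Rk A" using T(5) by (auto simp: Rk_def sides_def)
  then have "(ca e, cc e) \<in> conn (Rk T)" using conn_base T(4) by metis
  then have "nonorientable (surf (insert e T))" by (rule moebius_from_edge[OF TE T(2) e T(6,7)])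
  moreover have "surf (insert e T) \<subseteq> surf A" using T by (auto simp: rg_surface_def)
  ultimately show "nonorientable (surf A)" unfolding nonorientable_def by blast
qed

section \<open>Equality of the polynomials\<close>

theorem BR_ribbon_eq: "BR_ribbon V E = BR_delta (rg_delta_matroid V E)"
proof -
  have D: "rg_delta_matroid V E = quasi_trees E"
    unfolding rg_delta_matroid_def quasi_trees_def using rg_f_eq rg_k_eq by auto
  show ?thesis
    unfolding D BR_quasi_trees BR_ribbon_def
    by (intro arg_cong[where f = abs_br_ring] sum.cong refl)
      (auto simp: rg_rank_def rg_nullity_def rg_genus_def rg_t_def rg_k_eq rg_f_eq card_V nonorientable_iff)
qed

end

theorem theorem6p4:
  fixes V E :: "'a::t2_space set set"
  assumes "ribbon_graph V E"
  shows "BR_ribbon V E = BR_delta (rg_delta_matroid V E)"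
proof -
  interpret ribbon_graph V E by (rule assms)
  obtain g sq lo hi base where "ribbon_charts V E g sq lo hi base" by (rule charts_exist)
  then interpret ribbon_charts V E g sq lo hi base .
  show ?thesis by (rule BR_ribbon_eq)
qed

end
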